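(* Let $C$ be a contractible globular extension with a pregroupoidal structure and let $f\colon G\to H$ be a morphism of $\infty$-groupoids of type $C$. The following are equivalent: (1) $f$ is a weak equivalence; (2) $\pi_0(f)\colon\pi_0(G)\to\pi_0(H)$ is a bijection and for every $n\ge1$ and every $(n-1)$-arrow $u$ of $G$, $f$ induces a group isomorphism $\pi_n(G,u)\to\pi_n(H,f(u))$; (3) the functor $\Pi_1(f)\colon\Pi_1(G)\to\Pi_1(H)$ is an equivalence of categories and for every $n\ge2$ and every pair $u,v$ of parallel $(n-1)$-arrows of $G$, $f$ induces a bijection $\pi_n(G,u,v)\to\pi_n(H,f(u),f(v))$; (4) the functor $\Pi_1(f)$ is full and essentially surjective and for every $n\ge2$ and every pair $u,v$ of parallel $(n-1)$-arrows of $G$, $f$ induces a surjection $\pi_n(G,u,v)\to\pi_n(H,f(u),f(v))$.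
   Context: The globe category $\mathbb{G}$ has objects $D_n$ ($n\ge0$), generated by $\sigma_n,\tau_n\colon D_{n-1}\to D_n$ ($n\ge1$) with $\sigma_{n+1}\sigma_n=\tau_{n+1}\sigma_n$, $\sigma_{n+1}\tau_n=\tau_{n+1}\tau_n$; $\sigma^i_j=\sigma_i\cdots\sigma_{j+1}$, $\tau^i_j=\tau_i\cdots\tau_{j+1}$. A table of dimensions: integers $i_1,\dots,i_n,i'_1,\dots,i'_{n-1}$ with $i_k>i'_k<i_{k+1}$; dimension = largest entry. In a category $C$ under $\mathbb{G}$, its globular sum is the colimit of $D_{i_1}\xleftarrow{\sigma^{i_1}_{i'_1}}D_{i'_1}\xrightarrow{\tau^{i_2}_{i'_1}}D_{i_2}\leftarrow\cdots\xrightarrow{\tau^{i_n}_{i'_{n-1}}}D_{i_n}$, written $D_{i_1}\amalg_{D_{i'_1}}\cdots\amalg_{D_{i'_{n-1}}}D_{i_n}$. A globular extension is a category under $\mathbb{G}$ with all globular sums. $f,g\colon D_n\to X$ are globularly parallel if $n=0$ or $f\sigma_n=g\sigma_n$, $f\tau_n=g\tau_n$; a lifting of $(f,g)$ is $h\colon D_{n+1}\to X$ with $h\sigma_{n+1}=f$, $h\tau_{n+1}=g$; $(f,g)\colon D_n\to S$ is admissible if globularly parallel with $S$ a globular sum of dimension $\le n+1$; $C$ is contractible if every admissible pair has a lifting. An $\infty$-groupoid of type $C$ is a presheaf $G$ on $C$ such that each canonical map $G(D_{i_1}\amalg_{D_{i'_1}}\cdots\amalg_{D_{i'_{n-1}}}D_{i_n})\to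 G_{i_1}\times_{G_{i'_1}}\cdots\times_{G_{i'_{n-1}}}G_{i_n}$ is bijective, where $G_i=G(D_i)$ ($i$-arrows), $s=G(\sigma_i)$, $t=G(\tau_i)$ (source, target), $s^i_j=G(\sigma^i_j)$, $t^i_j=G(\tau^i_j)$, and the fiber product consists of $(u_1,\dots,u_n)$ with $s^{i_k}_{i'_k}(u_k)=t^{i_{k+1}}_{i'_k}(u_{k+1})$. Morphisms are natural transformations. Two $i$-arrows are parallel if $i=0$ or they have the same source and target. A pregroupoidal structure on $C$ consists of morphisms $\nabla^i_j\colon D_i\to D_i\amalg_{D_j}D_i$ ($i>j\ge0$), $\kappa_i\colon D_{i+1}\to D_i$, $w^i_j\colon D_i\to D_i$ with $\nabla^i_{i-1}\sigma_i=\epsilon_2\sigma_i$, $\nabla^i_{i-1}\tau_i=\epsilon_1\tau_i$ ($\epsilon_1,\epsilon_2$ the canonical inclusions of the first and second summand), $\nabla^i_j\sigma_i=(\sigma_i\amalg_{D_j}\sigma_i)\nabla^{i-1}_j$, $\nabla^i_j\tau_i=(\tau_i\amalg_{D_j}\tau_i)\nabla^{i-1}_j$ for $j<i-1$, $\kappa_i\sigma_{i+1}=\kappa_i\tau_{i+1}=\mathrm{id}$, $w^i_{i-1}\sigma_i=\tau_i$, $w^i_{i-1}\tau_i=\sigma_i$, $w^i_j\sigma_i=\sigma_iw^{i-1}_j$, $w^i_j\tau_i=\tau_iw^{i-1}_j$ for $j<i-1$. It induces on $G$: compositions $v\ast^i_ju=G(\nabla^i_j)(\xi)$ for $s^i_j(v)=t^i_j(u)$,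 $\xi$ corresponding to $(v,u)$; units $k_i=G(\kappa_i)\colon G_i\to G_{i+1}$, $k^i_j=k_{i-1}\cdots k_j\colon G_j\to G_i$. For $n$-arrows $u,v$, $u\sim v$ if some $(n+1)$-arrow has source $u$ and target $v$. $\pi_0(G)=G_0/\sim$. $\Pi_1(G)$ is the groupoid with objects $G_0$, arrows $G_1/\sim$, composition induced by $\ast^1_0$ and identities by $k_0$. For parallel $(n-1)$-arrows $u,v$, $\pi_n(G,u,v)$ is the set of $n$-arrows from $u$ to $v$ modulo $\sim$; $\pi_n(G,u)=\pi_n(G,u,u)$ is a group via $\ast^n_{n-1}$; for an object $x$, $\pi_n(G,x)=\pi_n(G,k^{n-1}_0(x))$. A morphism $f\colon G\to H$ is a weak equivalence if $\pi_0(f)$ is a bijection and, for all $n\ge1$ and all objects $x$ of $G$, the induced morphism $\pi_n(G,x)\to\pi_n(H,f(x))$ is an isomorphism. *)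

theory Defs
  imports "HOL-Algebra.Group"
begin

text \<open>A category is given by a set of objects, hom-sets, a composition
  (ccomp g f is g after f) and identities. The globe functor G -> C is given by
  the images gD n of the objects D_n and gsig n, gtau n of the generators
  sigma_n, tau_n : D_(n-1) -> D_n (n >= 1); since the globe category is presented by
  these generators and the two globular relations, this is exactly a functor.
  gsum is a chosen globular sum (colimit object and list of coprojections) for
  each table of dimensions; pnabla, pkappa, pw are the data of a pregroupoidal
  structure.\<close>

record ('o,'m) gcat =
  cobj :: "'o set"
  chom :: "'o \<Rightarrow> 'o \<Rightarrow> 'm set"
  ccomp :: "'m \<Rightarrow> 'm \<Rightarrow> 'm"
  cid :: "'o \<Rightarrow> 'm"
  gD :: "nat \<Rightarrow> 'o"
  gsig :: "nat \<Rightarrow> 'm"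
  gtau :: "nat \<Rightarrow> 'm"
  gsum :: "nat list \<Rightarrow> nat list \<Rightarrow> 'o \<times> 'm list"
  pnabla :: "nat \<Rightarrow> nat \<Rightarrow> 'm"
  pkappa :: "nat \<Rightarrow> 'm"
  pw :: "nat \<Rightarrow> nat \<Rightarrow> 'm"

definition is_category :: "('o,'m) gcat \<Rightarrow> bool" where
  "is_category C \<longleftrightarrow>
     (\<forall>x y. chom C x y \<noteq> {} \<longrightarrow> x \<in> cobj C \<and> y \<in> cobj C) \<and>
     (\<forall>x\<in>cobj C. cid C x \<in> chom C x x) \<and>
     (\<forall>x y z f g. f \<in> chom C x y \<longrightarrow> g \<in> chom C y z \<longrightarrow> ccomp C g f \<in> chom C x z) \<and>
     (\<forall>x y z w f g h. f \<in> chom C w x \<longrightarrow> g \<in> chom C x y \<longrightarrow> h \<in> chom C y z \<longrightarrow>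
        ccomp C h (ccomp C g f) = ccomp C (ccomp C h g) f) \<and>
     (\<forall>x y f. f \<in> chom C x y \<longrightarrow> ccomp C (cid C y) f = f \<and> ccomp C f (cid C x) = f)"

definition under_globe :: "('o,'m) gcat \<Rightarrow> bool" where
  "under_globe C \<longleftrightarrow>
     (\<forall>n. gD C n \<in> cobj C) \<and>
     (\<forall>n. gsig C (Suc n) \<in> chom C (gD C n) (gD C (Suc n)) \<and>
          gtau C (Suc n) \<in> chom C (gD C n) (gD C (Suc n))) \<and>
     (\<forall>n. n \<ge> 1 \<longrightarrow>
          ccomp C (gsig C (Suc n)) (gsig C n) = ccomp C (gtau C (Suc n)) (gsig C n) \<and>
          ccomp C (gsig C (Suc n)) (gtau C n) = ccomp C (gtau C (Suc n)) (gtau C n))"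

primrec gsigs' :: "('o,'m) gcat \<Rightarrow> nat \<Rightarrow> nat \<Rightarrow> 'm" where
  "gsigs' C j 0 = cid C (gD C j)"
| "gsigs' C j (Suc k) = ccomp C (gsig C (j + Suc k)) (gsigs' C j k)"

primrec gtaus' :: "('o,'m) gcat \<Rightarrow> nat \<Rightarrow> nat \<Rightarrow> 'm" where
  "gtaus' C j 0 = cid C (gD C j)"
| "gtaus' C j (Suc k) = ccomp C (gtau C (j + Suc k)) (gtaus' C j k)"

definition gsigs :: "('o,'m) gcat \<Rightarrow> nat \<Rightarrow> nat \<Rightarrow> 'm" where
  "gsigs C i j = gsigs' C j (i - j)"

definition gtaus :: "('o,'m) gcat \<Rightarrow> nat \<Rightarrow> nat \<Rightarrow> 'm" where
  "gtaus C i j = gtaus' C j (i - j)"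

text \<open>A table of dimensions (i_1,...,i_n ; i'_1,...,i'_(n-1)) as two lists.\<close>
definition table_ok :: "nat list \<Rightarrow> nat list \<Rightarrow> bool" where
  "table_ok is js \<longleftrightarrow> length is = Suc (length js) \<and>
     (\<forall>k<length js. js ! k < is ! k \<and> js ! k < is ! Suc k)"

definition table_dim :: "nat list \<Rightarrow> nat list \<Rightarrow> nat" where
  "table_dim is js = Max (set is \<union> set js)"

definition is_cocone :: "('o,'m) gcat \<Rightarrow> nat list \<Rightarrow> nat list \<Rightarrow> 'o \<Rightarrow> 'm list \<Rightarrow> bool" where
  "is_cocone C is js X e \<longleftrightarrow> X \<in> cobj C \<and> length e = length is \<and>
     (\<forall>k<length is. e ! k \<in> chom C (gD C (is ! k)) X) \<and>
     (\<forall>k<length js. ccomp C (e ! k) (gsigs C (is ! k) (js ! k)) =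
                    ccomp C (e ! Suc k) (gtaus C (is ! Suc k) (js ! k)))"

definition is_colimit :: "('o,'m) gcat \<Rightarrow> nat list \<Rightarrow> nat list \<Rightarrow> 'o \<Rightarrow> 'm list \<Rightarrow> bool" where
  "is_colimit C is js S e \<longleftrightarrow> is_cocone C is js S e \<and>
     (\<forall>X e'. is_cocone C is js X e' \<longrightarrow>
        (\<exists>!h. h \<in> chom C S X \<and> (\<forall>k<length is. ccomp C h (e ! k) = e' ! k)))"

definition globular_extension :: "('o,'m) gcat \<Rightarrow> bool" where
  "globular_extension C \<longleftrightarrow> is_category C \<and> under_globe C \<and>
     (\<forall>is js. table_ok is js \<longrightarrow> is_colimit C is js (fst (gsum C is js)) (snd (gsum C is js)))"

definition glob_parallel :: "('o,'m) gcat \<Rightarrow> nat \<Rightarrow> 'm \<Rightarrow> 'm \<Rightarrow> bool" where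
  "glob_parallel C n f g \<longleftrightarrow> n = 0 \<or>
     (ccomp C f (gsig C n) = ccomp C g (gsig C n) \<and> ccomp C f (gtau C n) = ccomp C g (gtau C n))"

definition contractible :: "('o,'m) gcat \<Rightarrow> bool" where
  "contractible C \<longleftrightarrow>
     (\<forall>n is js f g. table_ok is js \<longrightarrow> table_dim is js \<le> Suc n \<longrightarrow>
        f \<in> chom C (gD C n) (fst (gsum C is js)) \<longrightarrow>
        g \<in> chom C (gD C n) (fst (gsum C is js)) \<longrightarrow>
        glob_parallel C n f g \<longrightarrow>
        (\<exists>h\<in>chom C (gD C (Suc n)) (fst (gsum C is js)).
            ccomp C h (gsig C (Suc n)) = f \<and> ccomp C h (gtau C (Suc n)) = g))"

text \<open>Pregroupoidal structure. The map (sigma_i amalg_(D_j) sigma_i) from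
  D_(i-1) amalg_(D_j) D_(i-1) to D_i amalg_(D_j) D_i is the unique map h with
  h eps'_1 = eps_1 sigma_i and h eps'_2 = eps_2 sigma_i.\<close>
definition pregroupoidal :: "('o,'m) gcat \<Rightarrow> bool" where
  "pregroupoidal C \<longleftrightarrow>
    (\<forall>i j. j < i \<longrightarrow>
       pnabla C i j \<in> chom C (gD C i) (fst (gsum C [i,i] [j])) \<and>
       (j = i - 1 \<longrightarrow>
          ccomp C (pnabla C i j) (gsig C i) = ccomp C (snd (gsum C [i,i] [j]) ! 1) (gsig C i) \<and>
          ccomp C (pnabla C i j) (gtau C i) = ccomp C (snd (gsum C [i,i] [j]) ! 0) (gtau C i)) \<and>
       (j < i - 1 \<longrightarrow>
          (\<exists>h\<in>chom C (fst (gsum C [i-1,i-1] [j])) (fst (gsum C [i,i] [j])).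
              ccomp C h (snd (gsum C [i-1,i-1] [j]) ! 0) = ccomp C (snd (gsum C [i,i] [j]) ! 0) (gsig C i) \<and>
              ccomp C h (snd (gsum C [i-1,i-1] [j]) ! 1) = ccomp C (snd (gsum C [i,i] [j]) ! 1) (gsig C i) \<and>
              ccomp C (pnabla C i j) (gsig C i) = ccomp C h (pnabla C (i-1) j)) \<and>
          (\<exists>h\<in>chom C (fst (gsum C [i-1,i-1] [j])) (fst (gsum C [i,i] [j])).
              ccomp C h (snd (gsum C [i-1,i-1] [j]) ! 0) = ccomp C (snd (gsum C [i,i] [j]) ! 0) (gtau C i) \<and>
              ccomp C h (snd (gsum C [i-1,i-1] [j]) ! 1) = ccomp C (snd (gsum C [i,i] [j]) ! 1) (gtau C i) \<and>
              ccomp C (pnabla C i j) (gtau C i) = ccomp C h (pnabla C (i-1) j)))) \<and>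
    (\<forall>i. pkappa C i \<in> chom C (gD C (Suc i)) (gD C i) \<and>
         ccomp C (pkappa C i) (gsig C (Suc i)) = cid C (gD C i) \<and>
         ccomp C (pkappa C i) (gtau C (Suc i)) = cid C (gD C i)) \<and>
    (\<forall>i j. j < i \<longrightarrow>
       pw C i j \<in> chom C (gD C i) (gD C i) \<and>
       (j = i - 1 \<longrightarrow> ccomp C (pw C i j) (gsig C i) = gtau C i \<and>
                      ccomp C (pw C i j) (gtau C i) = gsig C i) \<and>
       (j < i - 1 \<longrightarrow> ccomp C (pw C i j) (gsig C i) = ccomp C (gsig C i) (pw C (i-1) j) \<and>
                      ccomp C (pw C i j) (gtau C i) = ccomp C (gtau C i) (pw C (i-1) j)))"

record ('o,'m,'a) psh =
  pob :: "'o \<Rightarrow> 'a set"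
  pmor :: "'m \<Rightarrow> 'a \<Rightarrow> 'a"

definition is_presheaf :: "('o,'m) gcat \<Rightarrow> ('o,'m,'a) psh \<Rightarrow> bool" where
  "is_presheaf C G \<longleftrightarrow>
     (\<forall>x y f a. f \<in> chom C x y \<longrightarrow> a \<in> pob G y \<longrightarrow> pmor G f a \<in> pob G x) \<and>
     (\<forall>x\<in>cobj C. \<forall>a\<in>pob G x. pmor G (cid C x) a = a) \<and>
     (\<forall>x y z f g a. f \<in> chom C x y \<longrightarrow> g \<in> chom C y z \<longrightarrow> a \<in> pob G z \<longrightarrow>
        pmor G (ccomp C g f) a = pmor G f (pmor G g a))"

definition fiber_prod :: "('o,'m) gcat \<Rightarrow> ('o,'m,'a) psh \<Rightarrow> nat list \<Rightarrow> nat list \<Rightarrow> 'a list set" where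
  "fiber_prod C G is js = {us. length us = length is \<and>
      (\<forall>k<length is. us ! k \<in> pob G (gD C (is ! k))) \<and>
      (\<forall>k<length js. pmor G (gsigs C (is ! k) (js ! k)) (us ! k) =
                     pmor G (gtaus C (is ! Suc k) (js ! k)) (us ! Suc k))}"

definition infty_groupoid :: "('o,'m) gcat \<Rightarrow> ('o,'m,'a) psh \<Rightarrow> bool" where
  "infty_groupoid C G \<longleftrightarrow> is_presheaf C G \<and>
     (\<forall>is js. table_ok is js \<longrightarrow>
        bij_betw (\<lambda>a. map (\<lambda>e. pmor G e a) (snd (gsum C is js)))
                 (pob G (fst (gsum C is js))) (fiber_prod C G is js))"

definition groupoid_morphism ::
  "('o,'m) gcat \<Rightarrow> ('o,'m,'a) psh \<Rightarrow> ('o,'m,'b) psh \<Rightarrow> ('o \<Rightarrow> 'a \<Rightarrow> 'b) \<Rightarrow> bool" where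
  "groupoid_morphism C G H f \<longleftrightarrow>
     (\<forall>x\<in>cobj C. \<forall>a\<in>pob G x. f x a \<in> pob H x) \<and>
     (\<forall>x y m a. m \<in> chom C x y \<longrightarrow> a \<in> pob G y \<longrightarrow> f x (pmor G m a) = pmor H m (f y a))"

abbreviation arr :: "('o,'m) gcat \<Rightarrow> ('o,'m,'a) psh \<Rightarrow> nat \<Rightarrow> 'a set" where
  "arr C G n \<equiv> pob G (gD C n)"

definition src :: "('o,'m) gcat \<Rightarrow> ('o,'m,'a) psh \<Rightarrow> nat \<Rightarrow> 'a \<Rightarrow> 'a" where
  "src C G n a = pmor G (gsig C n) a"

definition tgt :: "('o,'m) gcat \<Rightarrow> ('o,'m,'a) psh \<Rightarrow> nat \<Rightarrow> 'a \<Rightarrow> 'a" where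
  "tgt C G n a = pmor G (gtau C n) a"

definition gcomp :: "('o,'m) gcat \<Rightarrow> ('o,'m,'a) psh \<Rightarrow> nat \<Rightarrow> nat \<Rightarrow> 'a \<Rightarrow> 'a \<Rightarrow> 'a" where
  "gcomp C G i j v u = pmor G (pnabla C i j)
     (THE xi. xi \<in> pob G (fst (gsum C [i,i] [j])) \<and>
              pmor G (snd (gsum C [i,i] [j]) ! 0) xi = v \<and>
              pmor G (snd (gsum C [i,i] [j]) ! 1) xi = u)"

definition gunit :: "('o,'m) gcat \<Rightarrow> ('o,'m,'a) psh \<Rightarrow> nat \<Rightarrow> 'a \<Rightarrow> 'a" where
  "gunit C G i a = pmor G (pkappa C i) a"

primrec gunits :: "('o,'m) gcat \<Rightarrow> ('o,'m,'a) psh \<Rightarrow> nat \<Rightarrow> nat \<Rightarrow> 'a \<Rightarrow> 'a" where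
  "gunits C G j 0 a = a"
| "gunits C G j (Suc k) a = gunit C G (j + k) (gunits C G j k a)"

definition htpy_rel :: "('o,'m) gcat \<Rightarrow> ('o,'m,'a) psh \<Rightarrow> nat \<Rightarrow> 'a set \<Rightarrow> ('a \<times> 'a) set" where
  "htpy_rel C G n A = {(u,v). u \<in> A \<and> v \<in> A \<and>
      (\<exists>c\<in>arr C G (Suc n). src C G (Suc n) c = u \<and> tgt C G (Suc n) c = v)}"

definition parrows :: "('o,'m) gcat \<Rightarrow> ('o,'m,'a) psh \<Rightarrow> nat \<Rightarrow> 'a \<Rightarrow> 'a \<Rightarrow> 'a set" where
  "parrows C G n u v = {a \<in> arr C G n. src C G n a = u \<and> tgt C G n a = v}"

definition pi0 :: "('o,'m) gcat \<Rightarrow> ('o,'m,'a) psh \<Rightarrow> 'a set set" where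
  "pi0 C G = arr C G 0 // htpy_rel C G 0 (arr C G 0)"

definition pin :: "('o,'m) gcat \<Rightarrow> ('o,'m,'a) psh \<Rightarrow> nat \<Rightarrow> 'a \<Rightarrow> 'a \<Rightarrow> 'a set set" where
  "pin C G n u v = parrows C G n u v // htpy_rel C G n (parrows C G n u v)"

definition ind_map :: "('b \<times> 'b) set \<Rightarrow> ('a \<Rightarrow> 'b) \<Rightarrow> 'a set \<Rightarrow> 'b set" where
  "ind_map R g X = (\<Union>a\<in>X. R `` {g a})"

definition pi_grp :: "('o,'m) gcat \<Rightarrow> ('o,'m,'a) psh \<Rightarrow> nat \<Rightarrow> 'a \<Rightarrow> 'a set monoid" where
  "pi_grp C G n u =
     \<lparr>carrier = pin C G n u u,
      mult = (\<lambda>X Y. \<Union>x\<in>X. \<Union>y\<in>Y. htpy_rel C G n (parrows C G n u u) `` {gcomp C G n (n - 1) x y}),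
      one = htpy_rel C G n (parrows C G n u u) `` {gunit C G (n - 1) u}\<rparr>"

definition pin_map ::
  "('o,'m) gcat \<Rightarrow> ('o,'m,'b) psh \<Rightarrow> ('o \<Rightarrow> 'a \<Rightarrow> 'b) \<Rightarrow> nat \<Rightarrow> 'a \<Rightarrow> 'a \<Rightarrow> 'a set \<Rightarrow> 'b set" where
  "pin_map C H f n u v =
     ind_map (htpy_rel C H n (parrows C H n (f (gD C (n - 1)) u) (f (gD C (n - 1)) v))) (f (gD C n))"

definition pi0_map :: "('o,'m) gcat \<Rightarrow> ('o,'m,'b) psh \<Rightarrow> ('o \<Rightarrow> 'a \<Rightarrow> 'b) \<Rightarrow> 'a set \<Rightarrow> 'b set" where
  "pi0_map C H f = ind_map (htpy_rel C H 0 (arr C H 0)) (f (gD C 0))"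

text \<open>The fundamental groupoid Pi_1(G): objects G_0, Hom(x,y) = pi_1(G,x,y)\<close>
definition pi1_comp :: "('o,'m) gcat \<Rightarrow> ('o,'m,'a) psh \<Rightarrow> 'a \<Rightarrow> 'a \<Rightarrow> 'a set \<Rightarrow> 'a set \<Rightarrow> 'a set" where
  "pi1_comp C G x z B A = (\<Union>b\<in>B. \<Union>a\<in>A. htpy_rel C G 1 (parrows C G 1 x z) `` {gcomp C G 1 0 b a})"

definition pi1_id :: "('o,'m) gcat \<Rightarrow> ('o,'m,'a) psh \<Rightarrow> 'a \<Rightarrow> 'a set" where
  "pi1_id C G x = htpy_rel C G 1 (parrows C G 1 x x) `` {gunit C G 0 x}"

definition pi1_isomorphic :: "('o,'m) gcat \<Rightarrow> ('o,'m,'a) psh \<Rightarrow> 'a \<Rightarrow> 'a \<Rightarrow> bool" where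
  "pi1_isomorphic C G x y \<longleftrightarrow>
     (\<exists>P\<in>pin C G 1 x y. \<exists>Q\<in>pin C G 1 y x.
        pi1_comp C G x x Q P = pi1_id C G x \<and> pi1_comp C G y y P Q = pi1_id C G y)"

definition Pi1_full :: "('o,'m) gcat \<Rightarrow> ('o,'m,'a) psh \<Rightarrow> ('o,'m,'b) psh \<Rightarrow> ('o \<Rightarrow> 'a \<Rightarrow> 'b) \<Rightarrow> bool" where
  "Pi1_full C G H f \<longleftrightarrow> (\<forall>x\<in>arr C G 0. \<forall>y\<in>arr C G 0.
      \<forall>B\<in>pin C H 1 (f (gD C 0) x) (f (gD C 0) y). \<exists>A\<in>pin C G 1 x y. pin_map C H f 1 x y A = B)"

definition Pi1_faithful :: "('o,'m) gcat \<Rightarrow> ('o,'m,'a) psh \<Rightarrow> ('o,'m,'b) psh \<Rightarrow> ('o \<Rightarrow> 'a \<Rightarrow> 'b) \<Rightarrow> bool" where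
  "Pi1_faithful C G H f \<longleftrightarrow> (\<forall>x\<in>arr C G 0. \<forall>y\<in>arr C G 0.
      inj_on (pin_map C H f 1 x y) (pin C G 1 x y))"

definition Pi1_ess_surj :: "('o,'m) gcat \<Rightarrow> ('o,'m,'a) psh \<Rightarrow> ('o,'m,'b) psh \<Rightarrow> ('o \<Rightarrow> 'a \<Rightarrow> 'b) \<Rightarrow> bool" where
  "Pi1_ess_surj C G H f \<longleftrightarrow> (\<forall>y\<in>arr C H 0. \<exists>x\<in>arr C G 0. pi1_isomorphic C H (f (gD C 0) x) y)"

definition Pi1_equivalence :: "('o,'m) gcat \<Rightarrow> ('o,'m,'a) psh \<Rightarrow> ('o,'m,'b) psh \<Rightarrow> ('o \<Rightarrow> 'a \<Rightarrow> 'b) \<Rightarrow> bool" where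
  "Pi1_equivalence C G H f \<longleftrightarrow> Pi1_full C G H f \<and> Pi1_faithful C G H f \<and> Pi1_ess_surj C G H f"

definition weak_equivalence :: "('o,'m) gcat \<Rightarrow> ('o,'m,'a) psh \<Rightarrow> ('o,'m,'b) psh \<Rightarrow> ('o \<Rightarrow> 'a \<Rightarrow> 'b) \<Rightarrow> bool" where
  "weak_equivalence C G H f \<longleftrightarrow>
     bij_betw (pi0_map C H f) (pi0 C G) (pi0 C H) \<and>
     (\<forall>n\<ge>1. \<forall>x\<in>arr C G 0.
        pin_map C H f n (gunits C G 0 (n - 1) x) (gunits C G 0 (n - 1) x)
          \<in> iso (pi_grp C G n (gunits C G 0 (n - 1) x))
                (pi_grp C H n (gunits C H 0 (n - 1) (f (gD C 0) x))))"

definition cond2 :: "('o,'m) gcat \<Rightarrow> ('o,'m,'a) psh \<Rightarrow> ('o,'m,'b) psh \<Rightarrow> ('o \<Rightarrow> 'a \<Rightarrow> 'b) \<Rightarrow> bool" where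
  "cond2 C G H f \<longleftrightarrow>
     bij_betw (pi0_map C H f) (pi0 C G) (pi0 C H) \<and>
     (\<forall>n\<ge>1. \<forall>u\<in>arr C G (n - 1).
        pin_map C H f n u u \<in> iso (pi_grp C G n u) (pi_grp C H n (f (gD C (n - 1)) u)))"

definition cond3 :: "('o,'m) gcat \<Rightarrow> ('o,'m,'a) psh \<Rightarrow> ('o,'m,'b) psh \<Rightarrow> ('o \<Rightarrow> 'a \<Rightarrow> 'b) \<Rightarrow> bool" where
  "cond3 C G H f \<longleftrightarrow>
     Pi1_equivalence C G H f \<and>
     (\<forall>n\<ge>2. \<forall>u\<in>arr C G (n - 1). \<forall>v\<in>arr C G (n - 1).
        src C G (n - 1) u = src C G (n - 1) v \<longrightarrow> tgt C G (n - 1) u = tgt C G (n - 1) v \<longrightarrow>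
        bij_betw (pin_map C H f n u v) (pin C G n u v)
                 (pin C H n (f (gD C (n - 1)) u) (f (gD C (n - 1)) v)))"

definition cond4 :: "('o,'m) gcat \<Rightarrow> ('o,'m,'a) psh \<Rightarrow> ('o,'m,'b) psh \<Rightarrow> ('o \<Rightarrow> 'a \<Rightarrow> 'b) \<Rightarrow> bool" where
  "cond4 C G H f \<longleftrightarrow>
     Pi1_full C G H f \<and> Pi1_ess_surj C G H f \<and>
     (\<forall>n\<ge>2. \<forall>u\<in>arr C G (n - 1). \<forall>v\<in>arr C G (n - 1).
        src C G (n - 1) u = src C G (n - 1) v \<longrightarrow> tgt C G (n - 1) u = tgt C G (n - 1) v \<longrightarrow>
        (\<forall>B\<in>pin C H n (f (gD C (n - 1)) u) (f (gD C (n - 1)) v).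
            \<exists>A\<in>pin C G n u v. pin_map C H f n u v A = B))"

end

theory Submission
  imports Defs
begin

text \<open>
  The representable presheaf \<open>Hom(-, X)\<close> is itself an \<open>\<infinity>\<close>-groupoid, and an element of \<open>G(X)\<close> is a
  morphism \<open>Hom(-, X) \<rightarrow> G\<close>. Contractibility says that parallel arrows of \<open>Hom(-, S)\<close>, for \<open>S\<close> a globular
  sum of small dimension, are homotopic; evaluating at elements of \<open>G(S)\<close> yields all coherence cells needed
  in \<open>G\<close>.

  The main point is that two-sided whiskering \<open>a \<mapsto> z\<^sub>1 a z\<^sub>2\<close> by \<open>(l+1)\<close>-arrows induces bijections on
  homotopy classes of \<open>i\<close>-arrows for every \<open>i > l\<close>. By induction on the codimension, whiskering with
  \<open>z\<^sub>1, z\<^sub>2\<close> and then with their inverses is compared with the identity: the comparison cells given by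
  contractibility reduce the question about \<open>(i+1)\<close>-arrows to whiskerings of smaller codimension.

  Since whiskering is natural, it transports bijectivity of the map induced by \<open>f\<close> between base arrows.
  The iterated units on an \<open>m\<close>-arrow \<open>y\<close> and on its source are evaluations at \<open>y\<close> of two operations \<open>D\<^sub>N \<rightarrow> D\<^sub>m\<close>
  that agree below dimension \<open>m - 1\<close>; whiskering makes them agree in one dimension after the other. This
  gives (1) implies (2). The step from loops at \<open>u\<close> to arrows from \<open>u\<close> to \<open>v\<close> in (2) implies (3) is
  whiskering by an arrow between \<open>u\<close> and \<open>v\<close>.
\<close>

section \<open>Infinity-groupoids and their operations\<close>

text \<open>The obstacle is that contractibility compares only parallel operations. Whiskering by
  \<open>z1\<close>, \<open>z2\<close> and then by their inverses is parallel to the identity on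
  arrows just above the whiskering dimension, but on higher arrows its faces are the doubly
  whiskered faces and not the original ones. The remedy is to conjugate one family of operations by
  the comparison cells found one dimension below (\<open>bridge\<close>). This restores parallelism,
  and evaluated in \<open>G\<close> it is one more whiskering, along arrows one dimension higher,
  with fewer dimensions left to treat. Hence all whiskering dimensions are handled at once. The
  arity is D_(l+1) amalg_(D_l) D_i amalg_(D_l) D_(l+1) with l fixed and i growing; as i > l it has
  dimension i, so parallel operations on D_i are always admissible. For disks the bound bites:
  fillers for operations D_j -> D_m are guaranteed only if m <= j + 1. Iterated units on an m-arrow
  are therefore compared with those on its source, one dimension at a time, and not directly with
  those on an object.\<close>

definition yon :: "('o,'m) gcat \<Rightarrow> 'o \<Rightarrow> ('o,'m,'m) psh" where
  "yon C X = \<lparr>pob = (\<lambda>D. chom C D X), pmor = (\<lambda>\<phi> a. ccomp C a \<phi>)\<rparr>"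

definition amal :: "('o,'m) gcat \<Rightarrow> ('o,'m,'a) psh \<Rightarrow> nat list \<Rightarrow> nat list \<Rightarrow> 'a list \<Rightarrow> 'a" where
  "amal C G is js us = (THE \<xi>. \<xi> \<in> pob G (fst (gsum C is js)) \<and>
     map (\<lambda>e. pmor G e \<xi>) (snd (gsum C is js)) = us)"

definition msrc :: "('o,'m) gcat \<Rightarrow> ('o,'m,'a) psh \<Rightarrow> nat \<Rightarrow> nat \<Rightarrow> 'a \<Rightarrow> 'a" where
  "msrc C G i j a = pmor G (gsigs C i j) a"

definition mtgt :: "('o,'m) gcat \<Rightarrow> ('o,'m,'a) psh \<Rightarrow> nat \<Rightarrow> nat \<Rightarrow> 'a \<Rightarrow> 'a" where
  "mtgt C G i j a = pmor G (gtaus C i j) a"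

definition ginv :: "('o,'m) gcat \<Rightarrow> ('o,'m,'a) psh \<Rightarrow> nat \<Rightarrow> 'a \<Rightarrow> 'a" where
  "ginv C G k a = pmor G (pw C (Suc k) k) a"

locale pregroupoidal_extension =
  fixes C :: "('o,'m) gcat"
  assumes gext: "globular_extension C" and contr: "contractible C" and pregr: "pregroupoidal C"
begin

lemma cat: "is_category C" and glob: "under_globe C"
  and colim: "table_ok is js \<Longrightarrow> is_colimit C is js (fst (gsum C is js)) (snd (gsum C is js))"
  using gext by (auto simp: globular_extension_def)

lemma comp_in: "f \<in> chom C x y \<Longrightarrow> g \<in> chom C y z \<Longrightarrow> ccomp C g f \<in> chom C x z"
  and comp_assoc: "f \<in> chom C w x \<Longrightarrow> g \<in> chom C x y \<Longrightarrow> h \<in> chom C y z \<Longrightarrow>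
    ccomp C (ccomp C h g) f = ccomp C h (ccomp C g f)"
  and id_in [intro]: "x \<in> cobj C \<Longrightarrow> cid C x \<in> chom C x x"
  and id_left: "f \<in> chom C x y \<Longrightarrow> ccomp C (cid C y) f = f"
  and id_right: "f \<in> chom C x y \<Longrightarrow> ccomp C f (cid C x) = f"
  using cat unfolding is_category_def by metis+

lemma D_in [simp, intro]: "gD C n \<in> cobj C"
  and sig_in [simp, intro]: "gsig C (Suc n) \<in> chom C (gD C n) (gD C (Suc n))"
  and tau_in [simp, intro]: "gtau C (Suc n) \<in> chom C (gD C n) (gD C (Suc n))"
  using glob by (auto simp: under_globe_def)

lemma sig_sig: "ccomp C (gsig C (Suc (Suc n))) (gsig C (Suc n)) = ccomp C (gtau C (Suc (Suc n))) (gsig C (Suc n))"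
  and sig_tau: "ccomp C (gsig C (Suc (Suc n))) (gtau C (Suc n)) = ccomp C (gtau C (Suc (Suc n))) (gtau C (Suc n))"
  using glob by (auto simp: under_globe_def)

lemma gsigs'_in: "gsigs' C j k \<in> chom C (gD C j) (gD C (j + k))"
  and gtaus'_in: "gtaus' C j k \<in> chom C (gD C j) (gD C (j + k))"
  by (induction k) (auto intro: comp_in)

lemma gsigs_in [intro]: "j \<le> i \<Longrightarrow> gsigs C i j \<in> chom C (gD C j) (gD C i)"
  and gtaus_in [intro]: "j \<le> i \<Longrightarrow> gtaus C i j \<in> chom C (gD C j) (gD C i)"
  using gsigs'_in[of j "i - j"] gtaus'_in[of j "i - j"] by (auto simp: gsigs_def gtaus_def)

lemma gsigs_self: "gsigs C i i = cid C (gD C i)" and gtaus_self: "gtaus C i i = cid C (gD C i)"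
  by (auto simp: gsigs_def gtaus_def)

lemma gsigs_Suc: "j \<le> i \<Longrightarrow> gsigs C (Suc i) j = ccomp C (gsig C (Suc i)) (gsigs C i j)"
  and gtaus_Suc: "j \<le> i \<Longrightarrow> gtaus C (Suc i) j = ccomp C (gtau C (Suc i)) (gtaus C i j)"
  by (auto simp: gsigs_def gtaus_def Suc_diff_le)

abbreviation grpd :: "('o,'m,'a) psh \<Rightarrow> bool" where "grpd G \<equiv> infty_groupoid C G"

lemma pmor_in: "grpd G \<Longrightarrow> f \<in> chom C x y \<Longrightarrow> a \<in> pob G y \<Longrightarrow> pmor G f a \<in> pob G x"
  and pmor_id: "grpd G \<Longrightarrow> x \<in> cobj C \<Longrightarrow> a \<in> pob G x \<Longrightarrow> pmor G (cid C x) a = a"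
  and pmor_comp: "grpd G \<Longrightarrow> f \<in> chom C x y \<Longrightarrow> g \<in> chom C y z \<Longrightarrow> a \<in> pob G z \<Longrightarrow>
    pmor G (ccomp C g f) a = pmor G f (pmor G g a)"
  unfolding infty_groupoid_def is_presheaf_def by metis+

lemma src_in [intro]: "grpd G \<Longrightarrow> a \<in> arr C G (Suc n) \<Longrightarrow> src C G (Suc n) a \<in> arr C G n"
  and tgt_in [intro]: "grpd G \<Longrightarrow> a \<in> arr C G (Suc n) \<Longrightarrow> tgt C G (Suc n) a \<in> arr C G n"
  unfolding src_def tgt_def by (blast intro: pmor_in)+

lemma msrc_in [intro]: "grpd G \<Longrightarrow> a \<in> arr C G i \<Longrightarrow> j \<le> i \<Longrightarrow> msrc C G i j a \<in> arr C G j"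
  and mtgt_in [intro]: "grpd G \<Longrightarrow> a \<in> arr C G i \<Longrightarrow> j \<le> i \<Longrightarrow> mtgt C G i j a \<in> arr C G j"
  unfolding msrc_def mtgt_def by (blast intro: pmor_in)+

lemma src_src: "grpd G \<Longrightarrow> a \<in> arr C G (Suc (Suc n)) \<Longrightarrow>
    src C G (Suc n) (tgt C G (Suc (Suc n)) a) = src C G (Suc n) (src C G (Suc (Suc n)) a)"
  and tgt_tgt: "grpd G \<Longrightarrow> a \<in> arr C G (Suc (Suc n)) \<Longrightarrow>
    tgt C G (Suc n) (src C G (Suc (Suc n)) a) = tgt C G (Suc n) (tgt C G (Suc (Suc n)) a)"
  unfolding src_def tgt_def
  by (simp_all add: pmor_comp[symmetric, OF _ sig_in sig_in] pmor_comp[symmetric, OF _ sig_in tau_in]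
    pmor_comp[symmetric, OF _ tau_in sig_in] pmor_comp[symmetric, OF _ tau_in tau_in] sig_sig sig_tau)

lemma msrc_self: "grpd G \<Longrightarrow> a \<in> arr C G i \<Longrightarrow> msrc C G i i a = a"
  and mtgt_self: "grpd G \<Longrightarrow> a \<in> arr C G i \<Longrightarrow> mtgt C G i i a = a"
  by (simp_all add: msrc_def mtgt_def gsigs_self gtaus_self pmor_id)

lemma msrc_Suc: "grpd G \<Longrightarrow> a \<in> arr C G (Suc i) \<Longrightarrow> j \<le> i \<Longrightarrow>
    msrc C G (Suc i) j a = msrc C G i j (src C G (Suc i) a)"
  and mtgt_Suc: "grpd G \<Longrightarrow> a \<in> arr C G (Suc i) \<Longrightarrow> j \<le> i \<Longrightarrow>
    mtgt C G (Suc i) j a = mtgt C G i j (tgt C G (Suc i) a)"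
  by (simp_all add: msrc_def mtgt_def src_def tgt_def gsigs_Suc gtaus_Suc
     pmor_comp[OF _ gsigs_in sig_in] pmor_comp[OF _ gtaus_in tau_in])

lemma msrc_one: "grpd G \<Longrightarrow> a \<in> arr C G (Suc i) \<Longrightarrow> msrc C G (Suc i) i a = src C G (Suc i) a"
  and mtgt_one: "grpd G \<Longrightarrow> a \<in> arr C G (Suc i) \<Longrightarrow> mtgt C G (Suc i) i a = tgt C G (Suc i) a"
  by (simp_all add: msrc_Suc mtgt_Suc msrc_self mtgt_self src_in tgt_in)

lemma msrc_tgt: "grpd G \<Longrightarrow> a \<in> arr C G (Suc i) \<Longrightarrow> j < i \<Longrightarrow>
    msrc C G i j (tgt C G (Suc i) a) = msrc C G i j (src C G (Suc i) a)"
  and mtgt_src: "grpd G \<Longrightarrow> a \<in> arr C G (Suc i) \<Longrightarrow> j < i \<Longrightarrow>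
    mtgt C G i j (src C G (Suc i) a) = mtgt C G i j (tgt C G (Suc i) a)"
  by (cases i; simp add: msrc_Suc mtgt_Suc src_in tgt_in src_src tgt_tgt)+

lemma src_msrc: "grpd G \<Longrightarrow> a \<in> arr C G i \<Longrightarrow> j < i \<Longrightarrow> src C G (Suc j) (msrc C G i (Suc j) a) = msrc C G i j a
   \<and> tgt C G (Suc j) (msrc C G i (Suc j) a) = mtgt C G i j a
   \<and> src C G (Suc j) (mtgt C G i (Suc j) a) = msrc C G i j a
   \<and> tgt C G (Suc j) (mtgt C G i (Suc j) a) = mtgt C G i j a"
proof (induction i arbitrary: a)
  case (Suc i)
  show ?case
  proof (cases "j = i")
    case True
    then show ?thesis using Suc by (simp add: msrc_one mtgt_one msrc_self mtgt_self)
  next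
    case False
    then have "j < i" using Suc by simp
    then show ?thesis using Suc.prems Suc.IH[of "src C G (Suc i) a"] Suc.IH[of "tgt C G (Suc i) a"]
      by (auto simp: msrc_Suc mtgt_Suc src_in tgt_in msrc_tgt mtgt_src)
  qed
qed simp

subsection \<open>Amalgamation along globular sums\<close>

lemma length_coproj: "table_ok is js \<Longrightarrow> length (snd (gsum C is js)) = length is"
  and coproj_in: "table_ok is js \<Longrightarrow> k < length is \<Longrightarrow>
    snd (gsum C is js) ! k \<in> chom C (gD C (is ! k)) (fst (gsum C is js))"
  and gsum_in: "table_ok is js \<Longrightarrow> fst (gsum C is js) \<in> cobj C"
  using colim[of "is" js] by (auto simp: is_colimit_def is_cocone_def)

lemma amal_ex1: assumes "grpd G" "table_ok is js" "us \<in> fiber_prod C G is js"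
  shows "\<exists>!\<xi>. \<xi> \<in> pob G (fst (gsum C is js)) \<and> map (\<lambda>e. pmor G e \<xi>) (snd (gsum C is js)) = us"
proof -
  have "bij_betw (\<lambda>a. map (\<lambda>e. pmor G e a) (snd (gsum C is js)))
                 (pob G (fst (gsum C is js))) (fiber_prod C G is js)"
    using assms by (simp add: infty_groupoid_def)
  then have "inj_on (\<lambda>a. map (\<lambda>e. pmor G e a) (snd (gsum C is js))) (pob G (fst (gsum C is js)))"
    "us \<in> (\<lambda>a. map (\<lambda>e. pmor G e a) (snd (gsum C is js))) ` pob G (fst (gsum C is js))"
    using assms(3) by (simp_all add: bij_betw_def)
  then show ?thesis by (auto simp: inj_on_def)
qed

lemma amal_in: "grpd G \<Longrightarrow> table_ok is js \<Longrightarrow> us \<in> fiber_prod C G is js \<Longrightarrow>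
    amal C G is js us \<in> pob G (fst (gsum C is js))"
  and amal_map: "grpd G \<Longrightarrow> table_ok is js \<Longrightarrow> us \<in> fiber_prod C G is js \<Longrightarrow>
    map (\<lambda>e. pmor G e (amal C G is js us)) (snd (gsum C is js)) = us"
  using theI'[OF amal_ex1] unfolding amal_def by blast+

lemma amal_nth: assumes "grpd G" "table_ok is js" "us \<in> fiber_prod C G is js" "k < length is"
  shows "pmor G (snd (gsum C is js) ! k) (amal C G is js us) = us ! k"
proof -
  have "map (\<lambda>e. pmor G e (amal C G is js us)) (snd (gsum C is js)) ! k = us ! k"
    using assms by (simp only: amal_map)
  then show ?thesis using assms by (simp add: length_coproj)
qed

lemma amal_eqI: assumes "grpd G" "table_ok is js" "us \<in> fiber_prod C G is js"
    "\<xi> \<in> pob G (fst (gsum C is js))"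
    "\<And>k. k < length is \<Longrightarrow> pmor G (snd (gsum C is js) ! k) \<xi> = us ! k"
  shows "amal C G is js us = \<xi>"
proof -
  have "map (\<lambda>e. pmor G e \<xi>) (snd (gsum C is js)) = us"
    using assms by (intro nth_equalityI) (auto simp: length_coproj fiber_prod_def)
  then show ?thesis using amal_ex1[OF assms(1-3)] assms(4) amal_in[OF assms(1-3)] amal_map[OF assms(1-3)]
    by blast
qed

abbreviation mor where "mor G H f \<equiv> groupoid_morphism C G H f"

lemma mor_in: "mor G H f \<Longrightarrow> x \<in> cobj C \<Longrightarrow> a \<in> pob G x \<Longrightarrow> f x a \<in> pob H x"
  and mor_pmor: "mor G H f \<Longrightarrow> m \<in> chom C x y \<Longrightarrow> a \<in> pob G y \<Longrightarrow> f x (pmor G m a) = pmor H m (f y a)"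
  unfolding groupoid_morphism_def by blast+

lemma mor_src: "mor G H f \<Longrightarrow> a \<in> arr C G (Suc n) \<Longrightarrow>
    f (gD C n) (src C G (Suc n) a) = src C H (Suc n) (f (gD C (Suc n)) a)"
  and mor_tgt: "mor G H f \<Longrightarrow> a \<in> arr C G (Suc n) \<Longrightarrow>
    f (gD C n) (tgt C G (Suc n) a) = tgt C H (Suc n) (f (gD C (Suc n)) a)"
  and mor_msrc: "mor G H f \<Longrightarrow> a \<in> arr C G i \<Longrightarrow> j \<le> i \<Longrightarrow>
    f (gD C j) (msrc C G i j a) = msrc C H i j (f (gD C i) a)"
  and mor_mtgt: "mor G H f \<Longrightarrow> a \<in> arr C G i \<Longrightarrow> j \<le> i \<Longrightarrow>
    f (gD C j) (mtgt C G i j a) = mtgt C H i j (f (gD C i) a)"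
  unfolding src_def tgt_def msrc_def mtgt_def by (blast intro: mor_pmor)+

text \<open>Naturality at the coprojections gives the image of the amalgam the right components, and
  in \<open>H\<close> the components determine the element.\<close>

lemma mor_amal: assumes "grpd G" "grpd H" "mor G H f" "table_ok is js" "us \<in> fiber_prod C G is js"
  shows "f (fst (gsum C is js)) (amal C G is js us) = amal C H is js (map2 (\<lambda>i. f (gD C i)) is us)"
proof (rule amal_eqI[symmetric, OF assms(2,4)])
  have len: "length us = length is" "length is = Suc (length js)"
    using assms by (auto simp: fiber_prod_def table_ok_def)
  have ok: "js ! k \<le> is ! k" "js ! k \<le> is ! Suc k" if "k < length js" for k
    using assms(4) that by (auto simp: table_ok_def less_imp_le)
  have us: "us ! k \<in> arr C G (is ! k)" if "k < length is" for k
    using assms(5) that by (simp add: fiber_prod_def)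
  have st: "pmor H (gsigs C (is ! k) (js ! k)) (f (gD C (is ! k)) (us ! k)) =
      pmor H (gtaus C (is ! Suc k) (js ! k)) (f (gD C (is ! Suc k)) (us ! Suc k))" if "k < length js" for k
  proof -
    have "pmor G (gsigs C (is ! k) (js ! k)) (us ! k) = pmor G (gtaus C (is ! Suc k) (js ! k)) (us ! Suc k)"
      using assms(5) that by (simp add: fiber_prod_def)
    then show ?thesis
      using mor_pmor[OF assms(3) gsigs_in[OF ok(1)[OF that]] us] mor_pmor[OF assms(3) gtaus_in[OF ok(2)[OF that]] us]
        that len by simp
  qed
  show "map2 (\<lambda>i. f (gD C i)) is us \<in> fiber_prod C H is js"
    using len assms(3) us st by (auto simp: fiber_prod_def intro: mor_in)
  show "f (fst (gsum C is js)) (amal C G is js us) \<in> pob H (fst (gsum C is js))"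
    using assms by (blast intro: gsum_in amal_in mor_in)
  fix k assume k: "k < length is"
  have "pmor H (snd (gsum C is js) ! k) (f (fst (gsum C is js)) (amal C G is js us)) =
     f (gD C (is ! k)) (pmor G (snd (gsum C is js) ! k) (amal C G is js us))"
    using assms k by (simp add: mor_pmor[OF _ coproj_in] amal_in)
  then show "pmor H (snd (gsum C is js) ! k) (f (fst (gsum C is js)) (amal C G is js us)) =
      map2 (\<lambda>i. f (gD C i)) is us ! k"
    using assms k len by (simp add: amal_nth)
qed

subsection \<open>Representable groupoids\<close>

lemma yon_arr [simp]: "pob (yon C X) D = chom C D X"
  and yon_pmor [simp]: "pmor (yon C X) \<phi> a = ccomp C a \<phi>"
  by (simp_all add: yon_def)

text \<open>A tuple in the fiber product of the sets Hom(D_i, X) is the same thing as a cocone with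
  vertex \<open>X\<close>, so the universal property of the globular sum is exactly the required
  bijection.\<close>

lemma yon_grpd: assumes "X \<in> cobj C" shows "grpd (yon C X)"
proof -
  have ps: "is_presheaf C (yon C X)"
    by (auto simp: is_presheaf_def id_right comp_assoc intro: comp_in)
  have "bij_betw (\<lambda>a. map (ccomp C a) (snd (gsum C is js))) (chom C (fst (gsum C is js)) X)
     (fiber_prod C (yon C X) is js)" if ok: "table_ok is js" for "is" js
  proof -
    let ?S = "fst (gsum C is js)" and ?e = "snd (gsum C is js)"
    have len: "length is = Suc (length js)" using ok by (simp add: table_ok_def)
    have jk: "js ! k \<le> is ! k" "js ! k \<le> is ! Suc k" if "k < length js" for k
      using ok that by (auto simp: table_ok_def less_imp_le)
    have cc: "is_cocone C is js ?S ?e"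
      and un: "is_cocone C is js X us \<Longrightarrow> \<exists>!h. h \<in> chom C ?S X \<and> (\<forall>k<length is. ccomp C h (?e ! k) = us ! k)" for us
      using colim[OF ok] by (auto simp: is_colimit_def)
    have fp: "us \<in> fiber_prod C (yon C X) is js \<longleftrightarrow> is_cocone C is js X us" for us
      using assms by (auto simp: fiber_prod_def is_cocone_def)
    have img: "map (ccomp C a) ?e \<in> fiber_prod C (yon C X) is js" if "a \<in> chom C ?S X" for a
      using that len jk cc
      by (auto simp: fiber_prod_def is_cocone_def comp_assoc[OF gsigs_in coproj_in[OF ok]]
         comp_assoc[OF gtaus_in coproj_in[OF ok]] intro: comp_in)
    have mapeq: "map (ccomp C a) ?e = us \<longleftrightarrow> (\<forall>k<length is. ccomp C a (?e ! k) = us ! k)"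
      if "length us = length is" for a us
      using that length_coproj[OF ok] by (auto simp: list_eq_iff_nth_eq)
    show ?thesis
    proof (rule bij_betwI')
      fix a b assume ab: "a \<in> chom C ?S X" "b \<in> chom C ?S X"
      show "(map (ccomp C a) ?e = map (ccomp C b) ?e) = (a = b)"
      proof
        assume eq: "map (ccomp C a) ?e = map (ccomp C b) ?e"
        have "is_cocone C is js X (map (ccomp C a) ?e)" using fp img[OF ab(1)] by simp
        from un[OF this] show "a = b"
          using ab mapeq[of "map (ccomp C a) ?e"] length_coproj[OF ok] eq by (metis length_map)
      qed simp
    next
      fix us assume us: "us \<in> fiber_prod C (yon C X) is js"
      then obtain h where "h \<in> chom C ?S X" "\<forall>k<length is. ccomp C h (?e ! k) = us ! k"
        using un fp by blast
      then show "\<exists>h\<in>chom C ?S X. us = map (ccomp C h) ?e"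
        using mapeq[of us h] us by (auto simp: fiber_prod_def)
    qed (use img in auto)
  qed
  then show ?thesis using ps by (simp add: infty_groupoid_def)
qed

lemma yon_mor: "grpd G \<Longrightarrow> \<xi> \<in> pob G X \<Longrightarrow> mor (yon C X) G (\<lambda>D \<phi>. pmor G \<phi> \<xi>)"
  by (auto simp: groupoid_morphism_def pmor_comp intro: pmor_in)

lemma coproj_fiber_prod: assumes "table_ok is js"
  shows "snd (gsum C is js) \<in> fiber_prod C (yon C (fst (gsum C is js))) is js"
  using colim[OF assms] by (auto simp: fiber_prod_def is_colimit_def is_cocone_def)

section \<open>Contractibility as filling in representable groupoids\<close>

definition parallel :: "('o,'m,'a) psh \<Rightarrow> nat \<Rightarrow> 'a \<Rightarrow> 'a \<Rightarrow> bool" where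
  "parallel G n a b \<longleftrightarrow> n = 0 \<or> (src C G n a = src C G n b \<and> tgt C G n a = tgt C G n b)"

lemma filler: assumes "table_ok is js" "table_dim is js \<le> Suc n"
    "p \<in> arr C (yon C (fst (gsum C is js))) n" "q \<in> arr C (yon C (fst (gsum C is js))) n"
    "parallel (yon C (fst (gsum C is js))) n p q"
  shows "\<exists>h \<in> arr C (yon C (fst (gsum C is js))) (Suc n).
    src C (yon C (fst (gsum C is js))) (Suc n) h = p \<and> tgt C (yon C (fst (gsum C is js))) (Suc n) h = q"
proof -
  have "glob_parallel C n p q"
    using assms(5) by (simp add: parallel_def glob_parallel_def src_def tgt_def)
  then show ?thesis
    using contr assms(1-4) unfolding contractible_def src_def tgt_def yon_arr yon_pmor by blast
qed

text \<open>Contractibility speaks of the chosen globular sums, and the sum chosen for the one-entry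
  table \<open>[m]\<close> is merely isomorphic to D_m. The pair is pushed into that sum, filled
  there and brought back by a retraction.\<close>

lemma disk_filler: assumes "m \<le> Suc n" "p \<in> arr C (yon C (gD C m)) n" "q \<in> arr C (yon C (gD C m)) n"
    "parallel (yon C (gD C m)) n p q"
  shows "\<exists>h \<in> arr C (yon C (gD C m)) (Suc n).
    src C (yon C (gD C m)) (Suc n) h = p \<and> tgt C (yon C (gD C m)) (Suc n) h = q"
proof -
  let ?S = "fst (gsum C [m] [])" and ?e = "snd (gsum C [m] []) ! 0"
  have ok: "table_ok [m] []" by (simp add: table_ok_def)
  have e: "?e \<in> chom C (gD C m) ?S" using coproj_in[OF ok, of 0] by simp
  \<comment> \<open>The identity of D_m is a cocone on the one-entry diagram; its factorization
    \<open>r\<close> is the retraction.\<close>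
  have "is_cocone C [m] [] (gD C m) [cid C (gD C m)]" by (auto simp: is_cocone_def)
  then have "\<exists>!h. h \<in> chom C ?S (gD C m) \<and> (\<forall>k<length [m]. ccomp C h (snd (gsum C [m] []) ! k) = [cid C (gD C m)] ! k)"
    using colim[OF ok] unfolding is_colimit_def by blast
  then obtain r where r: "r \<in> chom C ?S (gD C m)" "ccomp C r ?e = cid C (gD C m)"
    by auto
  have ret: "ccomp C r (ccomp C ?e p) = p" if "p \<in> chom C D (gD C m)" for p D
    using that r e comp_assoc[OF that e r(1)] by (simp add: id_left)
  have "parallel (yon C ?S) n (ccomp C ?e p) (ccomp C ?e q)"
    using assms e by (cases n) (auto simp: parallel_def src_def tgt_def
      comp_assoc[OF sig_in _ e] comp_assoc[OF tau_in _ e])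
  then obtain h where h: "h \<in> chom C (gD C (Suc n)) ?S" "ccomp C h (gsig C (Suc n)) = ccomp C ?e p"
     "ccomp C h (gtau C (Suc n)) = ccomp C ?e q"
    using filler[OF ok, of n "ccomp C ?e p" "ccomp C ?e q"] assms(1) comp_in[OF _ e] assms(2,3)
    by (auto simp: table_dim_def src_def tgt_def)
  have "ccomp C r h \<in> chom C (gD C (Suc n)) (gD C m)" using h(1) r(1) by (rule comp_in)
  then show ?thesis
    using h assms(2,3) by (intro bexI[of _ "ccomp C r h"])
      (simp_all add: src_def tgt_def comp_assoc[OF sig_in h(1) r(1)] comp_assoc[OF tau_in h(1) r(1)] ret)
qed

end

text \<open>The composite \<open>z\<^sub>1 *\<^sub>l a *\<^sub>l z\<^sub>2\<close> of an \<open>i\<close>-arrow with \<open>(l+1)\<close>-arrows, made dimensionally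
  homogeneous by units.\<close>

definition conj_arr :: "('o,'m) gcat \<Rightarrow> ('o,'m,'a) psh \<Rightarrow> nat \<Rightarrow> nat \<Rightarrow> 'a \<Rightarrow> 'a \<Rightarrow> 'a \<Rightarrow> 'a" where
  "conj_arr C G l i z1 a z2 = gcomp C G i l (gunits C G (Suc l) (i - Suc l) z1)
     (gcomp C G i l a (gunits C G (Suc l) (i - Suc l) z2))"

definition htp :: "('o,'m) gcat \<Rightarrow> ('o,'m,'a) psh \<Rightarrow> nat \<Rightarrow> 'a \<Rightarrow> 'a \<Rightarrow> bool" where
  "htp C G n a b \<longleftrightarrow> (\<exists>c\<in>arr C G (Suc n). src C G (Suc n) c = a \<and> tgt C G (Suc n) c = b)"

context pregroupoidal_extension
begin

subsection \<open>Composition, units and inverses\<close>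

lemma table2: "j < i \<Longrightarrow> table_ok [i, i] [j]"
  by (simp add: table_ok_def)

lemma pair_fiber_prod: "[v, u] \<in> fiber_prod C G [i, i] [j] \<longleftrightarrow>
    v \<in> arr C G i \<and> u \<in> arr C G i \<and> msrc C G i j v = mtgt C G i j u"
  by (auto simp: fiber_prod_def msrc_def mtgt_def less_Suc_eq)

lemma gcomp_amal: assumes "j < i"
  shows "gcomp C G i j v u = pmor G (pnabla C i j) (amal C G [i,i] [j] [v,u])"
proof -
  have "length (snd (gsum C [i,i] [j])) = 2" using length_coproj[OF table2[OF assms]] by simp
  then obtain x y where "snd (gsum C [i,i] [j]) = [x,y]"
    by (auto simp: length_Suc_conv numeral_2_eq_2)
  then show ?thesis by (simp add: gcomp_def amal_def)
qed

lemma nabla_in: "j < i \<Longrightarrow> pnabla C i j \<in> chom C (gD C i) (fst (gsum C [i,i] [j]))"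
  using pregr by (simp add: pregroupoidal_def)

lemma nabla_sig: "ccomp C (pnabla C (Suc j) j) (gsig C (Suc j)) = ccomp C (snd (gsum C [Suc j,Suc j] [j]) ! 1) (gsig C (Suc j))"
  and nabla_tau: "ccomp C (pnabla C (Suc j) j) (gtau C (Suc j)) = ccomp C (snd (gsum C [Suc j,Suc j] [j]) ! 0) (gtau C (Suc j))"
  using pregr unfolding pregroupoidal_def by (metis diff_Suc_1 lessI)+

lemma nabla_sig_less: "j < i \<Longrightarrow> \<exists>h\<in>chom C (fst (gsum C [i,i] [j])) (fst (gsum C [Suc i,Suc i] [j])).
    ccomp C h (snd (gsum C [i,i] [j]) ! 0) = ccomp C (snd (gsum C [Suc i,Suc i] [j]) ! 0) (gsig C (Suc i)) \<and>
    ccomp C h (snd (gsum C [i,i] [j]) ! 1) = ccomp C (snd (gsum C [Suc i,Suc i] [j]) ! 1) (gsig C (Suc i)) \<and>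
    ccomp C (pnabla C (Suc i) j) (gsig C (Suc i)) = ccomp C h (pnabla C i j)"
  and nabla_tau_less: "j < i \<Longrightarrow> \<exists>h\<in>chom C (fst (gsum C [i,i] [j])) (fst (gsum C [Suc i,Suc i] [j])).
    ccomp C h (snd (gsum C [i,i] [j]) ! 0) = ccomp C (snd (gsum C [Suc i,Suc i] [j]) ! 0) (gtau C (Suc i)) \<and>
    ccomp C h (snd (gsum C [i,i] [j]) ! 1) = ccomp C (snd (gsum C [Suc i,Suc i] [j]) ! 1) (gtau C (Suc i)) \<and>
    ccomp C (pnabla C (Suc i) j) (gtau C (Suc i)) = ccomp C h (pnabla C i j)"
  using pregr[unfolded pregroupoidal_def, THEN conjunct1, rule_format, of j "Suc i"] by simp_all

definition composable :: "('o,'m,'a) psh \<Rightarrow> nat \<Rightarrow> nat \<Rightarrow> 'a \<Rightarrow> 'a \<Rightarrow> bool" where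
  "composable G i j v u \<longleftrightarrow> j < i \<and> v \<in> arr C G i \<and> u \<in> arr C G i \<and> msrc C G i j v = mtgt C G i j u"

lemma pair_amal: assumes "grpd G" "composable G i j v u"
  shows "amal C G [i,i] [j] [v,u] \<in> pob G (fst (gsum C [i,i] [j]))"
    "pmor G (snd (gsum C [i,i] [j]) ! 0) (amal C G [i,i] [j] [v,u]) = v"
    "pmor G (snd (gsum C [i,i] [j]) ! 1) (amal C G [i,i] [j] [v,u]) = u"
  using assms amal_in[OF assms(1) table2, of j i "[v,u]"] amal_nth[OF assms(1) table2, of j i "[v,u]" 0]
    amal_nth[OF assms(1) table2, of j i "[v,u]" 1]
  by (auto simp: pair_fiber_prod composable_def)

lemma gcomp_in: assumes "grpd G" "composable G i j v u" shows "gcomp C G i j v u \<in> arr C G i"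
  using pair_amal[OF assms] assms nabla_in by (auto simp: gcomp_amal composable_def intro: pmor_in)

lemma pair_coproj: assumes "j < i"
  shows "snd (gsum C [i,i] [j]) ! 0 \<in> chom C (gD C i) (fst (gsum C [i,i] [j]))"
    "snd (gsum C [i,i] [j]) ! 1 \<in> chom C (gD C i) (fst (gsum C [i,i] [j]))"
  using coproj_in[OF table2[OF assms], of 0] coproj_in[OF table2[OF assms], of 1] by simp_all

lemma src_gcomp: assumes "grpd G" "composable G (Suc j) j v u"
  shows "src C G (Suc j) (gcomp C G (Suc j) j v u) = src C G (Suc j) u"
    "tgt C G (Suc j) (gcomp C G (Suc j) j v u) = tgt C G (Suc j) v"
proof -
  note am = pair_amal[OF assms]
  show "src C G (Suc j) (gcomp C G (Suc j) j v u) = src C G (Suc j) u"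
    using pmor_comp[OF assms(1) sig_in nabla_in am(1)] pmor_comp[OF assms(1) sig_in pair_coproj(2) am(1)] am
    by (simp add: gcomp_amal src_def nabla_sig)
  show "tgt C G (Suc j) (gcomp C G (Suc j) j v u) = tgt C G (Suc j) v"
    using pmor_comp[OF assms(1) tau_in nabla_in am(1)] pmor_comp[OF assms(1) tau_in pair_coproj(1) am(1)] am
    by (simp add: gcomp_amal tgt_def nabla_tau)
qed

lemma composable_src: assumes "grpd G" "composable G (Suc i) j v u" "j < i"
  shows "composable G i j (src C G (Suc i) v) (src C G (Suc i) u)"
   "composable G i j (tgt C G (Suc i) v) (tgt C G (Suc i) u)"
  using assms by (auto simp: composable_def msrc_Suc mtgt_Suc msrc_tgt mtgt_src)

text \<open>The map h in the axiom for nabla is the amalgamated sum of two copies of a face map, so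
  it acts on G by sending the element with components (v, u) to the one whose components are the
  faces of v and u.\<close>

lemma src_gcomp_less: assumes G: "grpd G" and c: "composable G (Suc i) j v u" and ji: "j < i"
  shows "src C G (Suc i) (gcomp C G (Suc i) j v u) = gcomp C G i j (src C G (Suc i) v) (src C G (Suc i) u)"
    "tgt C G (Suc i) (gcomp C G (Suc i) j v u) = gcomp C G i j (tgt C G (Suc i) v) (tgt C G (Suc i) u)"
proof -
  let ?x = "amal C G [Suc i,Suc i] [j] [v,u]"
  have j: "j < Suc i" using ji by simp
  note am = pair_amal[OF G c]
  \<comment> \<open>Here \<open>m\<close> stands for sigma or tau, so that source and target are
    settled by one computation.\<close>
  have main: "pmor G m (gcomp C G (Suc i) j v u) = gcomp C G i j (pmor G m v) (pmor G m u)"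
    if m: "m \<in> chom C (gD C i) (gD C (Suc i))" and cm: "composable G i j (pmor G m v) (pmor G m u)"
      and h: "h\<in>chom C (fst (gsum C [i,i] [j])) (fst (gsum C [Suc i,Suc i] [j]))"
      "ccomp C h (snd (gsum C [i,i] [j]) ! 0) = ccomp C (snd (gsum C [Suc i,Suc i] [j]) ! 0) m"
      "ccomp C h (snd (gsum C [i,i] [j]) ! 1) = ccomp C (snd (gsum C [Suc i,Suc i] [j]) ! 1) m"
      "ccomp C (pnabla C (Suc i) j) m = ccomp C h (pnabla C i j)" for m h
  proof -
    have "amal C G [i,i] [j] [pmor G m v, pmor G m u] = pmor G h ?x"
    proof (rule amal_eqI[OF G table2[OF ji]])
      show "[pmor G m v, pmor G m u] \<in> fiber_prod C G [i,i] [j]"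
        using cm by (simp add: pair_fiber_prod composable_def)
      show "pmor G h ?x \<in> pob G (fst (gsum C [i,i] [j]))" using G h am by (blast intro: pmor_in)
      fix k assume "k < length [i,i]"
      then consider "k = 0" | "k = 1" by fastforce
      then show "pmor G (snd (gsum C [i,i] [j]) ! k) (pmor G h ?x) = [pmor G m v, pmor G m u] ! k"
      proof cases
        case 1
        then show ?thesis
          using pmor_comp[OF G pair_coproj(1)[OF ji] h(1) am(1)] h(2)
            pmor_comp[OF G m pair_coproj(1)[OF j] am(1)] am by simp
      next
        case 2
        then show ?thesis
          using pmor_comp[OF G pair_coproj(2)[OF ji] h(1) am(1)] h(3)
            pmor_comp[OF G m pair_coproj(2)[OF j] am(1)] am by simp
      qed
    qed
    then show ?thesis
      using pmor_comp[OF G m nabla_in[OF j] am(1)] pmor_comp[OF G nabla_in[OF ji] h(1) am(1)] h(4)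
      by (simp add: gcomp_amal[OF j] gcomp_amal[OF ji])
  qed
  show "src C G (Suc i) (gcomp C G (Suc i) j v u) = gcomp C G i j (src C G (Suc i) v) (src C G (Suc i) u)"
    using nabla_sig_less[OF ji] main[OF sig_in] composable_src[OF G c ji] unfolding src_def by blast
  show "tgt C G (Suc i) (gcomp C G (Suc i) j v u) = gcomp C G i j (tgt C G (Suc i) v) (tgt C G (Suc i) u)"
    using nabla_tau_less[OF ji] main[OF tau_in] composable_src[OF G c ji] unfolding tgt_def by blast
qed

lemma msrc_gcomp: "grpd G \<Longrightarrow> composable G i j v u \<Longrightarrow> msrc C G i j (gcomp C G i j v u) = msrc C G i j u
   \<and> mtgt C G i j (gcomp C G i j v u) = mtgt C G i j v"
proof (induction i arbitrary: v u)
  case 0 then show ?case by (simp add: composable_def)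
next
  case (Suc i)
  note c = gcomp_in[OF Suc.prems]
  have j: "j \<le> i" and vu: "v \<in> arr C G (Suc i)" "u \<in> arr C G (Suc i)" using Suc.prems by (auto simp: composable_def)
  show ?case
  proof (cases "j = i")
    case True
    then show ?thesis using Suc.prems c vu src_gcomp[of G j v u] by (simp add: msrc_one mtgt_one)
  next
    case False
    then have ji: "j < i" using j by simp
    note cs = composable_src[OF Suc.prems ji]
    show ?thesis
      using Suc.IH[OF Suc.prems(1) cs(1)] Suc.IH[OF Suc.prems(1) cs(2)] src_gcomp_less[OF Suc.prems ji] j vu c Suc.prems(1)
      by (simp add: msrc_Suc mtgt_Suc)
  qed
qed

lemma mor_gcomp: assumes "grpd G" "grpd H" "mor G H f" "composable G i j v u"
  shows "f (gD C i) (gcomp C G i j v u) = gcomp C H i j (f (gD C i) v) (f (gD C i) u)"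
proof -
  have j: "j < i" using assms(4) by (simp add: composable_def)
  then show ?thesis
    using mor_amal[OF assms(1-3) table2[OF j], of "[v,u]"] assms(4)
      mor_pmor[OF assms(3) nabla_in[OF j] pair_amal(1)[OF assms(1,4)]]
    by (simp add: gcomp_amal[OF j] pair_fiber_prod composable_def)
qed

lemma kappa_in: "pkappa C i \<in> chom C (gD C (Suc i)) (gD C i)"
  and kappa_sig: "ccomp C (pkappa C i) (gsig C (Suc i)) = cid C (gD C i)"
  and kappa_tau: "ccomp C (pkappa C i) (gtau C (Suc i)) = cid C (gD C i)"
  using pregr by (auto simp: pregroupoidal_def)

lemma gunit_in [intro]: "grpd G \<Longrightarrow> a \<in> arr C G i \<Longrightarrow> gunit C G i a \<in> arr C G (Suc i)"
  unfolding gunit_def using kappa_in by (blast intro: pmor_in)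

lemma src_gunit: "grpd G \<Longrightarrow> a \<in> arr C G i \<Longrightarrow> src C G (Suc i) (gunit C G i a) = a"
  and tgt_gunit: "grpd G \<Longrightarrow> a \<in> arr C G i \<Longrightarrow> tgt C G (Suc i) (gunit C G i a) = a"
  using pmor_comp[OF _ sig_in kappa_in, of G a i] pmor_comp[OF _ tau_in kappa_in, of G a i]
  by (simp_all add: gunit_def src_def tgt_def kappa_sig kappa_tau pmor_id)

lemma mor_gunit: "mor G H f \<Longrightarrow> a \<in> arr C G i \<Longrightarrow>
    f (gD C (Suc i)) (gunit C G i a) = gunit C H i (f (gD C i) a)"
  unfolding gunit_def by (rule mor_pmor[OF _ kappa_in])

lemma gunits_in: "grpd G \<Longrightarrow> a \<in> arr C G j \<Longrightarrow> gunits C G j k a \<in> arr C G (j + k)"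
  by (induction k) auto

lemma msrc_gunits: "grpd G \<Longrightarrow> a \<in> arr C G j \<Longrightarrow> l \<le> j \<Longrightarrow>
   msrc C G (j + k) l (gunits C G j k a) = msrc C G j l a \<and> mtgt C G (j + k) l (gunits C G j k a) = mtgt C G j l a"
  by (induction k) (simp_all add: msrc_Suc mtgt_Suc gunits_in gunit_in src_gunit tgt_gunit)

lemma mor_gunits: "grpd G \<Longrightarrow> mor G H f \<Longrightarrow> a \<in> arr C G j \<Longrightarrow>
    f (gD C (j + k)) (gunits C G j k a) = gunits C H j k (f (gD C j) a)"
  by (induction k) (simp_all add: mor_gunit gunits_in)

lemma w_in: "pw C (Suc k) k \<in> chom C (gD C (Suc k)) (gD C (Suc k))"
  and w_sig: "ccomp C (pw C (Suc k) k) (gsig C (Suc k)) = gtau C (Suc k)"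
  and w_tau: "ccomp C (pw C (Suc k) k) (gtau C (Suc k)) = gsig C (Suc k)"
  using pregr[unfolded pregroupoidal_def, THEN conjunct2, THEN conjunct2, rule_format, of k "Suc k"]
  by simp_all

lemma ginv_in [intro]: "grpd G \<Longrightarrow> a \<in> arr C G (Suc k) \<Longrightarrow> ginv C G k a \<in> arr C G (Suc k)"
  unfolding ginv_def using w_in by (blast intro: pmor_in)

lemma src_ginv: "grpd G \<Longrightarrow> a \<in> arr C G (Suc k) \<Longrightarrow> src C G (Suc k) (ginv C G k a) = tgt C G (Suc k) a"
  and tgt_ginv: "grpd G \<Longrightarrow> a \<in> arr C G (Suc k) \<Longrightarrow> tgt C G (Suc k) (ginv C G k a) = src C G (Suc k) a"
  using pmor_comp[OF _ sig_in w_in, of G a k] pmor_comp[OF _ tau_in w_in, of G a k]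
  by (simp_all add: ginv_def src_def tgt_def w_sig w_tau)

lemma mor_ginv: "mor G H f \<Longrightarrow> a \<in> arr C G (Suc k) \<Longrightarrow>
    f (gD C (Suc k)) (ginv C G k a) = ginv C H k (f (gD C (Suc k)) a)"
  unfolding ginv_def by (rule mor_pmor[OF _ w_in])

subsection \<open>Homotopy of arrows\<close>

lemma htp_refl: "grpd G \<Longrightarrow> a \<in> arr C G n \<Longrightarrow> htp C G n a a"
  unfolding htp_def by (intro bexI[of _ "gunit C G n a"] conjI src_gunit tgt_gunit gunit_in)

lemma htp_sym: "grpd G \<Longrightarrow> htp C G n a b \<Longrightarrow> htp C G n b a"
  unfolding htp_def by (metis src_ginv tgt_ginv ginv_in)

lemma htp_trans: assumes G: "grpd G" and "htp C G n a b" "htp C G n b c" shows "htp C G n a c"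
proof -
  obtain x y where x: "x \<in> arr C G (Suc n)" "src C G (Suc n) x = a" "tgt C G (Suc n) x = b"
    and y: "y \<in> arr C G (Suc n)" "src C G (Suc n) y = b" "tgt C G (Suc n) y = c"
    using assms by (auto simp: htp_def)
  have "composable G (Suc n) n y x" using x y G by (simp add: composable_def msrc_one mtgt_one)
  then show ?thesis using gcomp_in[OF G] src_gcomp[OF G] x y unfolding htp_def by metis
qed

lemma htp_mor: "mor G H f \<Longrightarrow> htp C G n a b \<Longrightarrow> htp C H n (f (gD C n) a) (f (gD C n) b)"
  unfolding htp_def by (elim bexE, intro bexI[of _ "f (gD C (Suc n)) _"])
    (auto simp: mor_src[symmetric] mor_tgt[symmetric] intro: mor_in)

subsection \<open>Two-sided whiskering\<close>

definition whiskerable :: "('o,'m,'a) psh \<Rightarrow> nat \<Rightarrow> nat \<Rightarrow> 'a \<Rightarrow> 'a \<Rightarrow> 'a \<Rightarrow> bool" where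
  "whiskerable G l i z1 a z2 \<longleftrightarrow> l < i \<and> z1 \<in> arr C G (Suc l) \<and> a \<in> arr C G i \<and> z2 \<in> arr C G (Suc l) \<and>
     src C G (Suc l) z1 = mtgt C G i l a \<and> tgt C G (Suc l) z2 = msrc C G i l a"

lemma whiskerable_src: assumes "grpd G" "whiskerable G l (Suc i) z1 a z2" "l < i"
  shows "whiskerable G l i z1 (src C G (Suc i) a) z2" "whiskerable G l i z1 (tgt C G (Suc i) a) z2"
  using assms by (auto simp: whiskerable_def msrc_Suc mtgt_Suc msrc_tgt mtgt_src)

lemma whiskerable_msrc: "grpd G \<Longrightarrow> whiskerable G l i z1 a z2 \<Longrightarrow> l < n \<Longrightarrow> n \<le> i \<Longrightarrow>
  whiskerable G l n z1 (msrc C G i n a) z2 \<and> whiskerable G l n z1 (mtgt C G i n a) z2"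
proof (induction i arbitrary: a)
  case (Suc i)
  show ?case
  proof (cases "n = Suc i")
    case True
    then show ?thesis using Suc by (auto simp: msrc_self mtgt_self whiskerable_def)
  next
    case False
    then have "n \<le> i" "l < i" using Suc by auto
    moreover have "a \<in> arr C G (Suc i)" using Suc by (simp add: whiskerable_def)
    ultimately show ?thesis using Suc.IH[OF Suc.prems(1)] whiskerable_src[OF Suc.prems(1,2)] Suc.prems(1,3)
      by (simp add: msrc_Suc mtgt_Suc)
  qed
qed simp

lemma whisker_units: assumes "grpd G" "z \<in> arr C G (Suc l)" "l < i"
  shows "gunits C G (Suc l) (i - Suc l) z \<in> arr C G i"
    "msrc C G i l (gunits C G (Suc l) (i - Suc l) z) = src C G (Suc l) z"
    "mtgt C G i l (gunits C G (Suc l) (i - Suc l) z) = tgt C G (Suc l) z"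
  using assms gunits_in[OF assms(1,2), of "i - Suc l"] msrc_gunits[OF assms(1,2), of l "i - Suc l"]
  by (simp_all add: msrc_one mtgt_one)

lemma whiskerable_composable: assumes "grpd G" "whiskerable G l i z1 a z2"
  shows "composable G i l a (gunits C G (Suc l) (i - Suc l) z2)"
    "composable G i l (gunits C G (Suc l) (i - Suc l) z1) (gcomp C G i l a (gunits C G (Suc l) (i - Suc l) z2))"
proof -
  show 1: "composable G i l a (gunits C G (Suc l) (i - Suc l) z2)"
    using assms whisker_units[OF assms(1)] by (simp add: composable_def whiskerable_def)
  show "composable G i l (gunits C G (Suc l) (i - Suc l) z1) (gcomp C G i l a (gunits C G (Suc l) (i - Suc l) z2))"
    using assms whisker_units[OF assms(1)] gcomp_in[OF assms(1) 1] msrc_gcomp[OF assms(1) 1]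
    by (simp add: composable_def whiskerable_def)
qed

lemma conj_in: "grpd G \<Longrightarrow> whiskerable G l i z1 a z2 \<Longrightarrow> conj_arr C G l i z1 a z2 \<in> arr C G i"
  unfolding conj_arr_def by (blast intro: gcomp_in whiskerable_composable)

lemma msrc_conj: assumes "grpd G" "whiskerable G l i z1 a z2"
  shows "msrc C G i l (conj_arr C G l i z1 a z2) = src C G (Suc l) z2"
    "mtgt C G i l (conj_arr C G l i z1 a z2) = tgt C G (Suc l) z1"
  using assms msrc_gcomp[OF assms(1) whiskerable_composable(1)[OF assms]]
    msrc_gcomp[OF assms(1) whiskerable_composable(2)[OF assms]] whisker_units[OF assms(1)]
  by (simp_all add: conj_arr_def whiskerable_def)

lemma src_conj_base: assumes "grpd G" "whiskerable G l (Suc l) z1 a z2"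
  shows "src C G (Suc l) (conj_arr C G l (Suc l) z1 a z2) = src C G (Suc l) z2"
    "tgt C G (Suc l) (conj_arr C G l (Suc l) z1 a z2) = tgt C G (Suc l) z1"
  using msrc_conj[OF assms] conj_in[OF assms] assms(1) by (simp_all add: msrc_one mtgt_one)

text \<open>In dimension i + 1 the whiskering arrows carry one more unit than in dimension i, and
  both faces of a unit are the arrow it was formed on. Since l < i, composition along dimension l
  commutes with the faces, hence whiskering by fixed \<open>z1\<close>, \<open>z2\<close> does
  too.\<close>

lemma src_conj: assumes "grpd G" "whiskerable G l (Suc i) z1 a z2" "l < i"
  shows "src C G (Suc i) (conj_arr C G l (Suc i) z1 a z2) = conj_arr C G l i z1 (src C G (Suc i) a) z2"
    "tgt C G (Suc i) (conj_arr C G l (Suc i) z1 a z2) = conj_arr C G l i z1 (tgt C G (Suc i) a) z2"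
proof -
  have k: "Suc i - Suc l = Suc (i - Suc l)" "Suc l + (i - Suc l) = i" using assms(3) by auto
  have z: "z1 \<in> arr C G (Suc l)" "z2 \<in> arr C G (Suc l)" using assms(2) by (auto simp: whiskerable_def)
  have u: "src C G (Suc i) (gunits C G (Suc l) (Suc i - Suc l) z) = gunits C G (Suc l) (i - Suc l) z"
     "tgt C G (Suc i) (gunits C G (Suc l) (Suc i - Suc l) z) = gunits C G (Suc l) (i - Suc l) z"
    if "z \<in> arr C G (Suc l)" for z
    using src_gunit[OF assms(1) whisker_units(1)[OF assms(1) that assms(3)]]
     tgt_gunit[OF assms(1) whisker_units(1)[OF assms(1) that assms(3)]] unfolding k(1) gunits.simps k(2) by simp_all
  note c = whiskerable_composable[OF assms(1,2)]
  show "src C G (Suc i) (conj_arr C G l (Suc i) z1 a z2) = conj_arr C G l i z1 (src C G (Suc i) a) z2"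
    unfolding conj_arr_def by (simp only: src_gcomp_less[OF assms(1) c(2) assms(3)] src_gcomp_less[OF assms(1) c(1) assms(3)] u z)
  show "tgt C G (Suc i) (conj_arr C G l (Suc i) z1 a z2) = conj_arr C G l i z1 (tgt C G (Suc i) a) z2"
    unfolding conj_arr_def by (simp only: src_gcomp_less[OF assms(1) c(2) assms(3)] src_gcomp_less[OF assms(1) c(1) assms(3)] u z)
qed

lemma mor_conj: assumes "grpd G" "grpd H" "mor G H f" "whiskerable G l i z1 a z2"
  shows "f (gD C i) (conj_arr C G l i z1 a z2) =
     conj_arr C H l i (f (gD C (Suc l)) z1) (f (gD C i) a) (f (gD C (Suc l)) z2)"
proof -
  have "Suc l + (i - Suc l) = i" using assms(4) by (auto simp: whiskerable_def)
  then have u: "f (gD C i) (gunits C G (Suc l) (i - Suc l) z) = gunits C H (Suc l) (i - Suc l) (f (gD C (Suc l)) z)"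
    if "z \<in> arr C G (Suc l)" for z using mor_gunits[OF assms(1,3) that, of "i - Suc l"] by simp
  have z: "z1 \<in> arr C G (Suc l)" "z2 \<in> arr C G (Suc l)" using assms(4) by (auto simp: whiskerable_def)
  show ?thesis
    unfolding conj_arr_def
    by (simp only: mor_gcomp[OF assms(1-3) whiskerable_composable(2)[OF assms(1,4)]]
      mor_gcomp[OF assms(1-3) whiskerable_composable(1)[OF assms(1,4)]] u z)
qed

end

section \<open>Bijectivity up to homotopy through a range of dimensions\<close>

text \<open>This is bijectivity on homotopy classes, phrased with representatives so that quotients
  stay out of the argument until the homotopy groups appear. That \<open>g\<close> respects
  endpoints and homotopies is not part of it; \<open>globular_map\<close> or
  \<open>groupoid_morphism\<close> supplies that.\<close>

definition htp_bij :: "('o,'m) gcat \<Rightarrow> ('o,'m,'a) psh \<Rightarrow> ('o,'m,'b) psh \<Rightarrow> nat \<Rightarrow> ('a \<Rightarrow> 'b) \<Rightarrow> 'a \<Rightarrow> 'a \<Rightarrow> 'b \<Rightarrow> 'b \<Rightarrow> bool" where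
  "htp_bij C G H n g u v u' v' \<longleftrightarrow>
     (\<forall>c\<in>parrows C H n u' v'. \<exists>a\<in>parrows C G n u v. htp C H n (g a) c) \<and>
     (\<forall>a\<in>parrows C G n u v. \<forall>b\<in>parrows C G n u v. htp C H n (g a) (g b) \<longrightarrow> htp C G n a b)"

text \<open>A family \<open>F\<close> of maps on \<open>i\<close>-arrows (\<open>i > k\<close>) between the \<open>k\<close>-arrows \<open>u, v\<close> is bijective up to
  homotopy in dimensions \<open>k+1, \<dots>, k+1+r\<close>.\<close>

primrec equiv_upto :: "('o,'m) gcat \<Rightarrow> ('o,'m,'a) psh \<Rightarrow> nat \<Rightarrow> nat \<Rightarrow> (nat \<Rightarrow> 'a \<Rightarrow> 'a) \<Rightarrow> 'a \<Rightarrow> 'a \<Rightarrow> 'a \<Rightarrow> 'a \<Rightarrow> bool" where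
  "equiv_upto C G 0 k F u v u' v' \<longleftrightarrow> htp_bij C G G (Suc k) (F (Suc k)) u v u' v'"
| "equiv_upto C G (Suc r) k F u v u' v' \<longleftrightarrow> htp_bij C G G (Suc k) (F (Suc k)) u v u' v' \<and>
     (\<forall>p\<in>parrows C G (Suc k) u v. \<forall>q\<in>parrows C G (Suc k) u v.
        equiv_upto C G r (Suc k) F p q (F (Suc k) p) (F (Suc k) q))"

text \<open>The injective half of \<open>equiv_upto\<close>. It ranges over all parallel pairs
  \<open>p\<close>, \<open>q\<close>, not only those in the image of another map, so it can be
  applied after an arbitrary first factor.\<close>

primrec inj_upto :: "('o,'m) gcat \<Rightarrow> ('o,'m,'a) psh \<Rightarrow> nat \<Rightarrow> nat \<Rightarrow> (nat \<Rightarrow> 'a \<Rightarrow> 'a) \<Rightarrow> 'a \<Rightarrow> 'a \<Rightarrow> bool" where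
  "inj_upto C G 0 k F u v \<longleftrightarrow> (\<forall>a\<in>parrows C G (Suc k) u v. \<forall>b\<in>parrows C G (Suc k) u v.
     htp C G (Suc k) (F (Suc k) a) (F (Suc k) b) \<longrightarrow> htp C G (Suc k) a b)"
| "inj_upto C G (Suc r) k F u v \<longleftrightarrow> (\<forall>a\<in>parrows C G (Suc k) u v. \<forall>b\<in>parrows C G (Suc k) u v.
     htp C G (Suc k) (F (Suc k) a) (F (Suc k) b) \<longrightarrow> htp C G (Suc k) a b) \<and>
     (\<forall>p\<in>parrows C G (Suc k) u v. \<forall>q\<in>parrows C G (Suc k) u v. inj_upto C G r (Suc k) F p q)"

definition over :: "('o,'m) gcat \<Rightarrow> ('o,'m,'a) psh \<Rightarrow> nat \<Rightarrow> nat \<Rightarrow> 'a \<Rightarrow> 'a \<Rightarrow> 'a set" where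
  "over C G k i u v = {a \<in> arr C G i. msrc C G i k a = u \<and> mtgt C G i k a = v}"

text \<open>Compatibility with faces starts at the faces of (k+2)-arrows: in dimension k + 1 the
  endpoints are the prescribed \<open>u'\<close>, \<open>v'\<close>, and \<open>F k\<close> has no
  meaning.\<close>

definition globular_map :: "('o,'m) gcat \<Rightarrow> ('o,'m,'a) psh \<Rightarrow> nat \<Rightarrow> (nat \<Rightarrow> 'a \<Rightarrow> 'a) \<Rightarrow> 'a \<Rightarrow> 'a \<Rightarrow> 'a \<Rightarrow> 'a \<Rightarrow> bool" where
  "globular_map C G k F u v u' v' \<longleftrightarrow>
     (\<forall>i>k. \<forall>a\<in>over C G k i u v. F i a \<in> over C G k i u' v') \<and>
     (\<forall>i>k. \<forall>a\<in>over C G k (Suc i) u v.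
        src C G (Suc i) (F (Suc i) a) = F i (src C G (Suc i) a) \<and>
        tgt C G (Suc i) (F (Suc i) a) = F i (tgt C G (Suc i) a))"

context pregroupoidal_extension
begin

lemma parrows_over: "grpd G \<Longrightarrow> parrows C G (Suc k) u v = over C G k (Suc k) u v"
  by (auto simp: parrows_def over_def msrc_one mtgt_one)

lemma over_restrict: assumes "grpd G" "p \<in> parrows C G (Suc k) u v" "q \<in> parrows C G (Suc k) u v"
   "a \<in> over C G (Suc k) i p q" "k < i"
  shows "a \<in> over C G k i u v"
  using assms src_msrc[OF assms(1), of a i k] by (auto simp: over_def parrows_def)

lemma over_src: assumes "grpd G" "a \<in> over C G k (Suc i) u v" "k < i"
  shows "src C G (Suc i) a \<in> over C G k i u v" "tgt C G (Suc i) a \<in> over C G k i u v"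
  using assms by (auto simp: over_def msrc_Suc mtgt_Suc msrc_tgt mtgt_src)

lemma globular_map_over: "globular_map C G k F u v u' v' \<Longrightarrow> k < i \<Longrightarrow> a \<in> over C G k i u v \<Longrightarrow> F i a \<in> over C G k i u' v'"
  and globular_map_src: "globular_map C G k F u v u' v' \<Longrightarrow> k < i \<Longrightarrow> a \<in> over C G k (Suc i) u v \<Longrightarrow>
     src C G (Suc i) (F (Suc i) a) = F i (src C G (Suc i) a)"
  and globular_map_tgt: "globular_map C G k F u v u' v' \<Longrightarrow> k < i \<Longrightarrow> a \<in> over C G k (Suc i) u v \<Longrightarrow>
     tgt C G (Suc i) (F (Suc i) a) = F i (tgt C G (Suc i) a)"
  by (auto simp: globular_map_def)

lemma globular_map_parrows: "grpd G \<Longrightarrow> globular_map C G k F u v u' v' \<Longrightarrow> a \<in> parrows C G (Suc k) u v \<Longrightarrow>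
    F (Suc k) a \<in> parrows C G (Suc k) u' v'"
  by (simp add: parrows_over globular_map_over)

lemma globular_map_msrc: "grpd G \<Longrightarrow> globular_map C G k F u v u' v' \<Longrightarrow> a \<in> over C G k i u v \<Longrightarrow> k < j \<Longrightarrow> j \<le> i \<Longrightarrow>
   msrc C G i j (F i a) = F j (msrc C G i j a) \<and> mtgt C G i j (F i a) = F j (mtgt C G i j a)"
proof (induction i arbitrary: a)
  case (Suc i)
  have a: "a \<in> arr C G (Suc i)" using Suc.prems by (simp add: over_def)
  have Fa: "F (Suc i) a \<in> arr C G (Suc i)" using globular_map_over[OF Suc.prems(2) _ Suc.prems(3)] Suc.prems by (simp add: over_def)
  show ?case
  proof (cases "j = Suc i")
    case True
    then show ?thesis using a Fa Suc.prems(1) by (simp add: msrc_self mtgt_self)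
  next
    case False
    then have i: "k < i" "j \<le> i" using Suc.prems by auto
    show ?thesis
      using Suc.IH[OF Suc.prems(1,2) over_src(1)[OF Suc.prems(1,3) i(1)]] i
       Suc.IH[OF Suc.prems(1,2) over_src(2)[OF Suc.prems(1,3) i(1)]] Suc.prems a Fa
      by (simp add: msrc_Suc mtgt_Suc globular_map_src globular_map_tgt)
  qed
qed simp

text \<open>The inductive step on the number of dimensions: the base pair (u, v) is replaced by a
  pair of (k+1)-arrows between them, with the same family of maps.\<close>

lemma globular_map_restrict: assumes G: "grpd G" and F: "globular_map C G k F u v u' v'"
   and pq: "p \<in> parrows C G (Suc k) u v" "q \<in> parrows C G (Suc k) u v"
  shows "globular_map C G (Suc k) F p q (F (Suc k) p) (F (Suc k) q)"
  unfolding globular_map_def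
proof (intro conjI allI impI ballI)
  fix i a assume i: "Suc k < i" and a: "a \<in> over C G (Suc k) i p q"
  have a': "a \<in> over C G k i u v" using over_restrict[OF G pq a] i by simp
  show "F i a \<in> over C G (Suc k) i (F (Suc k) p) (F (Suc k) q)"
    using globular_map_over[OF F _ a'] globular_map_msrc[OF G F a', of "Suc k"] i a by (simp add: over_def)
next
  fix i a assume i: "Suc k < i" and a: "a \<in> over C G (Suc k) (Suc i) p q"
  have a': "a \<in> over C G k (Suc i) u v" using over_restrict[OF G pq a] i by simp
  show "src C G (Suc i) (F (Suc i) a) = F i (src C G (Suc i) a)"
    "tgt C G (Suc i) (F (Suc i) a) = F i (tgt C G (Suc i) a)"
    using globular_map_src[OF F _ a'] globular_map_tgt[OF F _ a'] i by simp_all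
qed

text \<open>A homotopy between (k+1)-arrows over (u, v) is itself an arrow over (u, v), so the next
  map of the family carries it to a homotopy of the images.\<close>

lemma globular_map_htp: assumes G: "grpd G" and F: "globular_map C G k F u v u' v'" and "a \<in> parrows C G (Suc k) u v"
   and "htp C G (Suc k) a b"
  shows "htp C G (Suc k) (F (Suc k) a) (F (Suc k) b)"
proof -
  obtain c where c: "c \<in> arr C G (Suc (Suc k))" "src C G (Suc (Suc k)) c = a" "tgt C G (Suc (Suc k)) c = b"
    using assms(4) by (auto simp: htp_def)
  then have o: "c \<in> over C G k (Suc (Suc k)) u v"
    using assms(1,3) mtgt_src[OF G c(1), of k] by (auto simp: over_def parrows_over msrc_Suc mtgt_Suc)
  then have "F (Suc (Suc k)) c \<in> arr C G (Suc (Suc k))" using globular_map_over[OF F _ o] by (simp add: over_def)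
  then show ?thesis using globular_map_src[OF F _ o] globular_map_tgt[OF F _ o] c unfolding htp_def by auto
qed

lemma equiv_upto_bij: "equiv_upto C G r k F u v u' v' \<Longrightarrow> htp_bij C G G (Suc k) (F (Suc k)) u v u' v'"
  by (cases r) auto

lemma inj_upto_level: "inj_upto C G r k F u v \<Longrightarrow> a \<in> parrows C G (Suc k) u v \<Longrightarrow> b \<in> parrows C G (Suc k) u v \<Longrightarrow>
   htp C G (Suc k) (F (Suc k) a) (F (Suc k) b) \<Longrightarrow> htp C G (Suc k) a b"
  by (cases r) auto

lemma equiv_upto_cong: assumes "grpd G"
  shows "(\<And>i a. k < i \<Longrightarrow> a \<in> over C G k i u v \<Longrightarrow> F i a = F' i a) \<Longrightarrow>
   equiv_upto C G r k F u v u' v' \<Longrightarrow> equiv_upto C G r k F' u v u' v'"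
proof (induction r arbitrary: k u v u' v')
  case 0
  have "F (Suc k) a = F' (Suc k) a" if "a \<in> parrows C G (Suc k) u v" for a
    using 0(1) that assms by (simp add: parrows_over)
  then show ?case using 0(2) by (simp add: htp_bij_def)
next
  case (Suc r)
  have eq: "F (Suc k) a = F' (Suc k) a" if "a \<in> parrows C G (Suc k) u v" for a
    using Suc.prems(1) that assms by (simp add: parrows_over)
  have "equiv_upto C G r (Suc k) F' p q (F' (Suc k) p) (F' (Suc k) q)"
    if pq: "p \<in> parrows C G (Suc k) u v" "q \<in> parrows C G (Suc k) u v" for p q
  proof (rule Suc.IH)
    show "F i a = F' i a" if "Suc k < i" "a \<in> over C G (Suc k) i p q" for i a
      using Suc.prems(1)[OF _ over_restrict[OF assms pq that(2)]] that by simp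
    show "equiv_upto C G r (Suc k) F p q (F' (Suc k) p) (F' (Suc k) q)"
      using Suc.prems(2) pq unfolding eq[OF pq(1), symmetric] eq[OF pq(2), symmetric] by simp
  qed
  moreover have "htp_bij C G G (Suc k) (F' (Suc k)) u v u' v'"
    using Suc.prems(2) eq by (simp add: htp_bij_def)
  ultimately show ?case by simp
qed

lemma equiv_upto_id: assumes "grpd G" shows "equiv_upto C G r k (\<lambda>i a. a) u v u v"
proof -
  have "htp_bij C G G (Suc k) (\<lambda>a. a) u v u v" for k u v
    using assms unfolding htp_bij_def parrows_def by (blast intro: htp_refl)
  then show ?thesis by (induction r arbitrary: k u v) auto
qed

lemma equiv_upto_comp: assumes G: "grpd G"
  shows "globular_map C G k F u v u' v' \<Longrightarrow> globular_map C G k K u' v' u'' v'' \<Longrightarrow> equiv_upto C G r k F u v u' v' \<Longrightarrow>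
    equiv_upto C G r k K u' v' u'' v'' \<Longrightarrow> equiv_upto C G r k (\<lambda>i a. K i (F i a)) u v u'' v''"
proof (induction r arbitrary: k u v u' v' u'' v'')
  have level: "htp_bij C G G (Suc k) (\<lambda>a. K (Suc k) (F (Suc k) a)) u v u'' v''"
    if F: "globular_map C G k F u v u' v'" and K: "globular_map C G k K u' v' u'' v''"
      and bF: "htp_bij C G G (Suc k) (F (Suc k)) u v u' v'" and bK: "htp_bij C G G (Suc k) (K (Suc k)) u' v' u'' v''"
    for k u v u' v' u'' v''
    unfolding htp_bij_def
  proof (intro conjI ballI impI)
    fix c assume "c \<in> parrows C G (Suc k) u'' v''"
    then obtain b where b: "b \<in> parrows C G (Suc k) u' v'" "htp C G (Suc k) (K (Suc k) b) c"
      using bK by (auto simp: htp_bij_def)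
    then obtain a where a: "a \<in> parrows C G (Suc k) u v" "htp C G (Suc k) (F (Suc k) a) b"
      using bF by (auto simp: htp_bij_def)
    then show "\<exists>a\<in>parrows C G (Suc k) u v. htp C G (Suc k) (K (Suc k) (F (Suc k) a)) c"
      using globular_map_htp[OF G K globular_map_parrows[OF G F a(1)] a(2)] b htp_trans[OF G] by blast
  next
    fix a b assume "a \<in> parrows C G (Suc k) u v" "b \<in> parrows C G (Suc k) u v"
      "htp C G (Suc k) (K (Suc k) (F (Suc k) a)) (K (Suc k) (F (Suc k) b))"
    then show "htp C G (Suc k) a b" using bF bK globular_map_parrows[OF G F] by (auto simp: htp_bij_def)
  qed
  {
    case 0
    then show ?case using level[OF 0(1,2)] by simp
  next
    case (Suc r)
    have "equiv_upto C G r (Suc k) (\<lambda>i a. K i (F i a)) p q (K (Suc k) (F (Suc k) p)) (K (Suc k) (F (Suc k) q))"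
      if "p \<in> parrows C G (Suc k) u v" "q \<in> parrows C G (Suc k) u v" for p q
      using that Suc.prems(3,4) globular_map_restrict[OF G Suc.prems(1) that] globular_map_parrows[OF G Suc.prems(1)]
       globular_map_restrict[OF G Suc.prems(2)] by (intro Suc.IH[of "Suc k" p q "F (Suc k) p" "F (Suc k) q"]) auto
    then show ?case using Suc.prems(3,4) level[OF Suc.prems(1,2)] by simp
  }
qed

lemma equiv_upto_comp_inj_upto: assumes G: "grpd G"
  shows "globular_map C G k K u v u' v' \<Longrightarrow> globular_map C G k L u' v' u'' v'' \<Longrightarrow>
    equiv_upto C G r k (\<lambda>i a. L i (K i a)) u v u'' v'' \<Longrightarrow> inj_upto C G r k K u v"
proof (induction r arbitrary: k u v u' v' u'' v'')
  have level: "htp C G (Suc k) a b"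
    if K: "globular_map C G k K u v u' v'" and L: "globular_map C G k L u' v' u'' v''"
      and bi: "htp_bij C G G (Suc k) (\<lambda>a. L (Suc k) (K (Suc k) a)) u v u'' v''"
      and a: "a \<in> parrows C G (Suc k) u v" and b: "b \<in> parrows C G (Suc k) u v"
      and h: "htp C G (Suc k) (K (Suc k) a) (K (Suc k) b)" for k u v u' v' u'' v'' a b
    using bi a b globular_map_htp[OF G L globular_map_parrows[OF G K a] h] by (simp add: htp_bij_def)
  {
    case 0
    then show ?case using level[OF 0(1,2)] by simp
  next
    case (Suc r)
    have "inj_upto C G r (Suc k) K p q" if "p \<in> parrows C G (Suc k) u v" "q \<in> parrows C G (Suc k) u v" for p q
      using that Suc.prems(3) globular_map_restrict[OF G Suc.prems(1) that] globular_map_parrows[OF G Suc.prems(1)]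
       globular_map_restrict[OF G Suc.prems(2)] by (intro Suc.IH[of "Suc k" p q "K (Suc k) p" "K (Suc k) q"]) auto
    then show ?case using level[OF Suc.prems(1,2)] Suc.prems(3) by simp
  }
qed

text \<open>For surjectivity of \<open>K\<close>, apply surjectivity of the composite to
  \<open>L c\<close>: this gives \<open>a\<close> with \<open>L (K a)\<close> homotopic to
  \<open>L c\<close>, and injectivity of \<open>L\<close> removes \<open>L\<close>. Injectivity of
  \<open>K\<close> follows from that of the composite because \<open>L\<close> preserves
  homotopies.\<close>

lemma equiv_upto_cancel: assumes G: "grpd G"
  shows "globular_map C G k K u v u' v' \<Longrightarrow> globular_map C G k L u' v' u'' v'' \<Longrightarrow>
    equiv_upto C G r k (\<lambda>i a. L i (K i a)) u v u'' v'' \<Longrightarrow> inj_upto C G r k L u' v' \<Longrightarrow> equiv_upto C G r k K u v u' v'"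
proof (induction r arbitrary: k u v u' v' u'' v'')
  have level: "htp_bij C G G (Suc k) (K (Suc k)) u v u' v'"
    if K: "globular_map C G k K u v u' v'" and L: "globular_map C G k L u' v' u'' v''"
      and b: "htp_bij C G G (Suc k) (\<lambda>a. L (Suc k) (K (Suc k) a)) u v u'' v''"
      and i: "\<And>a b. a \<in> parrows C G (Suc k) u' v' \<Longrightarrow> b \<in> parrows C G (Suc k) u' v' \<Longrightarrow>
         htp C G (Suc k) (L (Suc k) a) (L (Suc k) b) \<Longrightarrow> htp C G (Suc k) a b" for k u v u' v' u'' v''
    unfolding htp_bij_def
  proof (intro conjI ballI impI)
    fix c assume c: "c \<in> parrows C G (Suc k) u' v'"
    obtain a where a: "a \<in> parrows C G (Suc k) u v" "htp C G (Suc k) (L (Suc k) (K (Suc k) a)) (L (Suc k) c)"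
      using b globular_map_parrows[OF G L c] unfolding htp_bij_def by blast
    then show "\<exists>a\<in>parrows C G (Suc k) u v. htp C G (Suc k) (K (Suc k) a) c"
      using i[OF globular_map_parrows[OF G K a(1)] c] by blast
  next
    fix x y assume xy: "x \<in> parrows C G (Suc k) u v" "y \<in> parrows C G (Suc k) u v"
      "htp C G (Suc k) (K (Suc k) x) (K (Suc k) y)"
    then show "htp C G (Suc k) x y"
      using b globular_map_htp[OF G L globular_map_parrows[OF G K xy(1)] xy(3)] by (simp add: htp_bij_def)
  qed
  {
    case 0
    show ?case unfolding equiv_upto.simps
      by (rule level[OF 0(1,2)]) (use 0(3) inj_upto_level[OF 0(4)] in auto)
  next
    case (Suc r)
    have "htp_bij C G G (Suc k) (K (Suc k)) u v u' v'"
      by (rule level[OF Suc.prems(1,2)]) (use Suc.prems(3) inj_upto_level[OF Suc.prems(4)] in auto)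
    moreover have "equiv_upto C G r (Suc k) K p q (K (Suc k) p) (K (Suc k) q)"
      if "p \<in> parrows C G (Suc k) u v" "q \<in> parrows C G (Suc k) u v" for p q
      using that Suc.prems(3,4) globular_map_restrict[OF G Suc.prems(1) that] globular_map_parrows[OF G Suc.prems(1)]
       globular_map_restrict[OF G Suc.prems(2)] by (intro Suc.IH[of "Suc k" p q "K (Suc k) p" "K (Suc k) q"]) auto
    ultimately show ?case by simp
  }
qed

text \<open>Unrolls the recursion along the iterated faces of \<open>p\<close>, from its
  (k+1)-dimensional source and target up to \<open>p\<close> itself, and keeps the information on
  loops at \<open>p\<close>. These have dimension N + 1, within the range since N <= k + r.\<close>

lemma equiv_upto_descend: assumes G: "grpd G"
  shows "globular_map C G k F u v u' v' \<Longrightarrow> equiv_upto C G r k F u v u' v' \<Longrightarrow> k < N \<Longrightarrow> N \<le> k + r \<Longrightarrow>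
    p \<in> over C G k N u v \<Longrightarrow>
    globular_map C G N F p p (F N p) (F N p) \<and> htp_bij C G G (Suc N) (F (Suc N)) p p (F N p) (F N p)"
proof (induction r arbitrary: k u v u' v')
  case (Suc r)
  let ?P = "msrc C G N (Suc k) p" and ?Q = "mtgt C G N (Suc k) p"
  have p: "p \<in> arr C G N" using Suc.prems by (simp add: over_def)
  have PQ: "?P \<in> parrows C G (Suc k) u v" "?Q \<in> parrows C G (Suc k) u v"
    using src_msrc[OF G p Suc.prems(3)] Suc.prems(3,5) G by (auto simp: over_def parrows_def)
  have he: "equiv_upto C G r (Suc k) F ?P ?Q (F (Suc k) ?P) (F (Suc k) ?Q)" using Suc.prems(2) PQ by simp
  note gr = globular_map_restrict[OF G Suc.prems(1) PQ]
  show ?case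
  proof (cases "N = Suc k")
    case True
    then show ?thesis using equiv_upto_bij[OF he] gr G p by (simp add: msrc_self mtgt_self)
  next
    case False
    then show ?thesis using Suc.IH[OF gr he] Suc.prems p by (simp add: over_def)
  qed
qed simp

subsection \<open>Operations with a whiskering context\<close>

text \<open>The arity of an operation on an \<open>i\<close>-arrow together with two whiskering \<open>(l+1)\<close>-arrows.\<close>

definition ctx :: "nat \<Rightarrow> nat \<Rightarrow> 'o" where
  "ctx l i = fst (gsum C [Suc l, i, Suc l] [l, l])"

definition coproj0 :: "nat \<Rightarrow> nat \<Rightarrow> 'm" where "coproj0 l i = snd (gsum C [Suc l, i, Suc l] [l, l]) ! 0"
definition coproj1 :: "nat \<Rightarrow> nat \<Rightarrow> 'm" where "coproj1 l i = snd (gsum C [Suc l, i, Suc l] [l, l]) ! 1"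
definition coproj2 :: "nat \<Rightarrow> nat \<Rightarrow> 'm" where "coproj2 l i = snd (gsum C [Suc l, i, Suc l] [l, l]) ! 2"

definition amal3 :: "('o,'m,'a) psh \<Rightarrow> nat \<Rightarrow> nat \<Rightarrow> 'a \<Rightarrow> 'a \<Rightarrow> 'a \<Rightarrow> 'a" where
  "amal3 G l i z1 a z2 = amal C G [Suc l, i, Suc l] [l, l] [z1, a, z2]"

definition ctx_eval :: "('o,'m,'a) psh \<Rightarrow> nat \<Rightarrow> nat \<Rightarrow> 'm \<Rightarrow> 'a \<Rightarrow> 'a \<Rightarrow> 'a \<Rightarrow> 'a" where
  "ctx_eval G l i \<phi> z1 a z2 = pmor G \<phi> (amal3 G l i z1 a z2)"

lemma table3: "l < i \<Longrightarrow> table_ok [Suc l, i, Suc l] [l, l]"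
  by (auto simp: table_ok_def less_Suc_eq)

lemma triple_fiber_prod: "grpd G \<Longrightarrow> l < i \<Longrightarrow>
    [z1, a, z2] \<in> fiber_prod C G [Suc l, i, Suc l] [l, l] \<longleftrightarrow> whiskerable G l i z1 a z2"
  unfolding fiber_prod_def whiskerable_def msrc_def[symmetric] mtgt_def[symmetric]
  by (auto simp: less_Suc_eq msrc_one mtgt_one)

lemma ctx_in: "l < i \<Longrightarrow> ctx l i \<in> cobj C"
  unfolding ctx_def by (rule gsum_in[OF table3])

lemma ctx_grpd: "l < i \<Longrightarrow> grpd (yon C (ctx l i))"
  by (rule yon_grpd[OF ctx_in])

lemma amal3_in: "grpd G \<Longrightarrow> whiskerable G l i z1 a z2 \<Longrightarrow> amal3 G l i z1 a z2 \<in> pob G (ctx l i)"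
  unfolding ctx_def amal3_def by (rule amal_in) (auto simp: triple_fiber_prod table3 whiskerable_def)

lemma ctx_eval_coproj: assumes "grpd G" "whiskerable G l i z1 a z2"
  shows "ctx_eval G l i (coproj0 l i) z1 a z2 = z1" "ctx_eval G l i (coproj1 l i) z1 a z2 = a"
    "ctx_eval G l i (coproj2 l i) z1 a z2 = z2"
proof -
  have l: "l < i" using assms(2) by (simp add: whiskerable_def)
  have fp: "[z1, a, z2] \<in> fiber_prod C G [Suc l, i, Suc l] [l, l]"
    using assms l by (simp add: triple_fiber_prod)
  show "ctx_eval G l i (coproj0 l i) z1 a z2 = z1" "ctx_eval G l i (coproj1 l i) z1 a z2 = a"
    "ctx_eval G l i (coproj2 l i) z1 a z2 = z2"
    using amal_nth[OF assms(1) table3[OF l] fp, of 0] amal_nth[OF assms(1) table3[OF l] fp, of 1]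
     amal_nth[OF assms(1) table3[OF l] fp, of 2]
    by (simp_all add: ctx_eval_def amal3_def coproj0_def coproj1_def coproj2_def)
qed

lemma ctx_eval_in: "grpd G \<Longrightarrow> whiskerable G l i z1 a z2 \<Longrightarrow> \<phi> \<in> chom C D (ctx l i) \<Longrightarrow>
    ctx_eval G l i \<phi> z1 a z2 \<in> pob G D"
  unfolding ctx_eval_def by (rule pmor_in[OF _ _ amal3_in])

lemma mor_amal3: assumes "grpd G" "grpd H" "mor G H f" "whiskerable G l i z1 a z2"
  shows "f (ctx l i) (amal3 G l i z1 a z2) =
    amal3 H l i (f (gD C (Suc l)) z1) (f (gD C i) a) (f (gD C (Suc l)) z2)"
proof -
  have l: "l < i" using assms(4) by (simp add: whiskerable_def)
  show ?thesis using mor_amal[OF assms(1-3) table3[OF l], of "[z1, a, z2]"] assms(1,4) l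
    by (simp add: ctx_def amal3_def triple_fiber_prod)
qed

lemma mor_ctx_eval: assumes "grpd G" "grpd H" "mor G H f" "whiskerable G l i z1 a z2" "\<phi> \<in> chom C D (ctx l i)"
  shows "f D (ctx_eval G l i \<phi> z1 a z2) =
    ctx_eval H l i \<phi> (f (gD C (Suc l)) z1) (f (gD C i) a) (f (gD C (Suc l)) z2)"
  using mor_pmor[OF assms(3,5) amal3_in[OF assms(1,4)]] mor_amal3[OF assms(1-4)] by (simp add: ctx_eval_def)

lemma ctx_eval_mor: "grpd G \<Longrightarrow> whiskerable G l i z1 a z2 \<Longrightarrow>
    mor (yon C (ctx l i)) G (\<lambda>D \<phi>. ctx_eval G l i \<phi> z1 a z2)"
  unfolding ctx_eval_def by (rule yon_mor[OF _ amal3_in])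

lemma whiskerable_coproj: assumes "l < i" shows "whiskerable (yon C (ctx l i)) l i (coproj0 l i) (coproj1 l i) (coproj2 l i)"
proof -
  let ?e = "snd (gsum C [Suc l, i, Suc l] [l, l])"
  have "length ?e = 3" using length_coproj[OF table3[OF assms]] by simp
  then have "?e = [coproj0 l i, coproj1 l i, coproj2 l i]"
    by (intro nth_equalityI) (auto simp: coproj0_def coproj1_def coproj2_def less_Suc_eq numeral_3_eq_3 numeral_2_eq_2)
  then show ?thesis
    using coproj_fiber_prod[OF table3[OF assms]] triple_fiber_prod[OF ctx_grpd[OF assms] assms]
    by (simp add: ctx_def)
qed

text \<open>The triple of coprojections corresponds to the identity of the arity. An operation is
  therefore its own value at the universal triple, and identities between operations may be computed
  as identities between arrows of a representable groupoid.\<close>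

lemma ctx_eval_univ: assumes "l < i" "\<phi> \<in> chom C D (ctx l i)"
  shows "ctx_eval (yon C (ctx l i)) l i \<phi> (coproj0 l i) (coproj1 l i) (coproj2 l i) = \<phi>"
proof -
  have "amal3 (yon C (ctx l i)) l i (coproj0 l i) (coproj1 l i) (coproj2 l i) = cid C (ctx l i)"
    unfolding amal3_def
  proof (rule amal_eqI[OF ctx_grpd[OF assms(1)] table3[OF assms(1)]])
    show "[coproj0 l i, coproj1 l i, coproj2 l i] \<in> fiber_prod C (yon C (ctx l i)) [Suc l, i, Suc l] [l, l]"
      using triple_fiber_prod[OF ctx_grpd[OF assms(1)] assms(1)] whiskerable_coproj[OF assms(1)] by simp
    show "cid C (ctx l i) \<in> pob (yon C (ctx l i)) (fst (gsum C [Suc l, i, Suc l] [l, l]))"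
      using id_in[OF ctx_in[OF assms(1)]] by (simp add: ctx_def)
    fix k assume k: "k < length [Suc l, i, Suc l]"
    have "snd (gsum C [Suc l, i, Suc l] [l, l]) ! k \<in> chom C (gD C ([Suc l, i, Suc l] ! k)) (ctx l i)"
      using coproj_in[OF table3[OF assms(1)] k] by (simp add: ctx_def)
    moreover have "snd (gsum C [Suc l, i, Suc l] [l, l]) ! k = [coproj0 l i, coproj1 l i, coproj2 l i] ! k"
      using k by (auto simp: coproj0_def coproj1_def coproj2_def less_Suc_eq numeral_2_eq_2)
    ultimately show "pmor (yon C (ctx l i)) (snd (gsum C [Suc l, i, Suc l] [l, l]) ! k) (cid C (ctx l i)) =
       [coproj0 l i, coproj1 l i, coproj2 l i] ! k"
      by (simp add: id_left)
  qed
  then show ?thesis using assms by (simp add: ctx_eval_def id_left)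
qed

lemma ctx_eval_src: assumes "grpd G" "whiskerable G l i z1 a z2" "\<phi> \<in> chom C (gD C (Suc n)) (ctx l i)"
  shows "src C G (Suc n) (ctx_eval G l i \<phi> z1 a z2) = ctx_eval G l i (src C (yon C (ctx l i)) (Suc n) \<phi>) z1 a z2"
    "tgt C G (Suc n) (ctx_eval G l i \<phi> z1 a z2) = ctx_eval G l i (tgt C (yon C (ctx l i)) (Suc n) \<phi>) z1 a z2"
  using mor_src[OF ctx_eval_mor[OF assms(1,2)], of \<phi> n] mor_tgt[OF ctx_eval_mor[OF assms(1,2)], of \<phi> n] assms(3)
  by simp_all

text \<open>Evaluation at (z1, a, z2) is a morphism out of the representable groupoid, so it
  commutes with every operation; the outer two coprojections evaluate to \<open>z1\<close> and
  \<open>z2\<close>. This is substitution of an operation into the middle argument.\<close>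

lemma ctx_eval_sub: assumes "grpd G" "whiskerable G l i z1 a z2" "\<phi> \<in> chom C D (ctx l n)"
   "whiskerable (yon C (ctx l i)) l n (coproj0 l i) b (coproj2 l i)"
  shows "ctx_eval G l i (ctx_eval (yon C (ctx l i)) l n \<phi> (coproj0 l i) b (coproj2 l i)) z1 a z2 =
    ctx_eval G l n \<phi> z1 (ctx_eval G l i b z1 a z2) z2"
proof -
  have "l < i" using assms(2) by (simp add: whiskerable_def)
  then show ?thesis
    using mor_ctx_eval[OF ctx_grpd assms(1) ctx_eval_mor[OF assms(1,2)] assms(4,3)] ctx_eval_coproj[OF assms(1,2)] by simp
qed

text \<open>A compatible family of operations \<open>D\<^sub>i \<rightarrow> ctx l i\<close>: for fixed whiskering arrows it acts as a
  morphism of globular sets in dimensions \<open>\<ge> n\<close>.\<close>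

definition family :: "nat \<Rightarrow> nat \<Rightarrow> (nat \<Rightarrow> 'm) \<Rightarrow> bool" where
  "family l n F \<longleftrightarrow> l < n \<and> (\<forall>i\<ge>n. F i \<in> chom C (gD C i) (ctx l i) \<and>
     src C (yon C (ctx l (Suc i))) (Suc i) (F (Suc i)) = ctx_eval (yon C (ctx l (Suc i))) l i (F i)
       (coproj0 l (Suc i)) (src C (yon C (ctx l (Suc i))) (Suc i) (coproj1 l (Suc i))) (coproj2 l (Suc i)) \<and>
     tgt C (yon C (ctx l (Suc i))) (Suc i) (F (Suc i)) = ctx_eval (yon C (ctx l (Suc i))) l i (F i)
       (coproj0 l (Suc i)) (tgt C (yon C (ctx l (Suc i))) (Suc i) (coproj1 l (Suc i))) (coproj2 l (Suc i)))"

lemma family_in: "family l n F \<Longrightarrow> n \<le> i \<Longrightarrow> F i \<in> chom C (gD C i) (ctx l i)"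
  by (simp add: family_def)

lemma family_later: "family l n F \<Longrightarrow> n \<le> n' \<Longrightarrow> family l n' F"
  by (auto simp: family_def)

lemma coproj1_in: "l < i \<Longrightarrow> coproj1 l i \<in> chom C (gD C i) (ctx l i)"
  using whiskerable_coproj[of l i] by (simp add: whiskerable_def)

text \<open>A family is constrained only at the universal triple; naturality of evaluation spreads
  the equation to every whiskerable triple in every groupoid.\<close>

lemma family_src: assumes "grpd G" "family l n F" "n \<le> i" "whiskerable G l (Suc i) z1 a z2"
  shows "src C G (Suc i) (ctx_eval G l (Suc i) (F (Suc i)) z1 a z2) = ctx_eval G l i (F i) z1 (src C G (Suc i) a) z2"
    "tgt C G (Suc i) (ctx_eval G l (Suc i) (F (Suc i)) z1 a z2) = ctx_eval G l i (F i) z1 (tgt C G (Suc i) a) z2"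
proof -
  have l: "l < i" "l < Suc i" using assms(2,3) by (auto simp: family_def)
  let ?Y = "yon C (ctx l (Suc i))"
  have F: "F i \<in> chom C (gD C i) (ctx l i)" "F (Suc i) \<in> chom C (gD C (Suc i)) (ctx l (Suc i))"
     "src C ?Y (Suc i) (F (Suc i)) = ctx_eval ?Y l i (F i) (coproj0 l (Suc i)) (src C ?Y (Suc i) (coproj1 l (Suc i))) (coproj2 l (Suc i))"
     "tgt C ?Y (Suc i) (F (Suc i)) = ctx_eval ?Y l i (F i) (coproj0 l (Suc i)) (tgt C ?Y (Suc i) (coproj1 l (Suc i))) (coproj2 l (Suc i))"
    using assms(2,3) by (auto simp: family_def)
  note w = whiskerable_src[OF ctx_grpd[OF l(2)] whiskerable_coproj[OF l(2)] l(1)]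
  show "src C G (Suc i) (ctx_eval G l (Suc i) (F (Suc i)) z1 a z2) = ctx_eval G l i (F i) z1 (src C G (Suc i) a) z2"
    using ctx_eval_src(1)[OF assms(1,4) F(2)] ctx_eval_sub[OF assms(1,4) F(1) w(1)]
      ctx_eval_src(1)[OF assms(1,4) coproj1_in[OF l(2)]] ctx_eval_coproj(2)[OF assms(1,4)] F(3) by simp
  show "tgt C G (Suc i) (ctx_eval G l (Suc i) (F (Suc i)) z1 a z2) = ctx_eval G l i (F i) z1 (tgt C G (Suc i) a) z2"
    using ctx_eval_src(2)[OF assms(1,4) F(2)] ctx_eval_sub[OF assms(1,4) F(1) w(2)]
      ctx_eval_src(2)[OF assms(1,4) coproj1_in[OF l(2)]] ctx_eval_coproj(2)[OF assms(1,4)] F(4) by simp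
qed

lemma family_msrc: assumes G: "grpd G" and F: "family l n F"
  shows "n \<le> i \<Longrightarrow> whiskerable G l i z1 a z2 \<Longrightarrow>
    msrc C G i n (ctx_eval G l i (F i) z1 a z2) = ctx_eval G l n (F n) z1 (msrc C G i n a) z2 \<and>
    mtgt C G i n (ctx_eval G l i (F i) z1 a z2) = ctx_eval G l n (F n) z1 (mtgt C G i n a) z2"
proof (induction i arbitrary: a)
  case 0
  then show ?case using F by (simp add: family_def)
next
  case (Suc i)
  have a: "a \<in> arr C G (Suc i)" using Suc.prems by (simp add: whiskerable_def)
  have Fa: "ctx_eval G l (Suc i) (F (Suc i)) z1 a z2 \<in> arr C G (Suc i)"
    using ctx_eval_in[OF G Suc.prems(2) family_in[OF F Suc.prems(1)]] .
  show ?case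
  proof (cases "n = Suc i")
    case True
    then show ?thesis using a Fa G by (simp add: msrc_self mtgt_self)
  next
    case False
    then have n: "n \<le> i" "l < i" using Suc.prems F by (auto simp: family_def)
    show ?thesis
      using Suc.IH[OF n(1) whiskerable_src(1)[OF G Suc.prems(2) n(2)]] Suc.IH[OF n(1) whiskerable_src(2)[OF G Suc.prems(2) n(2)]]
       family_src[OF G F n(1) Suc.prems(2)] a Fa n G by (simp add: msrc_Suc mtgt_Suc)
  qed
qed

text \<open>Given homotopies \<open>h : E \<rightarrow> F\<close> and \<open>h' : F \<rightarrow> E\<close> in dimension \<open>n\<close>, conjugating \<open>F\<close> by them yields a
  family in dimensions \<open>> n\<close> that is parallel to \<open>E\<close>.\<close>

definition bridge :: "nat \<Rightarrow> nat \<Rightarrow> 'm \<Rightarrow> 'm \<Rightarrow> (nat \<Rightarrow> 'm) \<Rightarrow> nat \<Rightarrow> 'm" where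
  "bridge l n h' h F i = conj_arr C (yon C (ctx l i)) n i
     (ctx_eval (yon C (ctx l i)) l n h' (coproj0 l i) (mtgt C (yon C (ctx l i)) i n (coproj1 l i)) (coproj2 l i))
     (F i)
     (ctx_eval (yon C (ctx l i)) l n h (coproj0 l i) (msrc C (yon C (ctx l i)) i n (coproj1 l i)) (coproj2 l i))"

lemma bridge_whiskerable: assumes G: "grpd G" and F: "family l n F" and i: "n < i"
    and w: "whiskerable G l i z1 a z2"
    and h: "h \<in> chom C (gD C (Suc n)) (ctx l n)" "tgt C (yon C (ctx l n)) (Suc n) h = F n"
    and h': "h' \<in> chom C (gD C (Suc n)) (ctx l n)" "src C (yon C (ctx l n)) (Suc n) h' = F n"
  shows "whiskerable G n i (ctx_eval G l n h' z1 (mtgt C G i n a) z2) (ctx_eval G l i (F i) z1 a z2)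
     (ctx_eval G l n h z1 (msrc C G i n a) z2)"
proof -
  have l: "l < n" using F by (simp add: family_def)
  note wn = whiskerable_msrc[OF G w l less_imp_le[OF i]]
  show ?thesis
    unfolding whiskerable_def
    using i ctx_eval_in[OF G w family_in[OF F less_imp_le[OF i]]] ctx_eval_in[OF G _ h(1)] ctx_eval_in[OF G _ h'(1)] wn
      ctx_eval_src(2)[OF G _ h(1)] ctx_eval_src(1)[OF G _ h'(1)] h(2) h'(2) family_msrc[OF G F less_imp_le[OF i] w] by auto
qed

text \<open>A formal bridge becomes a genuine whiskering of \<open>G\<close>: by the values of the
  homotopies at the n-dimensional target and source of \<open>a\<close>. Only in this form can
  bijectivity of whiskering be applied to it.\<close>

lemma ctx_eval_bridge: assumes G: "grpd G" and F: "family l n F" and i: "n < i"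
    and w: "whiskerable G l i z1 a z2"
    and h: "h \<in> chom C (gD C (Suc n)) (ctx l n)" "tgt C (yon C (ctx l n)) (Suc n) h = F n"
    and h': "h' \<in> chom C (gD C (Suc n)) (ctx l n)" "src C (yon C (ctx l n)) (Suc n) h' = F n"
  shows "bridge l n h' h F i \<in> chom C (gD C i) (ctx l i)"
    "ctx_eval G l i (bridge l n h' h F i) z1 a z2 = conj_arr C G n i (ctx_eval G l n h' z1 (mtgt C G i n a) z2)
       (ctx_eval G l i (F i) z1 a z2) (ctx_eval G l n h z1 (msrc C G i n a) z2)"
proof -
  have l: "l < n" "l < i" using F i by (auto simp: family_def)
  let ?Y = "yon C (ctx l i)"
  note Y = ctx_grpd[OF l(2)] and u = whiskerable_coproj[OF l(2)]
  note uw = bridge_whiskerable[OF Y F i u h h', unfolded ctx_eval_univ[OF l(2) family_in[OF F less_imp_le[OF i]]]]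
  note un = whiskerable_msrc[OF Y u l(1) less_imp_le[OF i]]
  show "bridge l n h' h F i \<in> chom C (gD C i) (ctx l i)"
    using conj_in[OF Y uw] by (simp add: bridge_def)
  have m: "ctx_eval G l i (mtgt C ?Y i n (coproj1 l i)) z1 a z2 = mtgt C G i n a"
     "ctx_eval G l i (msrc C ?Y i n (coproj1 l i)) z1 a z2 = msrc C G i n a"
    using mor_mtgt[OF ctx_eval_mor[OF G w], of "coproj1 l i" i n] mor_msrc[OF ctx_eval_mor[OF G w], of "coproj1 l i" i n]
      coproj1_in[OF l(2)] i ctx_eval_coproj[OF G w] by simp_all
  show "ctx_eval G l i (bridge l n h' h F i) z1 a z2 = conj_arr C G n i (ctx_eval G l n h' z1 (mtgt C G i n a) z2)
       (ctx_eval G l i (F i) z1 a z2) (ctx_eval G l n h z1 (msrc C G i n a) z2)"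
    using mor_conj[OF Y G ctx_eval_mor[OF G w] uw] ctx_eval_sub[OF G w h(1)] ctx_eval_sub[OF G w h'(1)] un
    by (simp add: bridge_def m)
qed

lemma bridge_family: assumes F: "family l n F"
    and h: "h \<in> chom C (gD C (Suc n)) (ctx l n)" "tgt C (yon C (ctx l n)) (Suc n) h = F n"
    and h': "h' \<in> chom C (gD C (Suc n)) (ctx l n)" "src C (yon C (ctx l n)) (Suc n) h' = F n"
  shows "family l (Suc n) (bridge l n h' h F)"
  unfolding family_def
proof (intro conjI allI impI)
  have l: "l < n" using F by (simp add: family_def)
  then show "l < Suc n" by simp
  fix i assume i: "Suc n \<le> i"
  then have ni: "n < i" "n \<le> i" "n < Suc i" "n \<le> Suc i" and li: "l < i" "l < Suc i" using l by auto
  show "bridge l n h' h F i \<in> chom C (gD C i) (ctx l i)"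
    by (rule ctx_eval_bridge(1)[OF ctx_grpd[OF li(1)] F ni(1) whiskerable_coproj[OF li(1)] h h'])
  let ?Y = "yon C (ctx l (Suc i))"
  note Y = ctx_grpd[OF li(2)] and u = whiskerable_coproj[OF li(2)]
  note ws = whiskerable_src[OF Y u li(1)]
  note uw = bridge_whiskerable[OF Y F ni(3) u h h', unfolded ctx_eval_univ[OF li(2) family_in[OF F ni(4)]]]
  have e: "coproj1 l (Suc i) \<in> arr C ?Y (Suc i)" using coproj1_in[OF li(2)] by simp
  note fs = family_src[OF Y F ni(2) u, unfolded ctx_eval_univ[OF li(2) family_in[OF F ni(4)]]]
  note sc = src_conj[OF Y uw ni(1)]
  show "src C ?Y (Suc i) (bridge l n h' h F (Suc i)) = ctx_eval ?Y l i (bridge l n h' h F i)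
     (coproj0 l (Suc i)) (src C ?Y (Suc i) (coproj1 l (Suc i))) (coproj2 l (Suc i))"
    \<comment> \<open>An arrow of dimension i + 1 > n + 1 has the same n-dimensional source and
      target as its source and its target, so the bridge on the arrow and on its faces uses the same
      homotopies.\<close>
    unfolding ctx_eval_bridge(2)[OF Y F ni(1) ws(1) h h'] bridge_def[of l n h' h F "Suc i"] sc(1) fs
    by (simp only: msrc_Suc[OF Y e ni(2)] mtgt_Suc[OF Y e ni(2)] mtgt_src[OF Y e ni(1)])
  show "tgt C ?Y (Suc i) (bridge l n h' h F (Suc i)) = ctx_eval ?Y l i (bridge l n h' h F i)
     (coproj0 l (Suc i)) (tgt C ?Y (Suc i) (coproj1 l (Suc i))) (coproj2 l (Suc i))"
    unfolding ctx_eval_bridge(2)[OF Y F ni(1) ws(2) h h'] bridge_def[of l n h' h F "Suc i"] sc(2) fs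
    by (simp only: msrc_Suc[OF Y e ni(2)] mtgt_Suc[OF Y e ni(2)] msrc_tgt[OF Y e ni(1)])
qed

text \<open>On an (n+1)-arrow \<open>a\<close> the bridge is the composite F(s a) -> F'(s a) -> F'(t
  a) -> F(t a), whose outer maps are \<open>h\<close> and \<open>h'\<close> and whose middle map is
  F'(a). Its endpoints are those of F(a).\<close>

lemma bridge_parallel: assumes F: "family l n F" and F': "family l n F'"
    and h: "h \<in> chom C (gD C (Suc n)) (ctx l n)" "tgt C (yon C (ctx l n)) (Suc n) h = F' n"
      "src C (yon C (ctx l n)) (Suc n) h = F n"
    and h': "h' \<in> chom C (gD C (Suc n)) (ctx l n)" "src C (yon C (ctx l n)) (Suc n) h' = F' n"
      "tgt C (yon C (ctx l n)) (Suc n) h' = F n"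
  shows "parallel (yon C (ctx l (Suc n))) (Suc n) (F (Suc n)) (bridge l n h' h F' (Suc n))"
proof -
  have l: "l < n" "l < Suc n" using F by (auto simp: family_def)
  let ?Y = "yon C (ctx l (Suc n))"
  note Y = ctx_grpd[OF l(2)] and u = whiskerable_coproj[OF l(2)]
  note ws = whiskerable_src[OF Y u l(1)]
  have e: "coproj1 l (Suc n) \<in> arr C ?Y (Suc n)" using coproj1_in[OF l(2)] by simp
  note uw = bridge_whiskerable[OF Y F' lessI u h(1,2) h'(1,2), unfolded ctx_eval_univ[OF l(2) family_in[OF F' le_SucI[OF order.refl]]]]
  note fs = family_src[OF Y F order.refl u, unfolded ctx_eval_univ[OF l(2) family_in[OF F le_SucI[OF order.refl]]]]
  show ?thesis
    unfolding parallel_def bridge_def src_conj_base[OF Y uw] fs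
    using ctx_eval_src[OF Y ws(1) h(1)] ctx_eval_src[OF Y ws(2) h'(1)] h h' Y e by (simp add: msrc_one mtgt_one)
qed

text \<open>As l < n, the largest entry of the table (l+1, n, l+1; l, l) is n, so the dimension
  bound for admissibility holds.\<close>

lemma ctx_filler: assumes "l < n" "p \<in> chom C (gD C n) (ctx l n)" "q \<in> chom C (gD C n) (ctx l n)"
    "parallel (yon C (ctx l n)) n p q"
  shows "\<exists>h \<in> chom C (gD C (Suc n)) (ctx l n).
    src C (yon C (ctx l n)) (Suc n) h = p \<and> tgt C (yon C (ctx l n)) (Suc n) h = q"
  using filler[OF table3[OF assms(1)], of n p q] assms by (simp add: ctx_def table_dim_def)

end

text \<open>The index is that of the base arrows: for parallel \<open>u\<close>, \<open>v\<close> of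
  dimension k this concerns pi_(k+1)(G, u, v).\<close>

definition local_bij :: "('o,'m) gcat \<Rightarrow> ('o,'m,'a) psh \<Rightarrow> ('o,'m,'b) psh \<Rightarrow> ('o \<Rightarrow> 'a \<Rightarrow> 'b) \<Rightarrow> nat \<Rightarrow> 'a \<Rightarrow> 'a \<Rightarrow> bool" where
  "local_bij C G H f k u v \<longleftrightarrow> htp_bij C G H (Suc k) (f (gD C (Suc k))) u v (f (gD C k) u) (f (gD C k) v)"

context pregroupoidal_extension
begin

subsection \<open>Whiskering is an equivalence\<close>

text \<open>The number r counts the dimensions above k + 1 that are covered. All k are included
  because the induction trades a smaller r for a larger k.\<close>

definition whisker_equiv :: "('o,'m,'a) psh \<Rightarrow> nat \<Rightarrow> bool" where
  "whisker_equiv G r \<longleftrightarrow> (\<forall>k u v u' v'. \<forall>z1\<in>parrows C G (Suc k) v v'. \<forall>z2\<in>parrows C G (Suc k) u' u.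
     equiv_upto C G r k (\<lambda>i a. conj_arr C G k i z1 a z2) u v u' v')"

lemma over_whiskerable: assumes "z1 \<in> parrows C G (Suc k) v v'" "z2 \<in> parrows C G (Suc k) u' u" "k < i"
   "a \<in> over C G k i u v"
  shows "whiskerable G k i z1 a z2"
  using assms by (auto simp: over_def parrows_def whiskerable_def)

lemma globular_map_conj: assumes G: "grpd G" and z: "z1 \<in> parrows C G (Suc k) v v'" "z2 \<in> parrows C G (Suc k) u' u"
  shows "globular_map C G k (\<lambda>i a. conj_arr C G k i z1 a z2) u v u' v'"
  unfolding globular_map_def
proof (intro conjI allI impI ballI)
  fix i a assume i: "k < i" and a: "a \<in> over C G k i u v"
  note w = over_whiskerable[OF z i a]
  show "conj_arr C G k i z1 a z2 \<in> over C G k i u' v'"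
    using conj_in[OF G w] msrc_conj[OF G w] z by (simp add: over_def parrows_def)
next
  fix i a assume i: "k < i" and a: "a \<in> over C G k (Suc i) u v"
  note w = over_whiskerable[OF z less_SucI[OF i] a]
  show "src C G (Suc i) (conj_arr C G k (Suc i) z1 a z2) = conj_arr C G k i z1 (src C G (Suc i) a) z2"
    "tgt C G (Suc i) (conj_arr C G k (Suc i) z1 a z2) = conj_arr C G k i z1 (tgt C G (Suc i) a) z2"
    using src_conj[OF G w i] by auto
qed

text \<open>The context dimension l stays put while the base dimension k may lie above it.
  Whiskerability depends only on the l-dimensional faces, and these are faces of the
  (k+1)-dimensional source and target, where it is assumed.\<close>

lemma globular_map_family: assumes G: "grpd G" and F: "family l (Suc k) F"
   and w: "\<And>a. a \<in> parrows C G (Suc k) u v \<Longrightarrow> whiskerable G l (Suc k) z1 a z2"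
   and b: "\<And>a. a \<in> parrows C G (Suc k) u v \<Longrightarrow> ctx_eval G l (Suc k) (F (Suc k)) z1 a z2 \<in> parrows C G (Suc k) u' v'"
  shows "\<And>i a. k < i \<Longrightarrow> a \<in> over C G k i u v \<Longrightarrow> whiskerable G l i z1 a z2"
    "globular_map C G k (\<lambda>i a. ctx_eval G l i (F i) z1 a z2) u v u' v'"
proof -
  have lk: "l \<le> k" using F by (simp add: family_def)
  have bd: "msrc C G i (Suc k) a \<in> parrows C G (Suc k) u v" "mtgt C G i (Suc k) a \<in> parrows C G (Suc k) u v"
    "a \<in> arr C G i" if "k < i" "a \<in> over C G k i u v" for i a
    using that src_msrc[OF G, of a i k] G by (auto simp: over_def parrows_def)
  have mm: "msrc C G i l a = msrc C G (Suc k) l (msrc C G i (Suc k) a)"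
    "mtgt C G i l a = mtgt C G (Suc k) l (mtgt C G i (Suc k) a)" if "k < i" "a \<in> arr C G i" for i a
    using that lk
  proof (induction i arbitrary: a)
    case (Suc i)
    {
      case 1
      then show ?case using Suc.IH(1)[of "src C G (Suc i) a"] G
        by (cases "k = i") (auto simp: msrc_Suc msrc_self src_in)
    next
      case 2
      then show ?case using Suc.IH(2)[of "tgt C G (Suc i) a"] G
        by (cases "k = i") (auto simp: mtgt_Suc mtgt_self tgt_in)
    }
  qed auto
  show ww: "whiskerable G l i z1 a z2" if "k < i" "a \<in> over C G k i u v" for i a
    using w[OF bd(1)[OF that]] w[OF bd(2)[OF that]] mm[OF that(1) bd(3)[OF that]] that(1) lk bd(3)[OF that]
    by (simp add: whiskerable_def)
  show "globular_map C G k (\<lambda>i a. ctx_eval G l i (F i) z1 a z2) u v u' v'"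
    unfolding globular_map_def
  proof (intro conjI allI impI ballI)
    fix i a assume i: "k < i" and a: "a \<in> over C G k i u v"
    let ?b = "ctx_eval G l i (F i) z1 a z2"
    have ba: "?b \<in> arr C G i" using ctx_eval_in[OF G ww[OF i a] family_in[OF F]] i by simp
    have "msrc C G i (Suc k) ?b \<in> parrows C G (Suc k) u' v'" "mtgt C G i (Suc k) ?b \<in> parrows C G (Suc k) u' v'"
      using family_msrc[OF G F _ ww[OF i a]] b[OF bd(1)[OF i a]] b[OF bd(2)[OF i a]] i by simp_all
    then show "?b \<in> over C G k i u' v'"
      using src_msrc[OF G ba i] ba by (auto simp: over_def parrows_def)
  next
    fix i a assume i: "k < i" and a: "a \<in> over C G k (Suc i) u v"
    note w = ww[OF less_SucI[OF i] a]
    show "src C G (Suc i) (ctx_eval G l (Suc i) (F (Suc i)) z1 a z2) = ctx_eval G l i (F i) z1 (src C G (Suc i) a) z2"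
      "tgt C G (Suc i) (ctx_eval G l (Suc i) (F (Suc i)) z1 a z2) = ctx_eval G l i (F i) z1 (tgt C G (Suc i) a) z2"
      using family_src[OF G F Suc_leI[OF i] w] by auto
  qed
qed

text \<open>In the lowest dimension \<open>F\<close> and \<open>F'\<close> are homotopic by
  contractibility, which settles that level. For the next one, \<open>F'\<close> is replaced by its
  bridge: it is parallel to \<open>F\<close> there, and it is an equivalence because it is
  \<open>F'\<close> followed by a whiskering covered by the assumption on smaller r.\<close>

lemma equiv_upto_transfer: assumes G: "grpd G"
  shows "(\<And>r'. r' < r \<Longrightarrow> whisker_equiv G r') \<Longrightarrow> family l (Suc k) F \<Longrightarrow> family l (Suc k) F' \<Longrightarrow>
    parallel (yon C (ctx l (Suc k))) (Suc k) (F (Suc k)) (F' (Suc k)) \<Longrightarrow>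
    (\<And>a. a \<in> parrows C G (Suc k) u v \<Longrightarrow> whiskerable G l (Suc k) z1 a z2) \<Longrightarrow>
    (\<And>a. a \<in> parrows C G (Suc k) u v \<Longrightarrow> ctx_eval G l (Suc k) (F (Suc k)) z1 a z2 \<in> parrows C G (Suc k) u' v') \<Longrightarrow>
    equiv_upto C G r k (\<lambda>i a. ctx_eval G l i (F' i) z1 a z2) u v u' v' \<Longrightarrow>
    equiv_upto C G r k (\<lambda>i a. ctx_eval G l i (F i) z1 a z2) u v u' v'"
proof (induction r arbitrary: k F' u v u' v')
  let ?e = "\<lambda>F i a. ctx_eval G l i (F i) z1 a z2"
  have htp: "htp C G (Suc k) (?e F (Suc k) a) (?e F' (Suc k) a)"
    if F: "family l (Suc k) F" "family l (Suc k) F'"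
      and p: "parallel (yon C (ctx l (Suc k))) (Suc k) (F (Suc k)) (F' (Suc k))"
      and w: "whiskerable G l (Suc k) z1 a z2" for k F F' a
  proof -
    have l: "l < Suc k" using F by (simp add: family_def)
    obtain h where h: "h \<in> chom C (gD C (Suc (Suc k))) (ctx l (Suc k))"
        "src C (yon C (ctx l (Suc k))) (Suc (Suc k)) h = F (Suc k)"
        "tgt C (yon C (ctx l (Suc k))) (Suc (Suc k)) h = F' (Suc k)"
      using ctx_filler[OF l family_in[OF F(1)] family_in[OF F(2)] p] by auto
    show ?thesis unfolding htp_def
      using ctx_eval_in[OF G w h(1)] ctx_eval_src[OF G w h(1)] h(2,3) by auto
  qed
  have level: "htp_bij C G G (Suc k) (?e F (Suc k)) u v u' v'"
    if F: "family l (Suc k) F" "family l (Suc k) F'"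
      and p: "parallel (yon C (ctx l (Suc k))) (Suc k) (F (Suc k)) (F' (Suc k))"
      and w: "\<And>a. a \<in> parrows C G (Suc k) u v \<Longrightarrow> whiskerable G l (Suc k) z1 a z2"
      and b: "htp_bij C G G (Suc k) (?e F' (Suc k)) u v u' v'" for k F F' u v u' v'
    unfolding htp_bij_def
  proof (intro conjI ballI impI)
    fix c assume "c \<in> parrows C G (Suc k) u' v'"
    then obtain a where a: "a \<in> parrows C G (Suc k) u v" "htp C G (Suc k) (?e F' (Suc k) a) c"
      using b unfolding htp_bij_def by blast
    then show "\<exists>a\<in>parrows C G (Suc k) u v. htp C G (Suc k) (?e F (Suc k) a) c"
      using htp_trans[OF G htp[OF F p w[OF a(1)]] a(2)] by blast
  next
    fix x y assume xy: "x \<in> parrows C G (Suc k) u v" "y \<in> parrows C G (Suc k) u v"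
      "htp C G (Suc k) (?e F (Suc k) x) (?e F (Suc k) y)"
    have "htp C G (Suc k) (?e F' (Suc k) x) (?e F' (Suc k) y)"
      using htp_trans[OF G htp_sym[OF G htp[OF F p w[OF xy(1)]]] htp_trans[OF G xy(3) htp[OF F p w[OF xy(2)]]]] .
    then show "htp C G (Suc k) x y" using b xy(1,2) by (simp add: htp_bij_def)
  qed
  {
    case 0
    then show ?case using level[OF 0(2-5)] by simp
  next
    case (Suc r)
    note F = Suc.prems(2) and F' = Suc.prems(3) and par = Suc.prems(4) and w = Suc.prems(5) and b = Suc.prems(6)
    have l: "l < Suc k" using F by (simp add: family_def)
    let ?Y = "yon C (ctx l (Suc k))"
    obtain h where h: "h \<in> chom C (gD C (Suc (Suc k))) (ctx l (Suc k))"
        "src C ?Y (Suc (Suc k)) h = F (Suc k)" "tgt C ?Y (Suc (Suc k)) h = F' (Suc k)"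
      using ctx_filler[OF l family_in[OF F order.refl] family_in[OF F' order.refl] par] by auto
    have par': "parallel ?Y (Suc k) (F' (Suc k)) (F (Suc k))" using par by (simp add: parallel_def)
    obtain h' where h': "h' \<in> chom C (gD C (Suc (Suc k))) (ctx l (Suc k))"
        "src C ?Y (Suc (Suc k)) h' = F' (Suc k)" "tgt C ?Y (Suc (Suc k)) h' = F (Suc k)"
      using ctx_filler[OF l family_in[OF F' order.refl] family_in[OF F order.refl] par'] by auto
    let ?B = "bridge l (Suc k) h' h F'"
    have "equiv_upto C G r (Suc k) (?e F) p q (?e F (Suc k) p) (?e F (Suc k) q)"
      if p: "p \<in> parrows C G (Suc k) u v" and q: "q \<in> parrows C G (Suc k) u v" for p q
    \<comment> \<open>The induction hypothesis is used with the bridge \<open>?B\<close> in the role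
      of \<open>F'\<close>; for this reason \<open>F'\<close> varies in the induction while
      \<open>F\<close> and the context stay fixed.\<close>
    proof (rule Suc.IH)
      have b': "?e F' (Suc k) a \<in> parrows C G (Suc k) u' v'" if "a \<in> parrows C G (Suc k) u v" for a
      proof -
        have "src C G (Suc k) (?e F' (Suc k) a) = src C G (Suc k) (?e F (Suc k) a)"
          "tgt C G (Suc k) (?e F' (Suc k) a) = tgt C G (Suc k) (?e F (Suc k) a)"
          using ctx_eval_src[OF G w[OF that] family_in[OF F order.refl]] par
            ctx_eval_src[OF G w[OF that] family_in[OF F' order.refl]] by (auto simp: parallel_def)
        then show ?thesis using b[OF that] ctx_eval_in[OF G w[OF that] family_in[OF F' order.refl]]
          by (simp add: parrows_def)
      qed
      have gF: "globular_map C G k (?e F) u v u' v'" by (rule globular_map_family(2)[OF G F w b])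
      have gF': "globular_map C G k (?e F') u v u' v'" by (rule globular_map_family(2)[OF G F' w b'])
      have ow: "whiskerable G l i z1 a z2" if "k < i" "a \<in> over C G k i u v" for i a
        by (rule globular_map_family(1)[OF G F w b that])
      have pq_w: "whiskerable G l i z1 a z2" if "Suc k < i" "a \<in> over C G (Suc k) i p q" for i a
        using ow[OF _ over_restrict[OF G p q that(2)]] that(1) by auto
      show "\<And>r'. r' < r \<Longrightarrow> whisker_equiv G r'" using Suc.prems(1) by simp
      show "family l (Suc (Suc k)) F" using family_later[OF F] by simp
      show "family l (Suc (Suc k)) ?B" by (rule bridge_family[OF F' h(1,3) h'(1,2)])
      show "parallel (yon C (ctx l (Suc (Suc k)))) (Suc (Suc k)) (F (Suc (Suc k))) (?B (Suc (Suc k)))"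
        by (rule bridge_parallel[OF F F' h(1,3,2) h'(1,2,3)])
      show "whiskerable G l (Suc (Suc k)) z1 a z2" if "a \<in> parrows C G (Suc (Suc k)) p q" for a
        using pq_w[of "Suc (Suc k)" a] that G by (simp add: parrows_over)
      show "?e F (Suc (Suc k)) a \<in> parrows C G (Suc (Suc k)) (?e F (Suc k) p) (?e F (Suc k) q)"
        if "a \<in> parrows C G (Suc (Suc k)) p q" for a
        by (rule globular_map_parrows[OF G globular_map_restrict[OF G gF p q] that])
      \<comment> \<open>The comparison cells at \<open>q\<close> and \<open>p\<close>:
        \<open>?z1\<close> leads from F'(q) to F(q) and \<open>?z2\<close> from F(p) to F'(p), as
        needed to turn arrows F'(p) -> F'(q) into arrows F(p) -> F(q).\<close>
      let ?z1 = "ctx_eval G l (Suc k) h' z1 q z2" and ?z2 = "ctx_eval G l (Suc k) h z1 p z2"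
      have z: "?z1 \<in> parrows C G (Suc (Suc k)) (?e F' (Suc k) q) (?e F (Suc k) q)"
          "?z2 \<in> parrows C G (Suc (Suc k)) (?e F (Suc k) p) (?e F' (Suc k) p)"
        using ctx_eval_in[OF G w[OF q] h'(1)] ctx_eval_in[OF G w[OF p] h(1)] ctx_eval_src[OF G w[OF q] h'(1)]
          ctx_eval_src[OF G w[OF p] h(1)] h h' by (simp_all add: parrows_def)
      have "equiv_upto C G r (Suc k) (\<lambda>i a. conj_arr C G (Suc k) i ?z1 a ?z2) (?e F' (Suc k) p) (?e F' (Suc k) q)
          (?e F (Suc k) p) (?e F (Suc k) q)"
        using Suc.prems(1)[of r] z unfolding whisker_equiv_def by blast
      moreover have "equiv_upto C G r (Suc k) (?e F') p q (?e F' (Suc k) p) (?e F' (Suc k) q)"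
        using Suc.prems(7) p q by simp
      ultimately have "equiv_upto C G r (Suc k) (\<lambda>i a. conj_arr C G (Suc k) i ?z1 (?e F' i a) ?z2) p q
          (?e F (Suc k) p) (?e F (Suc k) q)"
        using equiv_upto_comp[OF G globular_map_restrict[OF G gF' p q] globular_map_conj[OF G z]] by blast
      then show "equiv_upto C G r (Suc k) (?e ?B) p q (?e F (Suc k) p) (?e F (Suc k) q)"
      proof (rule equiv_upto_cong[OF G, rotated])
        fix i a assume i: "Suc k < i" and a: "a \<in> over C G (Suc k) i p q"
        show "conj_arr C G (Suc k) i ?z1 (?e F' i a) ?z2 = ?e ?B i a"
          using ctx_eval_bridge(2)[OF G F' i pq_w[OF i a] h(1,3) h'(1,2)] a by (simp add: over_def)
      qed
    qed
    then show ?case using level[OF F F' par w] Suc.prems(7) by simp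
  }
qed

section \<open>Whiskering followed by whiskering with inverses\<close>

definition conj_inv :: "nat \<Rightarrow> nat \<Rightarrow> 'm" where
  "conj_inv k i = conj_arr C (yon C (ctx k i)) k i (ginv C (yon C (ctx k i)) k (coproj0 k i))
     (conj_arr C (yon C (ctx k i)) k i (coproj0 k i) (coproj1 k i) (coproj2 k i)) (ginv C (yon C (ctx k i)) k (coproj2 k i))"

lemma whiskerable_ginv: assumes "grpd G" "whiskerable G k i z1 a z2"
  shows "whiskerable G k i (ginv C G k z1) (conj_arr C G k i z1 a z2) (ginv C G k z2)"
  using assms conj_in[OF assms] msrc_conj[OF assms]
  by (auto simp: whiskerable_def src_ginv tgt_ginv)

lemma ctx_eval_conj_inv: assumes G: "grpd G" and w: "whiskerable G k i z1 a z2"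
  shows "ctx_eval G k i (conj_inv k i) z1 a z2 =
    conj_arr C G k i (ginv C G k z1) (conj_arr C G k i z1 a z2) (ginv C G k z2)"
proof -
  have k: "k < i" using w by (simp add: whiskerable_def)
  note Y = ctx_grpd[OF k] and u = whiskerable_coproj[OF k] and m = ctx_eval_mor[OF G w]
  have e: "coproj0 k i \<in> arr C (yon C (ctx k i)) (Suc k)" "coproj2 k i \<in> arr C (yon C (ctx k i)) (Suc k)"
    using u by (auto simp: whiskerable_def)
  show ?thesis
    using mor_conj[OF Y G m whiskerable_ginv[OF Y u]] mor_conj[OF Y G m u] mor_ginv[OF m e(1)] mor_ginv[OF m e(2)]
      ctx_eval_coproj[OF G w] by (simp add: conj_inv_def)
qed

lemma conj_inv_family: "family k (Suc k) (conj_inv k)"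
  unfolding family_def
proof (intro conjI allI impI)
  fix i assume i: "Suc k \<le> i"
  then have ki: "k < i" "k < Suc i" by auto
  show "conj_inv k i \<in> chom C (gD C i) (ctx k i)"
    using conj_in[OF ctx_grpd[OF ki(1)] whiskerable_ginv[OF ctx_grpd[OF ki(1)] whiskerable_coproj[OF ki(1)]]]
    by (simp add: conj_inv_def)
  note Y = ctx_grpd[OF ki(2)] and u = whiskerable_coproj[OF ki(2)]
  note ws = whiskerable_src[OF Y u ki(1)]
  show "src C (yon C (ctx k (Suc i))) (Suc i) (conj_inv k (Suc i)) = ctx_eval (yon C (ctx k (Suc i))) k i (conj_inv k i)
       (coproj0 k (Suc i)) (src C (yon C (ctx k (Suc i))) (Suc i) (coproj1 k (Suc i))) (coproj2 k (Suc i))"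
    unfolding ctx_eval_conj_inv[OF Y ws(1)] conj_inv_def[of k "Suc i"]
     src_conj[OF Y whiskerable_ginv[OF Y u] ki(1)] src_conj[OF Y u ki(1)] ..
  show "tgt C (yon C (ctx k (Suc i))) (Suc i) (conj_inv k (Suc i)) = ctx_eval (yon C (ctx k (Suc i))) k i (conj_inv k i)
       (coproj0 k (Suc i)) (tgt C (yon C (ctx k (Suc i))) (Suc i) (coproj1 k (Suc i))) (coproj2 k (Suc i))"
    unfolding ctx_eval_conj_inv[OF Y ws(2)] conj_inv_def[of k "Suc i"]
     src_conj[OF Y whiskerable_ginv[OF Y u] ki(1)] src_conj[OF Y u ki(1)] ..
qed simp

lemma coproj1_family: "family k (Suc k) (coproj1 k)"
  unfolding family_def
proof (intro conjI allI impI)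
  fix i assume i: "Suc k \<le> i"
  then have ki: "k < i" "k < Suc i" by auto
  show "coproj1 k i \<in> chom C (gD C i) (ctx k i)" by (rule coproj1_in[OF ki(1)])
  note Y = ctx_grpd[OF ki(2)] and u = whiskerable_coproj[OF ki(2)]
  note ws = whiskerable_src[OF Y u ki(1)]
  show "src C (yon C (ctx k (Suc i))) (Suc i) (coproj1 k (Suc i)) = ctx_eval (yon C (ctx k (Suc i))) k i (coproj1 k i)
       (coproj0 k (Suc i)) (src C (yon C (ctx k (Suc i))) (Suc i) (coproj1 k (Suc i))) (coproj2 k (Suc i))"
   "tgt C (yon C (ctx k (Suc i))) (Suc i) (coproj1 k (Suc i)) = ctx_eval (yon C (ctx k (Suc i))) k i (coproj1 k i)
       (coproj0 k (Suc i)) (tgt C (yon C (ctx k (Suc i))) (Suc i) (coproj1 k (Suc i))) (coproj2 k (Suc i))"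
    using ctx_eval_coproj(2)[OF Y ws(1)] ctx_eval_coproj(2)[OF Y ws(2)] by auto
qed simp

text \<open>The source of the inverse of \<open>z2\<close> is the target of \<open>z2\<close>, which
  is the source of \<open>a\<close>, and dually for \<open>z1\<close>. This computation is special
  to dimension k + 1.\<close>

lemma conj_inv_parallel: "parallel (yon C (ctx k (Suc k))) (Suc k) (conj_inv k (Suc k)) (coproj1 k (Suc k))"
proof -
  note Y = ctx_grpd[OF lessI[of k]] and u = whiskerable_coproj[OF lessI[of k]]
  show ?thesis using src_conj_base[OF Y whiskerable_ginv[OF Y u]] u Y
    by (auto simp: parallel_def conj_inv_def whiskerable_def src_ginv tgt_ginv msrc_one mtgt_one)
qed

lemma whisker_equiv_all: assumes G: "grpd G" shows "whisker_equiv G r"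
proof (induction r rule: less_induct)
  case (less r)
  have inv: "z1 \<in> parrows C G (Suc k) v v' \<Longrightarrow> z2 \<in> parrows C G (Suc k) u' u \<Longrightarrow>
     ginv C G k z1 \<in> parrows C G (Suc k) v' v \<and> ginv C G k z2 \<in> parrows C G (Suc k) u u'" for k u v u' v' z1 z2
    using G by (auto simp: parrows_def src_ginv tgt_ginv)
  \<comment> \<open>Transfer along the comparison with the identity operation
    \<open>coproj1\<close>; the induction hypothesis enters through the whiskerings that make up the
    bridges.\<close>
  have comp: "equiv_upto C G r k (\<lambda>i a. conj_arr C G k i (ginv C G k z1) (conj_arr C G k i z1 a z2) (ginv C G k z2)) u v u v"
    if z: "z1 \<in> parrows C G (Suc k) v v'" "z2 \<in> parrows C G (Suc k) u' u" for k u v u' v' z1 z2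
  proof -
    have w: "whiskerable G k i z1 a z2" if "k < i" "a \<in> over C G k i u v" for i a
      using over_whiskerable[OF z that] .
    have w1: "whiskerable G k (Suc k) z1 a z2" if "a \<in> parrows C G (Suc k) u v" for a
      using w[OF lessI] that G by (simp add: parrows_over)
    have "equiv_upto C G r k (\<lambda>i a. ctx_eval G k i (conj_inv k i) z1 a z2) u v u v"
    proof (rule equiv_upto_transfer[OF G less.IH conj_inv_family coproj1_family conj_inv_parallel w1])
      show "ctx_eval G k (Suc k) (conj_inv k (Suc k)) z1 a z2 \<in> parrows C G (Suc k) u v"
        if a: "a \<in> parrows C G (Suc k) u v" for a
        unfolding ctx_eval_conj_inv[OF G w1[OF a]]
        using globular_map_parrows[OF G globular_map_conj[OF G, of "ginv C G k z1" k v' v "ginv C G k z2" u u'] globular_map_parrows[OF G globular_map_conj[OF G z] a]]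
          inv[OF z] by simp
      show "equiv_upto C G r k (\<lambda>i a. ctx_eval G k i (coproj1 k i) z1 a z2) u v u v"
        by (rule equiv_upto_cong[OF G _ equiv_upto_id[OF G]]) (simp add: ctx_eval_coproj[OF G w])
    qed
    then show ?thesis
      by (rule equiv_upto_cong[OF G, rotated]) (simp add: ctx_eval_conj_inv[OF G w])
  qed
  show ?case unfolding whisker_equiv_def
  proof (intro allI ballI)
    fix k u v u' v' z1 z2 assume z: "z1 \<in> parrows C G (Suc k) v v'" "z2 \<in> parrows C G (Suc k) u' u"
    let ?y1 = "ginv C G k z1" and ?y2 = "ginv C G k z2"
    have y: "?y1 \<in> parrows C G (Suc k) v' v" "?y2 \<in> parrows C G (Suc k) u u'" using inv[OF z] by auto
    have x: "ginv C G k ?y1 \<in> parrows C G (Suc k) v v'" "ginv C G k ?y2 \<in> parrows C G (Suc k) u' u"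
      using inv[OF y] by auto
    \<comment> \<open>Strict double inverses need not return \<open>z1\<close>, \<open>z2\<close>,
      so the two composites are used separately: \<open>comp[OF y]\<close> makes whiskering by the
      inverses injective, and \<open>comp[OF z]\<close> then allows it to be cancelled.\<close>
    have "inj_upto C G r k (\<lambda>i a. conj_arr C G k i ?y1 a ?y2) u' v'"
      by (rule equiv_upto_comp_inj_upto[OF G globular_map_conj[OF G y] globular_map_conj[OF G x] comp[OF y]])
    then show "equiv_upto C G r k (\<lambda>i a. conj_arr C G k i z1 a z2) u v u' v'"
      by (rule equiv_upto_cancel[OF G globular_map_conj[OF G z] globular_map_conj[OF G y] comp[OF z]])
  qed
qed

subsection \<open>Change of base arrow\<close>

lemma mor_parrows: "mor G H f \<Longrightarrow> a \<in> parrows C G (Suc k) u v \<Longrightarrow>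
    f (gD C (Suc k)) a \<in> parrows C H (Suc k) (f (gD C k) u) (f (gD C k) v)"
  by (auto simp: parrows_def mor_src[symmetric] mor_tgt[symmetric] intro: mor_in)

text \<open>In the commuting square formed by \<open>K\<close>, \<open>L\<close> and
  \<open>f\<close>, three sides are bijective on classes, hence so is the fourth. The family
  \<open>L'\<close> records that \<open>L\<close> preserves endpoints and homotopies.\<close>

lemma local_bij_pull: assumes G: "grpd G" and H: "grpd H" and f: "mor G H f"
   and K: "htp_bij C G G (Suc N) K p q p' q'" "\<And>a. a \<in> parrows C G (Suc N) p q \<Longrightarrow> K a \<in> parrows C G (Suc N) p' q'"
   and L: "htp_bij C H H (Suc N) L (f (gD C N) p) (f (gD C N) q) (f (gD C N) p') (f (gD C N) q')"
     "globular_map C H N L' (f (gD C N) p) (f (gD C N) q) (f (gD C N) p') (f (gD C N) q')" "L = L' (Suc N)"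
   and com: "\<And>a. a \<in> parrows C G (Suc N) p q \<Longrightarrow> f (gD C (Suc N)) (K a) = L (f (gD C (Suc N)) a)"
   and local_bij: "local_bij C G H f N p' q'"
  shows "local_bij C G H f N p q"
proof -
  let ?f = "f (gD C (Suc N))" and ?A = "parrows C G (Suc N) p q" and ?B = "parrows C H (Suc N) (f (gD C N) p) (f (gD C N) q)"
  note fA = mor_parrows[OF f]
  show ?thesis unfolding local_bij_def htp_bij_def
  proof (intro conjI ballI impI)
    fix c assume c: "c \<in> ?B"
    have "L c \<in> parrows C H (Suc N) (f (gD C N) p') (f (gD C N) q')" using globular_map_parrows[OF H L(2) c] L(3) by simp
    then obtain a' where a': "a' \<in> parrows C G (Suc N) p' q'" "htp C H (Suc N) (?f a') (L c)"
      using local_bij unfolding local_bij_def htp_bij_def by blast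
    then obtain a where a: "a \<in> ?A" "htp C G (Suc N) (K a) a'" using K(1) unfolding htp_bij_def by blast
    have "htp C H (Suc N) (L (?f a)) (L c)"
      using htp_trans[OF H htp_mor[OF f a(2)] a'(2)] com[OF a(1)] by simp
    then have "htp C H (Suc N) (?f a) c" using L(1) fA[OF a(1)] c unfolding htp_bij_def by blast
    then show "\<exists>a\<in>?A. htp C H (Suc N) (?f a) c" using a(1) by blast
  next
    fix a b assume ab: "a \<in> ?A" "b \<in> ?A" "htp C H (Suc N) (?f a) (?f b)"
    have "htp C H (Suc N) (?f (K a)) (?f (K b))"
      using globular_map_htp[OF H L(2) fA[OF ab(1)] ab(3)] L(3) com[OF ab(1)] com[OF ab(2)] by simp
    then have "htp C G (Suc N) (K a) (K b)"
      using local_bij K(2)[OF ab(1)] K(2)[OF ab(2)] unfolding local_bij_def htp_bij_def by blast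
    then show "htp C G (Suc N) a b" using K(1) ab unfolding htp_bij_def by blast
  qed
qed

text \<open>Here the whiskering arrows lie one dimension above the base pair, so they replace its
  members by others connected to them.\<close>

lemma local_bij_conj_base: assumes G: "grpd G" and H: "grpd H" and f: "mor G H f"
   and z: "z1 \<in> parrows C G (Suc k) v v'" "z2 \<in> parrows C G (Suc k) u' u"
   and local_bij: "local_bij C G H f k u' v'"
  shows "local_bij C G H f k u v"
proof -
  note fz = mor_parrows[OF f z(1)] mor_parrows[OF f z(2)]
  let ?K = "\<lambda>i a. conj_arr C G k i z1 a z2"
  let ?L = "\<lambda>i a. conj_arr C H k i (f (gD C (Suc k)) z1) a (f (gD C (Suc k)) z2)"
  have K: "equiv_upto C G 0 k ?K u v u' v'" using whisker_equiv_all[OF G] z unfolding whisker_equiv_def by blast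
  have L: "equiv_upto C H 0 k ?L (f (gD C k) u) (f (gD C k) v) (f (gD C k) u') (f (gD C k) v')"
    using whisker_equiv_all[OF H] fz unfolding whisker_equiv_def by blast
  show ?thesis
  proof (rule local_bij_pull[OF G H f equiv_upto_bij[OF K] _ equiv_upto_bij[OF L] globular_map_conj[OF H fz] refl _ local_bij])
    fix a assume a: "a \<in> parrows C G (Suc k) u v"
    show "?K (Suc k) a \<in> parrows C G (Suc k) u' v'"
      by (rule globular_map_parrows[OF G globular_map_conj[OF G z] a])
    show "f (gD C (Suc k)) (?K (Suc k) a) = ?L (Suc k) (f (gD C (Suc k)) a)"
      using a mor_conj[OF G H f over_whiskerable[OF z lessI]] G by (simp add: parrows_over)
  qed
qed

text \<open>Whiskering along a lower dimension j < N acts on the base N-arrow itself, and loops at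
  \<open>p\<close> become loops at the whiskered \<open>p\<close>.\<close>

lemma local_bij_conj: assumes G: "grpd G" and H: "grpd H" and f: "mor G H f"
   and z: "z1 \<in> parrows C G (Suc j) v v'" "z2 \<in> parrows C G (Suc j) u' u"
   and jN: "j < N" and p: "p \<in> over C G j N u v"
   and local_bij: "local_bij C G H f N (conj_arr C G j N z1 p z2) (conj_arr C G j N z1 p z2)"
  shows "local_bij C G H f N p p"
proof -
  note fz = mor_parrows[OF f z(1)] mor_parrows[OF f z(2)]
  let ?K = "\<lambda>i a. conj_arr C G j i z1 a z2"
  let ?L = "\<lambda>i a. conj_arr C H j i (f (gD C (Suc j)) z1) a (f (gD C (Suc j)) z2)"
  have N: "N \<le> j + N" by simp
  have fp: "f (gD C N) p \<in> over C H j N (f (gD C j) u) (f (gD C j) v)"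
    using p jN by (auto simp: over_def mor_msrc[OF f, symmetric] mor_mtgt[OF f, symmetric] intro: mor_in[OF f])
  have fK: "f (gD C N) (?K N p) = ?L N (f (gD C N) p)"
    by (rule mor_conj[OF G H f over_whiskerable[OF z jN p]])
  have "equiv_upto C G N j ?K u v u' v'" using whisker_equiv_all[OF G] z unfolding whisker_equiv_def by blast
  note K = equiv_upto_descend[OF G globular_map_conj[OF G z] this jN N p]
  have "equiv_upto C H N j ?L (f (gD C j) u) (f (gD C j) v) (f (gD C j) u') (f (gD C j) v')"
    using whisker_equiv_all[OF H] fz unfolding whisker_equiv_def by blast
  note L = equiv_upto_descend[OF H globular_map_conj[OF H fz] this jN N fp, folded fK]
  show ?thesis
  proof (rule local_bij_pull[OF G H f K[THEN conjunct2] _ L[THEN conjunct2] L[THEN conjunct1] refl _ local_bij])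
    fix a assume a: "a \<in> parrows C G (Suc N) p p"
    show "?K (Suc N) a \<in> parrows C G (Suc N) (?K N p) (?K N p)"
      by (rule globular_map_parrows[OF G K[THEN conjunct1] a])
    have "a \<in> over C G j (Suc N) u v"
      using a p jN G by (auto simp: over_def parrows_def msrc_Suc mtgt_Suc)
    then show "f (gD C (Suc N)) (?K (Suc N) a) = ?L (Suc N) (f (gD C (Suc N)) a)"
      using mor_conj[OF G H f over_whiskerable[OF z]] jN by simp
  qed
qed

text \<open>The operations \<open>p\<close> and \<open>q\<close> agree below dimension j. Their
  j-dimensional faces are then parallel and can be joined by fillers, and whiskering
  \<open>p\<close> by these makes it agree with \<open>q\<close> in dimension j as well. The bound m
  <= j + 1 is admissibility for D_m, and it persists as j grows.\<close>

lemma local_bij_transport: assumes G: "grpd G" and H: "grpd H" and f: "mor G H f" and y: "y \<in> arr C G m"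
   and q: "q \<in> chom C (gD C N) (gD C m)" and local_bij: "local_bij C G H f N (pmor G q y) (pmor G q y)"
  shows "j \<le> Suc N \<Longrightarrow> m \<le> Suc j \<Longrightarrow> p \<in> chom C (gD C N) (gD C m) \<Longrightarrow>
    (\<And>j'. j = Suc j' \<Longrightarrow> msrc C (yon C (gD C m)) N j' p = msrc C (yon C (gD C m)) N j' q \<and>
      mtgt C (yon C (gD C m)) N j' p = mtgt C (yon C (gD C m)) N j' q) \<Longrightarrow>
    local_bij C G H f N (pmor G p y) (pmor G p y)"
proof (induction "Suc N - j" arbitrary: j p)
  case 0
  then have "j = Suc N" by simp
  \<comment> \<open>Agreement of the N-dimensional faces is equality of the operations.\<close>
  then have "p = q" using 0(4) q 0(5)[of N] yon_grpd[OF D_in, of m] by (simp add: msrc_self)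
  then show ?case using local_bij by simp
next
  case (Suc d)
  let ?Y = "yon C (gD C m)"
  let ?ev = "\<lambda>D \<phi>. pmor G \<phi> y"
  have Y: "grpd ?Y" by (rule yon_grpd[OF D_in])
  have ev: "mor ?Y G ?ev" by (rule yon_mor[OF G y])
  have j: "j \<le> N" using Suc(2) by simp
  have pY: "p \<in> arr C ?Y N" and qY: "q \<in> arr C ?Y N" using Suc(5) q by simp_all
  have pq: "parallel ?Y j (msrc C ?Y N j p) (msrc C ?Y N j q) \<and> parallel ?Y j (mtgt C ?Y N j p) (mtgt C ?Y N j q)"
  proof (cases j)
    case (Suc j')
    then show ?thesis using Suc.prems(4)[OF Suc] src_msrc[OF Y pY, of j'] src_msrc[OF Y qY, of j'] j
      by (simp add: parallel_def)
  qed (simp add: parallel_def)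
  have par: "parallel ?Y j b a" if "parallel ?Y j a b" for a b using that by (auto simp: parallel_def)
  \<comment> \<open>The filler for sources runs from \<open>q\<close> to \<open>p\<close> and the
    one for targets from \<open>p\<close> to \<open>q\<close>, so that \<open>p\<close> whiskered by
    them has the j-dimensional faces of \<open>q\<close>.\<close>
  obtain h where h: "h \<in> arr C ?Y (Suc j)" "src C ?Y (Suc j) h = msrc C ?Y N j q" "tgt C ?Y (Suc j) h = msrc C ?Y N j p"
    using disk_filler[OF Suc.prems(2) msrc_in[OF Y qY j] msrc_in[OF Y pY j] par] pq by blast
  obtain h' where h': "h' \<in> arr C ?Y (Suc j)" "src C ?Y (Suc j) h' = mtgt C ?Y N j p" "tgt C ?Y (Suc j) h' = mtgt C ?Y N j q"
    using disk_filler[OF Suc.prems(2) mtgt_in[OF Y pY j] mtgt_in[OF Y qY j]] pq by blast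
  have z': "h' \<in> parrows C ?Y (Suc j) (mtgt C ?Y N j p) (mtgt C ?Y N j q)"
      "h \<in> parrows C ?Y (Suc j) (msrc C ?Y N j q) (msrc C ?Y N j p)"
    using h h' by (simp_all add: parrows_def)
  note z = mor_parrows[OF ev z'(1)] mor_parrows[OF ev z'(2)]
  show ?case
  proof (cases "j = N")
    case True
    \<comment> \<open>In the top dimension the fillers join \<open>p\<close> and \<open>q\<close>
      themselves, and the base pair is changed directly.\<close>
    then have m: "msrc C ?Y N j p = p" "mtgt C ?Y N j p = p" "msrc C ?Y N j q = q" "mtgt C ?Y N j q = q"
      using pY qY Y by (simp_all add: msrc_self mtgt_self)
    show ?thesis using local_bij_conj_base[OF G H f z[unfolded m]] local_bij True by simp
  next
    case False
    then have jN: "j < N" using j by simp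
    have po: "p \<in> over C ?Y j N (msrc C ?Y N j p) (mtgt C ?Y N j p)" using pY by (simp add: over_def)
    note w = over_whiskerable[OF z' jN po]
    let ?p = "conj_arr C ?Y j N h' p h"
    have p': "?p \<in> arr C ?Y N" by (rule conj_in[OF Y w])
    have "local_bij C G H f N (pmor G ?p y) (pmor G ?p y)"
    proof (rule Suc.hyps(1)[of "Suc j"])
      show "d = Suc N - Suc j" using Suc.hyps(2) by simp
      show "?p \<in> chom C (gD C N) (gD C m)" using p' by simp
      show "msrc C ?Y N j' ?p = msrc C ?Y N j' q \<and> mtgt C ?Y N j' ?p = mtgt C ?Y N j' q" if "Suc j = Suc j'" for j'
        using that msrc_conj[OF Y w] h h' by simp
    qed (use jN Suc.prems(2) in auto)
    then have gd: "local_bij C G H f N (conj_arr C G j N (pmor G h' y) (pmor G p y) (pmor G h y))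
        (conj_arr C G j N (pmor G h' y) (pmor G p y) (pmor G h y))"
      using mor_conj[OF Y G ev w] by simp
    have "pmor G p y \<in> over C G j N (?ev (gD C j) (msrc C ?Y N j p)) (?ev (gD C j) (mtgt C ?Y N j p))"
      using mor_msrc[OF ev pY j] mor_mtgt[OF ev pY j] mor_in[OF ev D_in pY] by (simp add: over_def)
    then show ?thesis using local_bij_conj[OF G H f z jN _ gd] by simp
  qed
qed

lemma local_bij_units: assumes G: "grpd G" and H: "grpd H" and f: "mor G H f"
   and base: "\<And>x. x \<in> arr C G 0 \<Longrightarrow> local_bij C G H f N (gunits C G 0 N x) (gunits C G 0 N x)"
  shows "m \<le> N \<Longrightarrow> y \<in> arr C G m \<Longrightarrow> local_bij C G H f N (gunits C G m (N - m) y) (gunits C G m (N - m) y)"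
proof (induction m arbitrary: y)
  case 0
  then show ?case using base by simp
next
  case (Suc m)
  let ?Y = "yon C (gD C (Suc m))" and ?e = "cid C (gD C (Suc m))"
  let ?ev = "\<lambda>D \<phi>. pmor G \<phi> y"
  have Y: "grpd ?Y" by (rule yon_grpd[OF D_in])
  have ev: "mor ?Y G ?ev" by (rule yon_mor[OF G Suc.prems(2)])
  have e: "?e \<in> arr C ?Y (Suc m)" using id_in[OF D_in] by simp
  have se: "src C ?Y (Suc m) ?e \<in> arr C ?Y m" by (rule src_in[OF Y e])
  have ye: "pmor G ?e y = y" by (rule pmor_id[OF G D_in Suc.prems(2)])
  \<comment> \<open>Both operations live on the universal (m+1)-arrow, the identity of D_(m+1):
    iterated units on it, and iterated units on its source.\<close>
  let ?p = "gunits C ?Y (Suc m) (N - Suc m) ?e" and ?q = "gunits C ?Y m (N - m) (src C ?Y (Suc m) ?e)"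
  have N: "Suc m + (N - Suc m) = N" "m + (N - m) = N" using Suc.prems(1) by auto
  have p: "?p \<in> chom C (gD C N) (gD C (Suc m))" using gunits_in[OF Y e, of "N - Suc m"] N by simp
  have q: "?q \<in> chom C (gD C N) (gD C (Suc m))" using gunits_in[OF Y se, of "N - m"] N by simp
  have evp: "pmor G ?p y = gunits C G (Suc m) (N - Suc m) y"
    using mor_gunits[OF Y ev e, of "N - Suc m"] ye by simp
  have evq: "pmor G ?q y = gunits C G m (N - m) (src C G (Suc m) y)"
    using mor_gunits[OF Y ev se, of "N - m"] mor_src[OF ev e] ye by simp
  have "local_bij C G H f N (pmor G ?p y) (pmor G ?p y)"
  \<comment> \<open>Below dimension m both operations have the faces of the universal arrow.
    Starting at j = m meets the admissibility bound for D_(m+1) with equality.\<close>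
  proof (rule local_bij_transport[OF G H f Suc.prems(2) q, where j = m])
    show "local_bij C G H f N (pmor G ?q y) (pmor G ?q y)"
      unfolding evq using Suc.IH[OF _ src_in[OF G Suc.prems(2)]] Suc.prems(1) by simp
    show "msrc C ?Y N j' ?p = msrc C ?Y N j' ?q \<and> mtgt C ?Y N j' ?p = mtgt C ?Y N j' ?q" if "m = Suc j'" for j'
      using msrc_gunits[OF Y e, of j' "N - Suc m", unfolded N] msrc_gunits[OF Y se, of j' "N - m", unfolded N] that
        msrc_Suc[OF Y e, of j'] mtgt_Suc[OF Y e, of j'] mtgt_src[OF Y e, of j'] by simp
  qed (use p Suc.prems(1) in auto)
  then show ?case unfolding evp .
qed

lemma local_bij_from_units: assumes "grpd G" "grpd H" "mor G H f"
   and "\<And>x. x \<in> arr C G 0 \<Longrightarrow> local_bij C G H f N (gunits C G 0 N x) (gunits C G 0 N x)" and "u \<in> arr C G N"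
  shows "local_bij C G H f N u u"
  using local_bij_units[OF assms(1-4) order.refl assms(5)] by simp

end

section \<open>Homotopy groups\<close>

lemma ind_map_class: assumes "equiv A R" "equiv B S" "\<And>a b. (a, b) \<in> R \<Longrightarrow> (g a, g b) \<in> S" "a \<in> A"
  shows "ind_map S g (R `` {a}) = S `` {g a}"
  unfolding ind_map_def
  by (rule UN_equiv_class[OF assms(1) _ assms(4)], rule congruentI, rule equiv_class_eq[OF assms(2) assms(3)])

lemma ind_map_inj_iff: assumes "equiv A R" "equiv B S" "\<And>a b. (a, b) \<in> R \<Longrightarrow> (g a, g b) \<in> S"
   "\<And>a. a \<in> A \<Longrightarrow> g a \<in> B"
  shows "inj_on (ind_map S g) (A // R) \<longleftrightarrow> (\<forall>a\<in>A. \<forall>b\<in>A. (g a, g b) \<in> S \<longrightarrow> (a, b) \<in> R)"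
proof -
  have "inj_on (ind_map S g) (A // R) \<longleftrightarrow>
     (\<forall>a\<in>A. \<forall>b\<in>A. ind_map S g (R `` {a}) = ind_map S g (R `` {b}) \<longrightarrow> R `` {a} = R `` {b})"
    by (auto simp: inj_on_def quotient_def)
  also have "\<dots> \<longleftrightarrow> (\<forall>a\<in>A. \<forall>b\<in>A. (g a, g b) \<in> S \<longrightarrow> (a, b) \<in> R)"
    by (simp add: ind_map_class[OF assms(1-3)] eq_equiv_class_iff[OF assms(1)] eq_equiv_class_iff[OF assms(2)] assms(4))
  finally show ?thesis .
qed

lemma ind_map_surj_iff: assumes "equiv A R" "equiv B S" "\<And>a b. (a, b) \<in> R \<Longrightarrow> (g a, g b) \<in> S"
   "\<And>a. a \<in> A \<Longrightarrow> g a \<in> B"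
  shows "(\<forall>Y\<in>B // S. \<exists>X\<in>A // R. ind_map S g X = Y) \<longleftrightarrow> (\<forall>b\<in>B. \<exists>a\<in>A. (g a, b) \<in> S)"
proof -
  have "(\<forall>Y\<in>B // S. \<exists>X\<in>A // R. ind_map S g X = Y) \<longleftrightarrow>
     (\<forall>b\<in>B. \<exists>a\<in>A. ind_map S g (R `` {a}) = S `` {b})"
    by (simp add: quotient_def)
  also have "\<dots> \<longleftrightarrow> (\<forall>b\<in>B. \<exists>a\<in>A. (g a, b) \<in> S)"
    by (simp add: ind_map_class[OF assms(1-3)] eq_equiv_class_iff[OF assms(2)] assms(4) cong: bex_cong)
  finally show ?thesis .
qed

text \<open>The passage between statements about classes and statements about representatives, used
  for pi_0 and for every pi_n.\<close>

lemma ind_map_bij_iff: assumes "equiv A R" "equiv B S" "\<And>a b. (a, b) \<in> R \<Longrightarrow> (g a, g b) \<in> S"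
   "\<And>a. a \<in> A \<Longrightarrow> g a \<in> B"
  shows "bij_betw (ind_map S g) (A // R) (B // S) \<longleftrightarrow>
    (\<forall>b\<in>B. \<exists>a\<in>A. (g a, b) \<in> S) \<and> (\<forall>a\<in>A. \<forall>b\<in>A. (g a, g b) \<in> S \<longrightarrow> (a, b) \<in> R)"
proof -
  have "ind_map S g X \<in> B // S" if "X \<in> A // R" for X
    using that by (auto elim!: quotientE simp: ind_map_class[OF assms(1-3)] intro!: quotientI assms(4))
  then have "ind_map S g ` (A // R) \<subseteq> B // S" by (rule image_subsetI)
  moreover have im: "Y \<in> ind_map S g ` (A // R) \<longleftrightarrow> (\<exists>X\<in>A // R. ind_map S g X = Y)" for Y by auto
  ultimately have "ind_map S g ` (A // R) = B // S \<longleftrightarrow> (\<forall>Y\<in>B // S. \<exists>X\<in>A // R. ind_map S g X = Y)"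
    unfolding im[symmetric] by (simp add: set_eq_subset subset_eq)
  then show ?thesis
    by (simp add: bij_betw_def ind_map_inj_iff[OF assms] ind_map_surj_iff[OF assms] conj_commute)
qed

lemma all_nat_split: "(\<forall>k. P k) \<longleftrightarrow> P 0 \<and> (\<forall>k. P (Suc k))"
  by (metis not0_implies_Suc)

lemma all_ge_1_iff: "(\<forall>n\<ge>1. P n) \<longleftrightarrow> (\<forall>k. P (Suc k))"
  by (metis One_nat_def Suc_le_D le_add1 plus_1_eq_Suc)

lemma all_ge_2_iff: "(\<forall>n\<ge>2. P n) \<longleftrightarrow> (\<forall>k. P (Suc (Suc k)))"
  by (metis Suc_le_D Suc_le_mono all_ge_1_iff numeral_2_eq_2 One_nat_def)

context pregroupoidal_extension
begin

lemma htpy_rel_iff: "(a, b) \<in> htpy_rel C G n A \<longleftrightarrow> a \<in> A \<and> b \<in> A \<and> htp C G n a b"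
  by (auto simp: htpy_rel_def htp_def)

lemma htpy_rel_equiv: assumes "grpd G" "A \<subseteq> arr C G n" shows "equiv A (htpy_rel C G n A)"
proof (rule equivI)
  show "htpy_rel C G n A \<subseteq> A \<times> A" by (auto simp: htpy_rel_iff)
  show "refl_on A (htpy_rel C G n A)" using assms by (auto simp: refl_on_def htpy_rel_iff intro: htp_refl)
  show "sym (htpy_rel C G n A)" using htp_sym[OF assms(1)] by (auto simp: sym_def htpy_rel_iff)
  show "trans (htpy_rel C G n A)" using htp_trans[OF assms(1)] by (auto intro!: transI simp: htpy_rel_iff)
qed

lemma parrows_equiv: "grpd G \<Longrightarrow> equiv (parrows C G n u v) (htpy_rel C G n (parrows C G n u v))"
  by (rule htpy_rel_equiv) (auto simp: parrows_def)

lemma arr_equiv: "grpd G \<Longrightarrow> equiv (arr C G n) (htpy_rel C G n (arr C G n))"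
  by (rule htpy_rel_equiv) auto

context
  fixes G :: "('o,'m,'a) psh" and H :: "('o,'m,'b) psh" and f
  assumes G: "grpd G" and H: "grpd H" and f: "mor G H f"
begin

lemma mor_htpy_rel: "(a, b) \<in> htpy_rel C G (Suc k) (parrows C G (Suc k) u v) \<Longrightarrow>
   (f (gD C (Suc k)) a, f (gD C (Suc k)) b) \<in> htpy_rel C H (Suc k) (parrows C H (Suc k) (f (gD C k) u) (f (gD C k) v))"
  using mor_parrows[OF f] htp_mor[OF f] by (simp add: htpy_rel_iff)

lemma pin_map_inj_iff: "inj_on (pin_map C H f (Suc k) u v) (pin C G (Suc k) u v) \<longleftrightarrow>
   (\<forall>a\<in>parrows C G (Suc k) u v. \<forall>b\<in>parrows C G (Suc k) u v.
      htp C H (Suc k) (f (gD C (Suc k)) a) (f (gD C (Suc k)) b) \<longrightarrow> htp C G (Suc k) a b)"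
  unfolding pin_map_def pin_def diff_Suc_1
  by (subst ind_map_inj_iff[OF parrows_equiv[OF G] parrows_equiv[OF H]])
    (simp_all add: htp_mor[OF f] mor_parrows[OF f] htpy_rel_iff cong: bex_cong)

lemma pin_map_surj_iff: "(\<forall>Y\<in>pin C H (Suc k) (f (gD C k) u) (f (gD C k) v).
      \<exists>X\<in>pin C G (Suc k) u v. pin_map C H f (Suc k) u v X = Y) \<longleftrightarrow>
   (\<forall>c\<in>parrows C H (Suc k) (f (gD C k) u) (f (gD C k) v).
      \<exists>a\<in>parrows C G (Suc k) u v. htp C H (Suc k) (f (gD C (Suc k)) a) c)"
  unfolding pin_map_def pin_def diff_Suc_1
  by (subst ind_map_surj_iff[OF parrows_equiv[OF G] parrows_equiv[OF H]])
    (simp_all add: htp_mor[OF f] mor_parrows[OF f] htpy_rel_iff cong: bex_cong)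

lemma pin_map_bij_iff: "bij_betw (pin_map C H f (Suc k) u v) (pin C G (Suc k) u v)
     (pin C H (Suc k) (f (gD C k) u) (f (gD C k) v)) \<longleftrightarrow> local_bij C G H f k u v"
  unfolding pin_map_def pin_def diff_Suc_1 local_bij_def htp_bij_def
  by (subst ind_map_bij_iff[OF parrows_equiv[OF G] parrows_equiv[OF H]])
    (simp_all add: htp_mor[OF f] mor_parrows[OF f] htpy_rel_iff cong: bex_cong)

lemma pi0_map_bij_iff: "bij_betw (pi0_map C H f) (pi0 C G) (pi0 C H) \<longleftrightarrow>
    (\<forall>y\<in>arr C H 0. \<exists>x\<in>arr C G 0. htp C H 0 (f (gD C 0) x) y) \<and>
    (\<forall>x\<in>arr C G 0. \<forall>y\<in>arr C G 0. htp C H 0 (f (gD C 0) x) (f (gD C 0) y) \<longrightarrow> htp C G 0 x y)"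
  unfolding pi0_map_def pi0_def
  by (subst ind_map_bij_iff[OF arr_equiv[OF G] arr_equiv[OF H]])
    (simp_all add: htp_mor[OF f] mor_in[OF f D_in] htpy_rel_iff cong: bex_cong)

end

section \<open>Composition on homotopy classes\<close>

lemma parrows_composable: "grpd G \<Longrightarrow> x \<in> parrows C G (Suc k) v w \<Longrightarrow> y \<in> parrows C G (Suc k) u v \<Longrightarrow>
    composable G (Suc k) k x y"
  by (simp add: parrows_def composable_def msrc_one mtgt_one)

lemma gcomp_parrows: assumes "grpd G" "x \<in> parrows C G (Suc k) v w" "y \<in> parrows C G (Suc k) u v"
  shows "gcomp C G (Suc k) k x y \<in> parrows C G (Suc k) u w"
  using gcomp_in[OF assms(1) parrows_composable[OF assms]] src_gcomp[OF assms(1) parrows_composable[OF assms]] assms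
  by (simp add: parrows_def)

text \<open>The two homotopies are (k+2)-arrows that can be composed along dimension k; the faces of
  this horizontal composite are the composites of the faces.\<close>

lemma htp_gcomp: assumes G: "grpd G" and x: "x \<in> parrows C G (Suc k) v w" and y: "y \<in> parrows C G (Suc k) u v"
   and "htp C G (Suc k) x x'" "htp C G (Suc k) y y'"
  shows "htp C G (Suc k) (gcomp C G (Suc k) k x y) (gcomp C G (Suc k) k x' y')"
proof -
  let ?n = "Suc (Suc k)"
  obtain c d where c: "c \<in> arr C G ?n" "src C G ?n c = x" "tgt C G ?n c = x'"
    and d: "d \<in> arr C G ?n" "src C G ?n d = y" "tgt C G ?n d = y'"
    using assms(4,5) by (auto simp: htp_def)
  have "msrc C G ?n k c = v" using msrc_Suc[OF G c(1), of k] x c G by (simp add: parrows_def msrc_one)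
  moreover have "mtgt C G ?n k d = v"
    using mtgt_Suc[OF G d(1), of k] mtgt_src[OF G d(1), of k] mtgt_one[OF G, of y k] y d by (simp add: parrows_def)
  ultimately have "composable G ?n k c d" using c d by (simp add: composable_def)
  then show ?thesis
    using gcomp_in[OF G] src_gcomp_less[OF G _ lessI] c d unfolding htp_def by metis
qed

lemma gcomp_class: assumes G: "grpd G" and x: "x \<in> parrows C G (Suc k) v w" and y: "y \<in> parrows C G (Suc k) u v"
  shows "(\<Union>b\<in>htpy_rel C G (Suc k) (parrows C G (Suc k) v w) `` {x}.
      \<Union>a\<in>htpy_rel C G (Suc k) (parrows C G (Suc k) u v) `` {y}.
        htpy_rel C G (Suc k) (parrows C G (Suc k) u w) `` {gcomp C G (Suc k) k b a}) =
     htpy_rel C G (Suc k) (parrows C G (Suc k) u w) `` {gcomp C G (Suc k) k x y}"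
proof (rule UN_equiv_class2[OF parrows_equiv[OF G] parrows_equiv[OF G] _ x y], rule congruent2I')
  fix b b' a a' assume b: "(b, b') \<in> htpy_rel C G (Suc k) (parrows C G (Suc k) v w)"
    and a: "(a, a') \<in> htpy_rel C G (Suc k) (parrows C G (Suc k) u v)"
  show "htpy_rel C G (Suc k) (parrows C G (Suc k) u w) `` {gcomp C G (Suc k) k b a} =
     htpy_rel C G (Suc k) (parrows C G (Suc k) u w) `` {gcomp C G (Suc k) k b' a'}"
    using a b htp_gcomp[OF G, of b k v w a u b' a'] gcomp_parrows[OF G, of _ k v w _ u]
    by (intro equiv_class_eq[OF parrows_equiv[OF G]]) (auto simp: htpy_rel_iff)
qed

lemma pin_map_class: assumes "grpd G" "grpd H" "mor G H f" "x \<in> parrows C G (Suc k) u v"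
  shows "pin_map C H f (Suc k) u v (htpy_rel C G (Suc k) (parrows C G (Suc k) u v) `` {x}) =
    htpy_rel C H (Suc k) (parrows C H (Suc k) (f (gD C k) u) (f (gD C k) v)) `` {f (gD C (Suc k)) x}"
  unfolding pin_map_def diff_Suc_1
  by (rule ind_map_class[OF parrows_equiv[OF assms(1)] parrows_equiv[OF assms(2)] mor_htpy_rel[OF assms(1-3)] assms(4)])

lemma pin_map_hom: assumes G: "grpd G" and H: "grpd H" and f: "mor G H f"
  shows "pin_map C H f (Suc k) u u \<in> hom (pi_grp C G (Suc k) u) (pi_grp C H (Suc k) (f (gD C k) u))"
proof (rule homI)
  let ?R = "htpy_rel C G (Suc k) (parrows C G (Suc k) u u)" and ?f = "f (gD C (Suc k))"
  fix X assume "X \<in> carrier (pi_grp C G (Suc k) u)"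
  then obtain x where x: "x \<in> parrows C G (Suc k) u u" "X = ?R `` {x}"
    by (auto simp: pi_grp_def pin_def elim: quotientE)
  show "pin_map C H f (Suc k) u u X \<in> carrier (pi_grp C H (Suc k) (f (gD C k) u))"
    using pin_map_class[OF G H f x(1)] x mor_parrows[OF f x(1)] by (simp add: pi_grp_def pin_def quotientI)
  fix Y assume "Y \<in> carrier (pi_grp C G (Suc k) u)"
  then obtain y where y: "y \<in> parrows C G (Suc k) u u" "Y = ?R `` {y}"
    by (auto simp: pi_grp_def pin_def elim: quotientE)
  show "pin_map C H f (Suc k) u u (X \<otimes>\<^bsub>pi_grp C G (Suc k) u\<^esub> Y) =
     pin_map C H f (Suc k) u u X \<otimes>\<^bsub>pi_grp C H (Suc k) (f (gD C k) u)\<^esub> pin_map C H f (Suc k) u u Y"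
    using gcomp_class[OF G x(1) y(1)] gcomp_class[OF H mor_parrows[OF f x(1)] mor_parrows[OF f y(1)]]
      pin_map_class[OF G H f x(1)] pin_map_class[OF G H f y(1)]
      pin_map_class[OF G H f gcomp_parrows[OF G x(1) y(1)]]
      mor_gcomp[OF G H f parrows_composable[OF G x(1) y(1)]]
    by (simp add: x(2) y(2) pi_grp_def)
qed

text \<open>Compatibility with the product is automatic for a morphism, so being an isomorphism
  reduces to bijectivity.\<close>

lemma pin_map_iso_iff: assumes "grpd G" "grpd H" "mor G H f"
  shows "pin_map C H f (Suc k) u u \<in> iso (pi_grp C G (Suc k) u) (pi_grp C H (Suc k) (f (gD C k) u)) \<longleftrightarrow>
    local_bij C G H f k u u"
  using pin_map_hom[OF assms] pin_map_bij_iff[OF assms, of k u u] by (simp add: iso_def pi_grp_def)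

section \<open>Inverses in the fundamental groupoid\<close>

text \<open>Both sides are values at \<open>a\<close> of operations on the universal 1-arrow, the
  identity of D_1. There they are parallel, and fillers exist because D_1 has dimension at most
  2.\<close>

lemma ginv_gcomp: assumes G: "grpd G" and a: "a \<in> parrows C G 1 x y"
  shows "htp C G 1 (gcomp C G 1 0 (ginv C G 0 a) a) (gunit C G 0 x)"
    "htp C G 1 (gcomp C G 1 0 a (ginv C G 0 a)) (gunit C G 0 y)"
proof -
  let ?Y = "yon C (gD C 1)" and ?e = "cid C (gD C 1)"
  let ?ev = "\<lambda>D \<phi>. pmor G \<phi> a"
  have aG: "a \<in> arr C G 1" "src C G 1 a = x" "tgt C G 1 a = y" using a by (auto simp: parrows_def)
  have Y: "grpd ?Y" by (rule yon_grpd[OF D_in])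
  have ev: "mor ?Y G ?ev" by (rule yon_mor[OF G aG(1)])
  have e: "?e \<in> arr C ?Y (Suc 0)" using id_in[OF D_in] by simp
  have ae: "pmor G ?e a = a" by (rule pmor_id[OF G D_in aG(1)])
  have ie: "ginv C ?Y 0 ?e \<in> arr C ?Y (Suc 0)" by (rule ginv_in[OF Y e])
  have c: "composable ?Y (Suc 0) 0 (ginv C ?Y 0 ?e) ?e" "composable ?Y (Suc 0) 0 ?e (ginv C ?Y 0 ?e)"
    using e ie Y by (simp_all only: composable_def msrc_one mtgt_one src_ginv tgt_ginv) simp_all
  have fill: "htp C G 1 (pmor G p a) (pmor G q a)"
    if p: "p \<in> arr C ?Y (Suc 0)" and q: "q \<in> arr C ?Y (Suc 0)" and pq: "parallel ?Y (Suc 0) p q" for p q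
  proof -
    obtain h where "h \<in> arr C ?Y (Suc 1)" "src C ?Y (Suc 1) h = p" "tgt C ?Y (Suc 1) h = q"
      using disk_filler[of 1 1 p q] p q pq by auto
    then have "htp C ?Y 1 p q" unfolding htp_def by blast
    then show ?thesis using htp_mor[OF ev] by blast
  qed
  have se: "src C ?Y (Suc 0) ?e \<in> arr C ?Y 0" "tgt C ?Y (Suc 0) ?e \<in> arr C ?Y 0"
    using src_in[OF Y e] tgt_in[OF Y e] .
  have xy: "pmor G (src C ?Y (Suc 0) ?e) a = x" "pmor G (tgt C ?Y (Suc 0) ?e) a = y"
    using mor_src[OF ev e] mor_tgt[OF ev e] ae aG by simp_all
  have "parallel ?Y (Suc 0) (gcomp C ?Y (Suc 0) 0 (ginv C ?Y 0 ?e) ?e) (gunit C ?Y 0 (src C ?Y (Suc 0) ?e))"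
    unfolding parallel_def src_gcomp[OF Y c(1)] src_gunit[OF Y se(1)] tgt_gunit[OF Y se(1)] tgt_ginv[OF Y e] by simp
  from fill[OF gcomp_in[OF Y c(1)] gunit_in[OF Y se(1)] this]
  show "htp C G 1 (gcomp C G 1 0 (ginv C G 0 a) a) (gunit C G 0 x)"
    using mor_gcomp[OF Y G ev c(1)] mor_gunit[OF ev se(1)] mor_ginv[OF ev e] ae xy by simp
  have "parallel ?Y (Suc 0) (gcomp C ?Y (Suc 0) 0 ?e (ginv C ?Y 0 ?e)) (gunit C ?Y 0 (tgt C ?Y (Suc 0) ?e))"
    unfolding parallel_def src_gcomp[OF Y c(2)] src_gunit[OF Y se(2)] tgt_gunit[OF Y se(2)] src_ginv[OF Y e] by simp
  from fill[OF gcomp_in[OF Y c(2)] gunit_in[OF Y se(2)] this]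
  show "htp C G 1 (gcomp C G 1 0 a (ginv C G 0 a)) (gunit C G 0 y)"
    using mor_gcomp[OF Y G ev c(2)] mor_gunit[OF ev se(2)] mor_ginv[OF ev e] ae xy by simp
qed

text \<open>Every 1-arrow is invertible up to homotopy, so isomorphism of objects amounts to the
  existence of an arrow.\<close>

lemma pi1_isomorphic_iff: assumes G: "grpd G" and xy: "x \<in> arr C G 0" "y \<in> arr C G 0"
  shows "pi1_isomorphic C G x y \<longleftrightarrow> htp C G 0 x y"
proof
  assume "pi1_isomorphic C G x y"
  then obtain P where "P \<in> pin C G 1 x y" by (auto simp: pi1_isomorphic_def)
  then obtain a where "a \<in> parrows C G 1 x y" by (auto simp: pin_def elim: quotientE)
  then show "htp C G 0 x y" by (auto simp: htp_def parrows_def)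
next
  assume "htp C G 0 x y"
  then obtain a where a: "a \<in> parrows C G 1 x y" by (auto simp: htp_def parrows_def)
  let ?b = "ginv C G 0 a"
  have b: "?b \<in> parrows C G 1 y x" using a G by (auto simp: parrows_def src_ginv tgt_ginv)
  have a': "a \<in> parrows C G (Suc 0) x y" and b': "?b \<in> parrows C G (Suc 0) y x" using a b by simp_all
  have u: "gunit C G 0 z \<in> parrows C G (Suc 0) z z" if "z \<in> arr C G 0" for z
    using that G by (auto simp: parrows_def src_gunit tgt_gunit)
  let ?P = "htpy_rel C G 1 (parrows C G 1 x y) `` {a}" and ?Q = "htpy_rel C G 1 (parrows C G 1 y x) `` {?b}"
  have "pi1_comp C G x x ?Q ?P = pi1_id C G x"
    using gcomp_class[OF G b' a'] ginv_gcomp(1)[OF G a] gcomp_parrows[OF G b' a'] u[OF xy(1)]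
    unfolding pi1_comp_def pi1_id_def One_nat_def
    by (simp add: eq_equiv_class_iff[OF parrows_equiv[OF G]] htpy_rel_iff)
  moreover have "pi1_comp C G y y ?P ?Q = pi1_id C G y"
    using gcomp_class[OF G a' b'] ginv_gcomp(2)[OF G a] gcomp_parrows[OF G a' b'] u[OF xy(2)]
    unfolding pi1_comp_def pi1_id_def One_nat_def
    by (simp add: eq_equiv_class_iff[OF parrows_equiv[OF G]] htpy_rel_iff)
  moreover have "?P \<in> pin C G 1 x y" "?Q \<in> pin C G 1 y x" using a b by (auto simp: pin_def intro: quotientI)
  ultimately show "pi1_isomorphic C G x y" unfolding pi1_isomorphic_def by blast
qed

text \<open>If \<open>u\<close> and \<open>v\<close> are joined by an arrow, whiskering reduces the
  claim to loops at \<open>u\<close>. Otherwise injectivity one dimension below (for objects,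
  injectivity on pi_0, the assumption labelled \<open>coproj0\<close>) shows that their images are
  not joined either, and both hom-sets are empty.\<close>

lemma local_bij_of_loops: assumes G: "grpd G" and H: "grpd H" and f: "mor G H f"
   and loops: "\<And>k u. u \<in> arr C G k \<Longrightarrow> local_bij C G H f k u u"
   and coproj0: "\<And>x y. x \<in> arr C G 0 \<Longrightarrow> y \<in> arr C G 0 \<Longrightarrow> htp C H 0 (f (gD C 0) x) (f (gD C 0) y) \<Longrightarrow> htp C G 0 x y"
  shows "u \<in> arr C G k \<Longrightarrow> v \<in> arr C G k \<Longrightarrow> parallel G k u v \<Longrightarrow> local_bij C G H f k u v"
proof (induction k arbitrary: u v)
  have ne: "local_bij C G H f k u v" if uv: "u \<in> arr C G k" "v \<in> arr C G k" and htp: "htp C G k u v" for k u v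
  proof -
    obtain a where a: "a \<in> parrows C G (Suc k) u v" using htp by (auto simp: htp_def parrows_def)
    then have "ginv C G k a \<in> parrows C G (Suc k) v u" using G by (auto simp: parrows_def src_ginv tgt_ginv)
    moreover have "gunit C G k u \<in> parrows C G (Suc k) u u"
      using uv G by (auto simp: parrows_def src_gunit tgt_gunit)
    ultimately show ?thesis using local_bij_conj_base[OF G H f _ _ loops[OF uv(1)]] by blast
  qed
  have em: "local_bij C G H f k u v" if "\<not> htp C G k u v" "\<not> htp C H k (f (gD C k) u) (f (gD C k) v)" for k u v
    using that by (auto simp: local_bij_def htp_bij_def parrows_def htp_def)
  {
    case 0
    then show ?case using ne em coproj0 by blast
  next
    case (Suc k)
    let ?x = "src C G (Suc k) u" and ?y = "tgt C G (Suc k) u"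
    have "parallel G k ?x ?y"
    proof (cases k)
      case (Suc k')
      then show ?thesis using Suc.prems(1) G src_src[OF G, of u k'] tgt_tgt[OF G, of u k'] by (simp add: parallel_def)
    qed (simp add: parallel_def)
    \<comment> \<open>The parallel arrows \<open>u\<close>, \<open>v\<close> belong to one hom-set
      between k-arrows, where the induction hypothesis provides injectivity.\<close>
    then have "local_bij C G H f k ?x ?y" using Suc.IH src_in[OF G Suc.prems(1)] tgt_in[OF G Suc.prems(1)] by blast
    moreover have "u \<in> parrows C G (Suc k) ?x ?y" "v \<in> parrows C G (Suc k) ?x ?y"
      using Suc.prems by (simp_all add: parrows_def parallel_def)
    ultimately have "htp C H (Suc k) (f (gD C (Suc k)) u) (f (gD C (Suc k)) v) \<Longrightarrow> htp C G (Suc k) u v"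
      unfolding local_bij_def htp_bij_def by blast
    then show ?case using ne em Suc.prems by blast
  }
qed

section \<open>The four conditions on representatives\<close>

lemma weak_equivalence_iff: assumes G: "grpd G" and H: "grpd H" and f: "mor G H f"
  shows "weak_equivalence C G H f \<longleftrightarrow> bij_betw (pi0_map C H f) (pi0 C G) (pi0 C H) \<and>
    (\<forall>k. \<forall>x\<in>arr C G 0. local_bij C G H f k (gunits C G 0 k x) (gunits C G 0 k x))"
proof -
  have "gunits C H 0 k (f (gD C 0) x) = f (gD C k) (gunits C G 0 k x)" if "x \<in> arr C G 0" for k x
    using mor_gunits[OF G f that, of k] by simp
  then show ?thesis
    unfolding weak_equivalence_def all_ge_1_iff diff_Suc_1 by (simp add: pin_map_iso_iff[OF assms])
qed

lemma cond2_iff: assumes "grpd G" "grpd H" "mor G H f"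
  shows "cond2 C G H f \<longleftrightarrow> bij_betw (pi0_map C H f) (pi0 C G) (pi0 C H) \<and>
    (\<forall>k. \<forall>u\<in>arr C G k. local_bij C G H f k u u)"
  unfolding cond2_def all_ge_1_iff diff_Suc_1 by (simp add: pin_map_iso_iff[OF assms])

lemma ess_surj_iff: assumes "grpd H" "mor G H f"
  shows "Pi1_ess_surj C G H f \<longleftrightarrow> (\<forall>y\<in>arr C H 0. \<exists>x\<in>arr C G 0. htp C H 0 (f (gD C 0) x) y)"
  unfolding Pi1_ess_surj_def using assms(2)
  by (simp add: pi1_isomorphic_iff[OF assms(1)] mor_in cong: bex_cong)

text \<open>Since \<open>parallel\<close> imposes nothing in dimension 0, full faithfulness of
  Pi_1(f) is the case k = 0 of the statement on parallel pairs; the bijections for n >= 2 are the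
  cases k = n - 1.\<close>

lemma cond3_iff: assumes "grpd G" "grpd H" "mor G H f"
  shows "cond3 C G H f \<longleftrightarrow> (\<forall>y\<in>arr C H 0. \<exists>x\<in>arr C G 0. htp C H 0 (f (gD C 0) x) y) \<and>
    (\<forall>k. \<forall>u\<in>arr C G k. \<forall>v\<in>arr C G k. parallel G k u v \<longrightarrow> local_bij C G H f k u v)"
proof -
  have ff: "Pi1_full C G H f \<and> Pi1_faithful C G H f \<longleftrightarrow> (\<forall>x\<in>arr C G 0. \<forall>y\<in>arr C G 0. local_bij C G H f 0 x y)"
    unfolding Pi1_full_def Pi1_faithful_def One_nat_def pin_map_surj_iff[OF assms] pin_map_inj_iff[OF assms]
      local_bij_def htp_bij_def by blast
  show ?thesis
    unfolding cond3_def Pi1_equivalence_def all_ge_2_iff diff_Suc_1 pin_map_bij_iff[OF assms] ess_surj_iff[OF assms(2,3)]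
      all_nat_split[of "\<lambda>k. \<forall>u\<in>arr C G k. \<forall>v\<in>arr C G k. parallel G k u v \<longrightarrow> local_bij C G H f k u v"]
    by (simp add: parallel_def ff[symmetric] conj_ac imp_conjL)
qed

lemma cond4_iff: assumes "grpd G" "grpd H" "mor G H f"
  shows "cond4 C G H f \<longleftrightarrow> (\<forall>y\<in>arr C H 0. \<exists>x\<in>arr C G 0. htp C H 0 (f (gD C 0) x) y) \<and>
    (\<forall>k. \<forall>u\<in>arr C G k. \<forall>v\<in>arr C G k. parallel G k u v \<longrightarrow>
      (\<forall>c\<in>parrows C H (Suc k) (f (gD C k) u) (f (gD C k) v).
        \<exists>a\<in>parrows C G (Suc k) u v. htp C H (Suc k) (f (gD C (Suc k)) a) c))" (is "_ \<longleftrightarrow> ?S \<and> (\<forall>k. ?P k)")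
proof -
  have "Pi1_full C G H f \<longleftrightarrow> ?P 0"
    unfolding Pi1_full_def One_nat_def pin_map_surj_iff[OF assms] by (simp add: parallel_def)
  moreover have "(\<forall>k. ?P k) \<longleftrightarrow> ?P 0 \<and> (\<forall>k. ?P (Suc k))" by (rule all_nat_split)
  ultimately show ?thesis
    unfolding cond4_def all_ge_2_iff diff_Suc_1 pin_map_surj_iff[OF assms] ess_surj_iff[OF assms(2,3)]
    by (simp add: parallel_def conj_ac imp_conjL)
qed

lemma weak_equivalence_cond2: assumes G: "grpd G" and H: "grpd H" and f: "mor G H f"
  shows "weak_equivalence C G H f \<longleftrightarrow> cond2 C G H f"
  unfolding weak_equivalence_iff[OF assms] cond2_iff[OF assms]
  using local_bij_from_units[OF assms] gunits_in[OF G, of _ 0] by (metis add_0)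

lemma cond2_cond3: assumes G: "grpd G" and H: "grpd H" and f: "mor G H f"
  shows "cond2 C G H f \<longleftrightarrow> cond3 C G H f"
proof
  assume "cond2 C G H f"
  then have c: "\<forall>y\<in>arr C H 0. \<exists>x\<in>arr C G 0. htp C H 0 (f (gD C 0) x) y"
      "\<And>x y. x \<in> arr C G 0 \<Longrightarrow> y \<in> arr C G 0 \<Longrightarrow> htp C H 0 (f (gD C 0) x) (f (gD C 0) y) \<Longrightarrow> htp C G 0 x y"
      "\<And>k u. u \<in> arr C G k \<Longrightarrow> local_bij C G H f k u u"
    by (simp_all add: cond2_iff[OF assms] pi0_map_bij_iff[OF assms])
  show "cond3 C G H f" unfolding cond3_iff[OF assms] using c(1) local_bij_of_loops[OF assms c(3,2)] by simp
next
  assume "cond3 C G H f"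
  then have c: "\<forall>y\<in>arr C H 0. \<exists>x\<in>arr C G 0. htp C H 0 (f (gD C 0) x) y"
      "\<And>k u v. u \<in> arr C G k \<Longrightarrow> v \<in> arr C G k \<Longrightarrow> parallel G k u v \<Longrightarrow> local_bij C G H f k u v"
    by (simp_all add: cond3_iff[OF assms])
  \<comment> \<open>Injectivity on pi_0: a 1-arrow between the images of \<open>x\<close> and
    \<open>y\<close> is hit, up to homotopy, by a 1-arrow from \<open>x\<close> to
    \<open>y\<close>.\<close>
  have "htp C G 0 x y" if xy: "x \<in> arr C G 0" "y \<in> arr C G 0" and h: "htp C H 0 (f (gD C 0) x) (f (gD C 0) y)" for x y
  proof -
    obtain a where "a \<in> parrows C H (Suc 0) (f (gD C 0) x) (f (gD C 0) y)"
      using h by (auto simp: htp_def parrows_def)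
    then obtain b where "b \<in> parrows C G (Suc 0) x y"
      using c(2)[OF xy] unfolding local_bij_def htp_bij_def parallel_def by blast
    then show ?thesis by (auto simp: htp_def parrows_def)
  qed
  then show "cond2 C G H f"
    unfolding cond2_iff[OF assms] pi0_map_bij_iff[OF assms] using c by (simp add: parallel_def)
qed

text \<open>Injectivity in dimension \<open>n\<close> is surjectivity in dimension \<open>n + 1\<close>, applied to the
  parallel pair formed by two arrows with homotopic images.\<close>

lemma cond3_cond4: assumes G: "grpd G" and H: "grpd H" and f: "mor G H f"
  shows "cond3 C G H f \<longleftrightarrow> cond4 C G H f"
proof
  assume "cond3 C G H f"
  then show "cond4 C G H f" unfolding cond3_iff[OF assms] cond4_iff[OF assms] local_bij_def htp_bij_def by blast
next
  assume "cond4 C G H f"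
  then have s: "\<forall>y\<in>arr C H 0. \<exists>x\<in>arr C G 0. htp C H 0 (f (gD C 0) x) y"
    and c: "\<And>k u v c. u \<in> arr C G k \<Longrightarrow> v \<in> arr C G k \<Longrightarrow> parallel G k u v \<Longrightarrow>
      c \<in> parrows C H (Suc k) (f (gD C k) u) (f (gD C k) v) \<Longrightarrow>
      \<exists>a\<in>parrows C G (Suc k) u v. htp C H (Suc k) (f (gD C (Suc k)) a) c"
    by (simp_all add: cond4_iff[OF assms])
  have "htp C G (Suc k) a b" if a: "a \<in> parrows C G (Suc k) u v" and b: "b \<in> parrows C G (Suc k) u v"
    and h: "htp C H (Suc k) (f (gD C (Suc k)) a) (f (gD C (Suc k)) b)" for k u v a b
  proof -
    have ab: "a \<in> arr C G (Suc k)" "b \<in> arr C G (Suc k)" "parallel G (Suc k) a b"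
      using a b by (auto simp: parrows_def parallel_def)
    obtain d where "d \<in> parrows C H (Suc (Suc k)) (f (gD C (Suc k)) a) (f (gD C (Suc k)) b)"
      using h by (auto simp: htp_def parrows_def)
    from c[OF ab this] show ?thesis by (auto simp: htp_def parrows_def)
  qed
  then show "cond3 C G H f" unfolding cond3_iff[OF assms] local_bij_def htp_bij_def using s c by blast
qed

end

theorem theorem4:
  fixes C :: "('o,'m) gcat" and G :: "('o,'m,'a) psh" and H :: "('o,'m,'b) psh"
    and f :: "'o \<Rightarrow> 'a \<Rightarrow> 'b"
  assumes "globular_extension C" and "contractible C" and "pregroupoidal C"
    and "infty_groupoid C G" and "infty_groupoid C H"
    and "groupoid_morphism C G H f"
  shows "(weak_equivalence C G H f \<longleftrightarrow> cond2 C G H f) \<and>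
         (cond2 C G H f \<longleftrightarrow> cond3 C G H f) \<and>
         (cond3 C G H f \<longleftrightarrow> cond4 C G H f)"
proof -
  interpret pregroupoidal_extension C using assms(1-3) by unfold_locales
  show ?thesis
    using weak_equivalence_cond2[OF assms(4-6)] cond2_cond3[OF assms(4-6)] cond3_cond4[OF assms(4-6)] by blast
qed

end
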